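(* Let $a>1$, $\sigma^2>0$, $Z_i$ i.i.d. $\mathcal{N}(0,\sigma^2)$, $U_0=0$, $U_i=aU_{i-1}+Z_i$. For any fixed $\epsilon\in(0,1)$ and $d\in(0,\frac{\sigma^2}{a^2-1})$, $$R(n,d,\epsilon)\le\mathbb{R}_U(d)+\sqrt{\frac{\mathbb{V}_U(d)}n}\,Q^{-1}(\epsilon)+O\!\left(\frac1{\sqrt n\log n}\right).$$
   Context: Distortion: $\mathsf{d}(x_1^n,y_1^n)=\frac1n\sum_{i=1}^n(x_i-y_i)^2$. An $(n,M,d,\epsilon)$ code consists of $f:\mathbb{R}^n\to\{1,\ldots,M\}$ and $g:\{1,\ldots,M\}\to\mathbb{R}^n$ with $\mathbb{P}[\mathsf{d}(U_1^n,g(f(U_1^n)))>d]\le\epsilon$; $R(n,d,\epsilon)=\frac1n\log\min\{M:\exists(n,M,d,\epsilon)\text{ code}\}$. $g(w)=1+a^2-2a\cos w$; $\theta>0$ solves $d=\frac1{2\pi}\int_{-\pi}^{\pi}\min(\theta,\sigma^2/g(w))dw$; $\mathbb{R}_U(d)=\frac1{2\pi}\int_{-\pi}^{\pi}\frac12\log\max(g(w),\sigma^2/\theta)dw$; $\mathbb{V}_U(d)=\frac1{4\pi}\int_{-\pi}^{\pi}\min[1,(\sigma^2/(\theta g(w)))^2]dw$. $Q^{-1}$ is the inverse standard Gaussian tail function. *)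

theory Defs
  imports "HOL-Probability.Probability"
begin

definition gspec :: "real \<Rightarrow> real \<Rightarrow> real" where
  "gspec a w = 1 + a\<^sup>2 - 2 * a * cos w"

text \<open>Reverse water-filling level theta (sig2 = sigma^2 is the innovation variance).\<close>
definition water_level :: "real \<Rightarrow> real \<Rightarrow> real \<Rightarrow> real" where
  "water_level a sig2 d = (THE th. th > 0 \<and>
      d = 1 / (2 * pi) * (LBINT w=-pi..pi. min th (sig2 / gspec a w)))"

definition RU :: "real \<Rightarrow> real \<Rightarrow> real \<Rightarrow> real" where
  "RU a sig2 d = 1 / (2 * pi) * (LBINT w=-pi..pi.
      1/2 * ln (max (gspec a w) (sig2 / water_level a sig2 d)))"

definition VU :: "real \<Rightarrow> real \<Rightarrow> real \<Rightarrow> real" where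
  "VU a sig2 d = 1 / (4 * pi) * (LBINT w=-pi..pi.
      min 1 ((sig2 / (water_level a sig2 d * gspec a w))\<^sup>2))"

definition Qfun :: "real \<Rightarrow> real" where
  "Qfun x = (LBINT t=x..\<infinity>. std_normal_density t)"

definition Qinv :: "real \<Rightarrow> real" where
  "Qinv e = (THE x. Qfun x = e)"

primrec GM :: "real \<Rightarrow> (nat \<Rightarrow> 'w \<Rightarrow> real) \<Rightarrow> nat \<Rightarrow> 'w \<Rightarrow> real" where
  "GM a Z 0 \<omega> = 0"
| "GM a Z (Suc i) \<omega> = a * GM a Z i \<omega> + Z (Suc i) \<omega>"

definition distortion :: "nat \<Rightarrow> (nat \<Rightarrow> real) \<Rightarrow> (nat \<Rightarrow> real) \<Rightarrow> real" where
  "distortion n x y = 1 / real n * (\<Sum>i=1..n. (x i - y i)\<^sup>2)"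

text \<open>An (n, Mc, d, eps) code for the source U on probability space M: the encoder
  f maps R^n (vectors represented as functions on nat, only coordinates 1..n matter)
  to {1..Mc}; the decoder g maps {1..Mc} to R^n (only coordinates 1..n are used).\<close>
definition is_code :: "'w measure \<Rightarrow> (nat \<Rightarrow> 'w \<Rightarrow> real) \<Rightarrow> nat \<Rightarrow> nat \<Rightarrow> real \<Rightarrow> real
    \<Rightarrow> ((nat \<Rightarrow> real) \<Rightarrow> nat) \<Rightarrow> (nat \<Rightarrow> nat \<Rightarrow> real) \<Rightarrow> bool" where
  "is_code M U n Mc d eps f g \<longleftrightarrow>
     (\<forall>x. f x \<in> {1..Mc}) \<and>
     (\<forall>x y. (\<forall>i\<in>{1..n}. x i = y i) \<longrightarrow> f x = f y) \<and>
     {\<omega> \<in> space M. distortion n (\<lambda>i. U i \<omega>) (g (f (\<lambda>i. U i \<omega>))) > d} \<in> sets M \<and>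
     measure M {\<omega> \<in> space M. distortion n (\<lambda>i. U i \<omega>) (g (f (\<lambda>i. U i \<omega>))) > d} \<le> eps"

definition Rop :: "'w measure \<Rightarrow> (nat \<Rightarrow> 'w \<Rightarrow> real) \<Rightarrow> nat \<Rightarrow> real \<Rightarrow> real \<Rightarrow> real" where
  "Rop M U n d eps = 1 / real n * ln (real (Inf {Mc. \<exists>f g. is_code M U n Mc d eps f g}))"

end

theory Submission
  imports Defs "HOL-Real_Asymp.Real_Asymp"
begin

text \<open>Let \<open>U_n\<close> be the last state. The vector \<open>(U_1, \<dots>, U_{n-1})\<close> has, given \<open>U_n\<close>, a tridiagonal Toeplitz
  precision matrix, so in the sine basis its coefficients are \<open>\<sigma> N_k / sqrt g(k\<pi>/n)\<close> with i.i.d. standard normal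
  \<open>N_k\<close>, up to a bounded multiple of \<open>U_n\<close>. Describing \<open>U_n\<close> to precision \<open>1/n\<close> costs \<open>n ln a + O(ln n)\<close> nats, and by
  Jensen's formula for \<open>g\<close> the rest is the reverse water-filling rate of the remaining coefficients.
  Codewords consist of a uniform guess of \<open>U_n\<close> and independent Gaussian coefficients; a greedy choice turns a lower bound on the probability that a
  random codeword is within the admissible distance of a typical source into a codebook. That probability is
  computed by passing to the conditional law of the codeword given the source, under which the distance is a sum of
  independent variables. It only has to fall into a window of length of order \<open>sqrt n / ln n\<close>, and it does so with
  probability at least \<open>1/n\<close>. Both this and the normal approximation of the tilted information up to \<open>O(1 / ln n)\<close>
  follow from Lindeberg's replacement argument.\<close>
section \<open>The sine basis\<close>

text \<open>The obstacle is instability: the variance of \<open>U_n\<close> grows like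
  \<open>a^(2n)\<close>, while given \<open>U_n\<close> every direction of the past has bounded
  variance. Fixing the final state isolates the unstable direction. It also imposes zero boundary
  values at both ends, so the eigenvalues \<open>g(k pi/n)\<close> are exact and only Riemann sums
  of Lipschitz functions have to be compared with integrals. The claimed remainder tolerates
  \<open>O(sqrt n / ln n)\<close> nats and an error probability of \<open>O(1 / ln n)\<close>, and
  this fixes all scales. Smoothing at width \<open>\<delta> = sqrt n / ln n\<close> makes the
  Lindeberg error of order \<open>n / \<delta>^3 = (ln n)^3 / sqrt n\<close>. Atypical sources are
  removed by Chebyshev and Markov, with thresholds \<open>R^2\<close> proportional to
  \<open>n ln n\<close> and \<open>T = n ln n\<close>, one logarithm above the natural size. The
  constant in \<open>R\<close> is small enough for the Gaussian factor at distance \<open>R\<close>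
  from the mean to be about \<open>n^(-1/4)\<close>, which still dominates the Lindeberg error. A
  polynomially small ball probability then costs only \<open>O(ln n)\<close> nats.\<close>

lemma AR_step:
  fixes a :: real
  shows "(s2 - a * s1) * (u2 - a * u1)
    = ((1 + a\<^sup>2) * s1 - a * (s2 + s0)) * u1 + s2 * u2 - a * s1 * u2 - (s1 * u1 - a * s0 * u1)"
  by (simp add: algebra_simps power2_eq_square)

text \<open>Moving the operator \<open>x_i - a x_(i-1)\<close> from \<open>U\<close> to
  \<open>s\<close> produces the tridiagonal stencil with diagonal \<open>1 + a\<^sup>2\<close> and
  off-diagonal \<open>-a\<close>. Both sequences vanish at 0, so only terms at the right end
  survive.\<close>

lemma summation_by_parts_AR:
  fixes s U :: "nat \<Rightarrow> real"
  assumes "s 0 = 0" "U 0 = 0"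
  shows "(\<Sum>i=1..Suc m. (s i - a * s (i-1)) * (U i - a * U (i-1)))
    = (\<Sum>i=1..m. ((1 + a\<^sup>2) * s i - a * (s (Suc i) + s (i-1))) * U i)
      + s (Suc m) * U (Suc m) - a * s m * U (Suc m)"
proof (induction m)
  case 0
  then show ?case using assms by simp
next
  case (Suc m)
  have "(\<Sum>i=1..Suc (Suc m). (s i - a * s (i-1)) * (U i - a * U (i-1)))
    = (\<Sum>i=1..Suc m. (s i - a * s (i-1)) * (U i - a * U (i-1)))
      + (s (Suc (Suc m)) - a * s (Suc m)) * (U (Suc (Suc m)) - a * U (Suc m))"
    by simp
  moreover have "(s (Suc (Suc m)) - a * s (Suc m)) * (U (Suc (Suc m)) - a * U (Suc m))
    = ((1 + a\<^sup>2) * s (Suc m) - a * (s (Suc (Suc m)) + s m)) * U (Suc m)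
      + s (Suc (Suc m)) * U (Suc (Suc m)) - a * s (Suc m) * U (Suc (Suc m))
      - (s (Suc m) * U (Suc m) - a * s m * U (Suc m))"
    by (rule AR_step)
  ultimately show ?case unfolding Suc.IH by simp
qed

text \<open>The discrete sine transform with zero values at \<open>i = 0\<close> and
  \<open>i = n\<close>; the relevant indices are \<open>{1..<n}\<close> both for time and for
  frequency, and the factor \<open>sqrt (2 / n)\<close> normalises the rows.\<close>

definition sine_basis :: "nat \<Rightarrow> nat \<Rightarrow> nat \<Rightarrow> real" where
  "sine_basis n k i = sqrt (2 / real n) * sin (real i * (real k * pi / real n))"

definition freq :: "nat \<Rightarrow> nat \<Rightarrow> real" where
  "freq n k = real k * pi / real n"

lemma sine_basis_0 [simp]: "sine_basis n k 0 = 0"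
  by (simp add: sine_basis_def)

lemma sine_basis_n [simp]: "n > 0 \<Longrightarrow> sine_basis n k n = 0"
  by (simp add: sine_basis_def)

text \<open>Symmetry makes the orthonormal matrix its own inverse, so completeness and Parseval
  follow from orthonormality of the rows.\<close>

lemma sine_basis_commute: "sine_basis n k i = sine_basis n i k"
  by (simp add: sine_basis_def mult_ac)

lemma sine_basis_neighbours:
  assumes "i \<ge> 1"
  shows "sine_basis n k (Suc i) + sine_basis n k (i-1) = 2 * cos (freq n k) * sine_basis n k i"
proof -
  define w where "w = real k * pi / real n"
  have 1: "real (Suc i) * w = real i * w + w" "real (i-1) * w = real i * w - w"
    using assms by (simp_all add: algebra_simps of_nat_diff)
  show ?thesis
    unfolding sine_basis_def freq_def w_def[symmetric] 1
    by (simp add: sin_add sin_diff algebra_simps)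
qed

text \<open>The precision matrix of the source, restricted to vectors vanishing at time \<open>n\<close>, is the
  tridiagonal Toeplitz matrix diagonalised by the sine basis; the last term is the effect of the end point.\<close>

lemma sine_basis_innovations:
  assumes "n > 0" "U 0 = 0"
  shows "(\<Sum>i=1..n. (sine_basis n k i - a * sine_basis n k (i-1)) * (U i - a * U (i-1)))
    = gspec a (freq n k) * (\<Sum>i\<in>{1..<n}. sine_basis n k i * U i) - a * sine_basis n k (n-1) * U n"
proof -
  obtain m where m: "n = Suc m" using assms by (cases n) auto
  have eig: "((1 + a\<^sup>2) * sine_basis n k i - a * (sine_basis n k (Suc i) + sine_basis n k (i-1))) * U i
     = gspec a (freq n k) * (sine_basis n k i * U i)" if "i \<in> {1..m}" for i
    using that by (subst sine_basis_neighbours) (auto simp: gspec_def algebra_simps)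
  have "(\<Sum>i=1..m. ((1 + a\<^sup>2) * sine_basis n k i - a * (sine_basis n k (Suc i) + sine_basis n k (i-1))) * U i)
     = gspec a (freq n k) * (\<Sum>i\<in>{1..m}. sine_basis n k i * U i)"
    unfolding sum_distrib_left by (intro sum.cong refl eig)
  moreover have "sine_basis n k (Suc m) = 0" using sine_basis_n[of n k] assms m by simp
  ultimately show ?thesis
    unfolding m using summation_by_parts_AR[of "sine_basis n k" U a m] assms
    by (simp add: m atLeastLessThanSuc_atLeastAtMost del: sum.cl_ivl_Suc)
qed

text \<open>The doubled angles run through the powers of an \<open>n\<close>-th root of unity. It
  differs from 1 because the frequency lies strictly between 0 and \<open>pi\<close>, hence the
  cosine part of \<open>sin\<^sup>2 = (1 - cos) / 2\<close> sums to zero.\<close>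

lemma sum_sin_squared:
  assumes "k \<in> {1..<n}"
  shows "(\<Sum>i\<in>{1..<n}. (sin (real i * freq n k))\<^sup>2) = real n / 2"
proof -
  have n: "n > 0" using assms by auto
  define z where "z = cis (2 * freq n k)"
  have zn: "z ^ n = 1"
  proof -
    have "z ^ n = cis (2 * pi * real k)"
      using n by (simp add: z_def freq_def Complex.DeMoivre mult_ac)
    then show ?thesis by simp
  qed
  have z1: "z \<noteq> 1"
  proof
    assume "z = 1"
    then have "cos (2 * freq n k) = 1" by (simp add: z_def complex_eq_iff)
    then have "(sin (freq n k))\<^sup>2 = 0" by (simp add: cos_double_sin)
    then have "sin (freq n k) = 0" by simp
    moreover have "0 < freq n k" "freq n k < pi" using assms by (auto simp: freq_def field_simps)
    ultimately show False using sin_gt_zero[of "freq n k"] by simp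
  qed
  have "(\<Sum>i<n. z ^ i) = 0" using z1 zn by (simp add: sum_gp_strict)
  then have "Re (\<Sum>i<n. z ^ i) = 0" by simp
  then have c: "(\<Sum>i<n. cos (2 * (real i * freq n k))) = 0"
    by (simp add: z_def Complex.DeMoivre mult_ac)
  have "(\<Sum>i\<in>{1..<n}. (sin (real i * freq n k))\<^sup>2) = (\<Sum>i<n. (sin (real i * freq n k))\<^sup>2)"
    by (rule sum.mono_neutral_left) (auto simp: not_le less_Suc_eq_0_disj Suc_le_eq)
  also have "\<dots> = (\<Sum>i<n. 1/2 - cos (2 * (real i * freq n k)) / 2)"
    by (intro sum.cong refl) (subst cos_double_sin, simp add: field_simps)
  also have "\<dots> = real n / 2"
    by (simp add: sum_subtractf c flip: sum_divide_distrib)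
  finally show ?thesis .
qed

lemma freq_bounds:
  assumes "k \<in> {1..<n}" shows "0 < freq n k" "freq n k < pi"
  using assms by (auto simp: freq_def field_simps)

lemma sine_basis_orthonormal:
  assumes "j \<in> {1..<n}" "k \<in> {1..<n}"
  shows "(\<Sum>i\<in>{1..<n}. sine_basis n j i * sine_basis n k i) = (if j = k then 1 else 0)"
proof (cases "j = k")
  case True
  have "sine_basis n j i * sine_basis n k i = 2 / real n * (sin (real i * freq n k))\<^sup>2" for i
  proof -
    have "sine_basis n j i * sine_basis n k i
        = (sqrt (2 / real n) * sqrt (2 / real n)) * (sin (real i * freq n k) * sin (real i * freq n k))"
      unfolding True sine_basis_def freq_def by (rule mult.assoc[symmetric, THEN trans]) (simp only: mult_ac)
    then show ?thesis by (simp add: power2_eq_square)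
  qed
  then have "(\<Sum>i\<in>{1..<n}. sine_basis n j i * sine_basis n k i)
      = 2 / real n * (\<Sum>i\<in>{1..<n}. (sin (real i * freq n k))\<^sup>2)"
    by (simp add: sum_distrib_left)
  then show ?thesis unfolding sum_sin_squared[OF assms(2)] using assms True by simp
next
  case False
  have n: "n > 0" using assms by auto
  \<comment> \<open>Eigenvectors of a symmetric form with distinct eigenvalues are orthogonal. The
    form is the product of plain differences, i.e. the innovations with \<open>a = 1\<close>;
    evaluating it from either side gives the eigenvalue of \<open>j\<close> or that of
    \<open>k\<close>.\<close>
  have "(gspec 1 (freq n j) - gspec 1 (freq n k)) * (\<Sum>i\<in>{1..<n}. sine_basis n j i * sine_basis n k i) = 0"
  proof -
    define D where "D l i = sine_basis n l i - 1 * sine_basis n l (i-1)" for l i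
    have "(\<Sum>i=1..n. D j i * D k i) = gspec 1 (freq n j) * (\<Sum>i\<in>{1..<n}. sine_basis n j i * sine_basis n k i)"
      using sine_basis_innovations[of n "sine_basis n k" j 1] n by (simp add: D_def)
    moreover have "(\<Sum>i=1..n. D k i * D j i) = gspec 1 (freq n k) * (\<Sum>i\<in>{1..<n}. sine_basis n k i * sine_basis n j i)"
      using sine_basis_innovations[of n "sine_basis n j" k 1] n by (simp add: D_def)
    moreover have "(\<Sum>i=1..n. D k i * D j i) = (\<Sum>i=1..n. D j i * D k i)"
      by (intro sum.cong refl mult.commute)
    moreover have "(\<Sum>i\<in>{1..<n}. sine_basis n k i * sine_basis n j i) = (\<Sum>i\<in>{1..<n}. sine_basis n j i * sine_basis n k i)"
      by (intro sum.cong refl mult.commute)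
    ultimately show ?thesis unfolding left_diff_distrib right_minus_eq by (simp only:)
  qed
  moreover have "cos (freq n j) \<noteq> cos (freq n k)"
  proof
    assume "cos (freq n j) = cos (freq n k)"
    then have "freq n j = freq n k"
      using cos_inj_pi[of "freq n j" "freq n k"] freq_bounds[OF assms(1)] freq_bounds[OF assms(2)] by simp
    then show False using False n by (simp add: freq_def)
  qed
  ultimately show ?thesis using False by (simp add: gspec_def)
qed

text \<open>After exchanging the two sums, symmetry turns the inner sum over \<open>k\<close> into
  an inner product of the rows \<open>i\<close> and \<open>j\<close>.\<close>

lemma sine_basis_expand:
  assumes "i \<in> {1..<n}"
  shows "(\<Sum>k\<in>{1..<n}. sine_basis n k i * (\<Sum>j\<in>{1..<n}. sine_basis n k j * x j)) = x i"
proof -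
  have "(\<Sum>k\<in>{1..<n}. sine_basis n k i * (\<Sum>j\<in>{1..<n}. sine_basis n k j * x j))
     = (\<Sum>j\<in>{1..<n}. (\<Sum>k\<in>{1..<n}. sine_basis n i k * sine_basis n j k) * x j)"
  proof -
    have eq: "sine_basis n k i * (sine_basis n k j * x j) = sine_basis n i k * sine_basis n j k * x j" for k j
      using sine_basis_commute[of n k i] sine_basis_commute[of n k j] by simp
    then show ?thesis
      unfolding sum_distrib_left sum_distrib_right by (subst sum.swap) (simp only: eq)
  qed
  also have "\<dots> = (\<Sum>j\<in>{1..<n}. (if i = j then 1 else 0) * x j)"
    by (intro sum.cong refl) (subst sine_basis_orthonormal, use assms in auto)
  also have "\<dots> = (\<Sum>j\<in>{1..<n}. if i = j then x j else 0)"
    by (intro sum.cong) auto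
  also have "\<dots> = x i" using assms by (simp only: sum.delta' finite_atLeastLessThan if_True)
  finally show ?thesis .
qed

lemma sine_basis_Parseval:
  "(\<Sum>i\<in>{1..<n}. (\<Sum>k\<in>{1..<n}. y k * sine_basis n k i)\<^sup>2) = (\<Sum>k\<in>{1..<n}. (y k)\<^sup>2)"
proof -
  have "(\<Sum>i\<in>{1..<n}. (\<Sum>k\<in>{1..<n}. y k * sine_basis n k i)\<^sup>2)
    = (\<Sum>i\<in>{1..<n}. \<Sum>k\<in>{1..<n}. y k * sine_basis n k i * (\<Sum>j\<in>{1..<n}. sine_basis n i j * y j))"
  proof -
    have "(\<Sum>k\<in>{1..<n}. y k * sine_basis n k i) = (\<Sum>j\<in>{1..<n}. sine_basis n i j * y j)" for i
      by (intro sum.cong refl) (subst sine_basis_commute, rule mult.commute)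
    then show ?thesis
      unfolding power2_eq_square sum_distrib_right by simp
  qed
  also have "\<dots> = (\<Sum>k\<in>{1..<n}. y k * (\<Sum>i\<in>{1..<n}. sine_basis n i k * (\<Sum>j\<in>{1..<n}. sine_basis n i j * y j)))"
    by (subst sum.swap) (intro sum.cong refl, subst sum_distrib_left, intro sum.cong refl,
        subst sine_basis_commute, rule mult.assoc)
  also have "\<dots> = (\<Sum>k\<in>{1..<n}. y k * y k)"
    by (intro sum.cong refl arg_cong2[where f="(*)"] sine_basis_expand)
  finally show ?thesis by (simp add: power2_eq_square)
qed

section \<open>Independence of jointly Gaussian variables\<close>

text \<open>The density \<open>w / c\<close> turns \<open>M\<close> into a probability measure under
  which \<open>X\<close> has the standard normal characteristic function, so Levy uniqueness gives
  its law. Bounded weights depending on other variables thereby transfer knowledge of a joint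
  characteristic function to events of \<open>X\<close>.\<close>

lemma weighted_std_normal:
  fixes X w :: "'a \<Rightarrow> real"
  assumes "prob_space M" and X [measurable]: "X \<in> borel_measurable M" and w [measurable]: "w \<in> borel_measurable M"
    and w_bd: "\<And>x. 0 \<le> w x" "\<And>x. w x \<le> B" and "c > 0" and A [measurable]: "A \<in> sets borel"
    and ch: "\<And>s. (CLINT x|M. complex_of_real (w x) * iexp (s * X x)) = complex_of_real (c * exp (- s\<^sup>2 / 2))"
  shows "(LINT x|M. w x * indicator A (X x)) = c * measure std_normal_distribution A"
proof -
  interpret prob_space M by fact
  interpret std: real_distribution std_normal_distribution by (rule real_dist_normal_dist)
  have int_w: "integrable M w"
    by (rule integrable_const_bound[where B=B]) (use w_bd in auto)
  have "complex_of_real (LINT x|M. w x) = (CLINT x|M. complex_of_real (w x) * iexp (0 * X x))" by simp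
  also have "\<dots> = complex_of_real c" by (subst ch) simp
  finally have Ew: "(LINT x|M. w x) = c" by (simp only: of_real_eq_iff)
  define D where "D = density M (\<lambda>x. ennreal (w x / c))"
  have nneg: "0 \<le> w x / c" for x using w_bd \<open>c > 0\<close> by simp
  have "emeasure D (space D) = (\<integral>\<^sup>+x. ennreal (w x / c) \<partial>M)"
    by (simp add: D_def emeasure_density cong: nn_integral_cong)
  also have "\<dots> = ennreal (LINT x|M. w x / c)"
    by (rule nn_integral_eq_integral) (use int_w nneg in auto)
  also have "\<dots> = 1" using Ew \<open>c > 0\<close> by simp
  finally have "prob_space D" by (rule prob_spaceI)
  then interpret D: prob_space D .
  have XD [measurable]: "X \<in> borel_measurable D" by (simp add: D_def)
  interpret DX: real_distribution "distr D borel X" by (rule D.real_distribution_distr) simp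
  have "char (distr D borel X) s = char std_normal_distribution s" for s
  proof -
    have "char (distr D borel X) s = (CLINT x|D. iexp (s * X x))"
      by (simp add: char_def integral_distr)
    also have "\<dots> = (CLINT x|M. (w x / c) *\<^sub>R iexp (s * X x))"
      unfolding D_def by (rule integral_density) (use nneg in auto)
    also have "\<dots> = (CLINT x|M. (complex_of_real (w x) * iexp (s * X x)) / complex_of_real c)"
      by (simp add: scaleR_conv_of_real)
    also have "\<dots> = (CLINT x|M. complex_of_real (w x) * iexp (s * X x)) / complex_of_real c"
      by (rule integral_divide_zero)
    also have "\<dots> = char std_normal_distribution s"
      unfolding ch char_std_normal_distribution using \<open>c > 0\<close> by simp
    finally show ?thesis .
  qed
  then have "distr D borel X = std_normal_distribution"
    by (intro Levy_uniqueness DX.real_distribution_axioms std.real_distribution_axioms) auto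
  then have "measure std_normal_distribution A = measure (distr D borel X) A" by simp
  also have "\<dots> = (LINT x|distr D borel X. indicator A x)" by simp
  also have "\<dots> = (LINT x|D. indicator A (X x))" by (subst integral_distr) auto
  also have "\<dots> = (LINT x|M. (w x / c) *\<^sub>R indicator A (X x))"
    unfolding D_def by (rule integral_density) (use nneg in auto)
  also have "\<dots> = (LINT x|M. w x * indicator A (X x)) / c"
    by simp
  finally show ?thesis using \<open>c > 0\<close> by (simp add: field_simps)
qed

text \<open>Induction on the number of variables: conditioning on an event of one variable does not change
  the joint characteristic function of the others.\<close>

lemma std_normal_box_prob:
  fixes N :: "'i \<Rightarrow> 'a \<Rightarrow> real"
  assumes "finite J"
  shows "\<lbrakk>prob_space M; \<And>j. j \<in> J \<Longrightarrow> N j \<in> borel_measurable M; \<And>j. j \<in> J \<Longrightarrow> A j \<in> sets borel;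
    \<And>t. (CLINT x|M. iexp (\<Sum>j\<in>J. t j * N j x)) = complex_of_real (exp (- (\<Sum>j\<in>J. (t j)\<^sup>2) / 2))\<rbrakk>
   \<Longrightarrow> measure M {x \<in> space M. \<forall>j\<in>J. N j x \<in> A j} = (\<Prod>j\<in>J. measure std_normal_distribution (A j))"
  using assms
proof (induction J arbitrary: M rule: finite_induct)
  case empty
  then show ?case by (simp add: prob_space.prob_space)
next
  case (insert k J)
  interpret prob_space M by fact
  have Nm [measurable]: "\<And>j. j \<in> J \<Longrightarrow> N j \<in> borel_measurable M" "N k \<in> borel_measurable M"
    using insert.prems(2) by auto
  have Am [measurable]: "\<And>j. j \<in> J \<Longrightarrow> A j \<in> sets borel" "A k \<in> sets borel"
    using insert.prems(3) by auto
  define B where "B = {x \<in> space M. N k x \<in> A k}"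
  have B [measurable]: "B \<in> sets M" by (simp add: B_def)
  let ?g = "measure std_normal_distribution (A k)"
  have indB: "indicator B x = indicator (A k) (N k x)" if "x \<in> space M" for x :: 'a
    using that by (simp add: B_def indicator_def)
  have ch: "(CLINT x|M. iexp (s * N k x + (\<Sum>j\<in>J. t j * N j x)))
     = complex_of_real (exp (- s\<^sup>2 / 2) * exp (- (\<Sum>j\<in>J. (t j)\<^sup>2) / 2))" for s t
  proof -
    have 1: "(\<Sum>j\<in>J. (t(k := s)) j * N j x) = (\<Sum>j\<in>J. t j * N j x)"
      "(\<Sum>j\<in>J. ((t(k := s)) j)\<^sup>2) = (\<Sum>j\<in>J. (t j)\<^sup>2)" for x
      using insert.hyps by (auto intro!: sum.cong)
    show ?thesis
      using insert.prems(4)[of "t(k := s)"] insert.hyps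
      by (simp add: 1 exp_add[symmetric] add_divide_distrib del: fun_upd_apply, simp)
  qed
  have PB: "measure M B = ?g"
  proof -
    have "(LINT x|M. (1::real) * indicator (A k) (N k x)) = 1 * ?g"
      by (rule weighted_std_normal[where B=1]) (use ch[of _ "\<lambda>_. 0"] in \<open>auto intro: prob_space_axioms\<close>)
    moreover have "(LINT x|M. (1::real) * indicator (A k) (N k x)) = (LINT x|M. indicator B x)"
      by (intro Bochner_Integration.integral_cong) (auto simp: indB)
    ultimately show ?thesis by simp
  qed
  show ?case
  proof (cases "?g = 0")
    case True
    have "measure M {x \<in> space M. \<forall>j\<in>insert k J. N j x \<in> A j} \<le> measure M B"
      by (rule finite_measure_mono) (auto simp: B_def)
    then show ?thesis using True PB insert.hyps by (simp add: measure_le_0_iff)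
  next
    case False
    then have gpos: "?g > 0" by (simp add: zero_less_measure_iff)
    \<comment> \<open>The induction is over the measure as well: the remaining variables satisfy the
      same hypothesis under conditioning on \<open>B\<close>.\<close>
    define D where "D = uniform_measure M B"
    have eB: "emeasure M B = ennreal ?g" by (simp add: emeasure_eq_measure PB)
    have "prob_space D" unfolding D_def
      by (rule prob_space_uniform_measure) (use gpos eB in auto)
    have restr: "(CLINT x|M. indicator B x *\<^sub>R iexp (\<Sum>j\<in>J. t j * N j x))
      = complex_of_real (?g * exp (- (\<Sum>j\<in>J. (t j)\<^sup>2) / 2))" for t
    proof -
      define T where "T x = (\<Sum>j\<in>J. t j * N j x)" for x
      define \<phi> where "\<phi> = exp (- (\<Sum>j\<in>J. (t j)\<^sup>2) / 2)"
      have T [measurable]: "T \<in> borel_measurable M" unfolding T_def by measurable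
      have c1: "(CLINT x|M. iexp (s * N k x + T x)) = complex_of_real (exp (- s\<^sup>2 / 2) * \<phi>)"
        and c2: "(CLINT x|M. iexp (s * N k x - T x)) = complex_of_real (exp (- s\<^sup>2 / 2) * \<phi>)"
        and c0: "(CLINT x|M. iexp (s * N k x)) = complex_of_real (exp (- s\<^sup>2 / 2))" for s
        using ch[of s t] ch[of s "\<lambda>j. - t j"] ch[of s "\<lambda>_. 0"]
        by (simp_all add: T_def \<phi>_def sum_negf)
      have int: "integrable M (\<lambda>x. iexp (f x))" if [measurable]: "f \<in> borel_measurable M" for f :: "'a \<Rightarrow> real"
        by (rule integrable_const_bound[where B=1]) auto
      have cosT: "complex_of_real (cos (T x)) * iexp (s * N k x)
          = (iexp (s * N k x + T x) + iexp (s * N k x - T x)) / 2"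
        and sinT: "complex_of_real (sin (T x)) * iexp (s * N k x)
          = (iexp (s * N k x + T x) - iexp (s * N k x - T x)) / (2 * \<i>)" for s x
        by (simp_all add: ring_distribs exp_add exp_diff cos_of_real[symmetric] sin_of_real[symmetric]
            cos_exp_eq sin_exp_eq exp_minus field_simps del: cos_of_real sin_of_real)
      \<comment> \<open>\<open>cos (T x)\<close> changes sign, so it is not itself a density. Adding
        1 makes it a nonnegative weight bounded by 2, to which \<open>weighted_std_normal\<close>
        applies; the contribution of the constant weight is subtracted afterwards. The same is done
        for \<open>sin (T x)\<close>.\<close>
      have C: "(LINT x|M. (1 + cos (T x)) * indicator (A k) (N k x)) = (1 + \<phi>) * ?g"
      proof (rule weighted_std_normal[where B=2])
        fix s
        have "(CLINT x|M. complex_of_real (1 + cos (T x)) * iexp (s * N k x))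
          = (CLINT x|M. iexp (s * N k x) + (iexp (s * N k x + T x) + iexp (s * N k x - T x)) / 2)"
          unfolding cosT[symmetric] by (simp add: ring_distribs)
        also have "\<dots> = complex_of_real ((1 + \<phi>) * exp (- s\<^sup>2 / 2))"
          by (subst Bochner_Integration.integral_add, (intro integrable_divide_zero Bochner_Integration.integrable_add int; measurable)+,
              subst integral_divide_zero, subst Bochner_Integration.integral_add, (intro int; measurable)+,
              subst c0, subst c1, subst c2) (simp add: algebra_simps)
        finally show "(CLINT x|M. complex_of_real (1 + cos (T x)) * iexp (s * N k x)) = complex_of_real ((1 + \<phi>) * exp (- s\<^sup>2 / 2))" .
      next
        show "0 < 1 + \<phi>" by (simp add: \<phi>_def add_pos_pos)
      next
        fix x show "0 \<le> 1 + cos (T x)" "1 + cos (T x) \<le> 2"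
          using cos_ge_minus_one[of "T x"] cos_le_one[of "T x"] by linarith+
      qed (auto intro: prob_space_axioms)
      have S: "(LINT x|M. (1 + sin (T x)) * indicator (A k) (N k x)) = 1 * ?g"
      proof (rule weighted_std_normal[where B=2])
        fix s
        have "(CLINT x|M. complex_of_real (1 + sin (T x)) * iexp (s * N k x))
          = (CLINT x|M. iexp (s * N k x) + (iexp (s * N k x + T x) - iexp (s * N k x - T x)) / (2 * \<i>))"
          unfolding sinT[symmetric] by (simp add: ring_distribs)
        also have "\<dots> = complex_of_real (1 * exp (- s\<^sup>2 / 2))"
          by (subst Bochner_Integration.integral_add, (intro integrable_divide_zero Bochner_Integration.integrable_diff int; measurable)+,
              subst integral_divide_zero, subst Bochner_Integration.integral_diff, (intro int; measurable)+,
              subst c0, subst c1, subst c2) simp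
        finally show "(CLINT x|M. complex_of_real (1 + sin (T x)) * iexp (s * N k x)) = complex_of_real (1 * exp (- s\<^sup>2 / 2))" .
      next
        fix x show "0 \<le> 1 + sin (T x)" "1 + sin (T x) \<le> 2"
          using sin_ge_minus_one[of "T x"] sin_le_one[of "T x"] by linarith+
      qed (auto intro: prob_space_axioms)
      have intr: "integrable M (\<lambda>x. f x * indicator (A k) (N k x))"
        if [measurable]: "f \<in> borel_measurable M" and "\<And>x. \<bar>f x\<bar> \<le> 1" for f :: "'a \<Rightarrow> real"
        by (rule integrable_const_bound[where B=1]) (use that in \<open>auto simp: indicator_def\<close>)
      have one: "(LINT x|M. (1::real) * indicator (A k) (N k x)) = ?g"
      proof -
        have "(LINT x|M. (1::real) * indicator (A k) (N k x)) = (LINT x|M. indicator B x)"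
          by (intro Bochner_Integration.integral_cong) (auto simp: indB)
        then show ?thesis using PB by simp
      qed
      have "(LINT x|M. (1 + cos (T x)) * indicator (A k) (N k x))
          = (LINT x|M. (1::real) * indicator (A k) (N k x)) + (LINT x|M. cos (T x) * indicator (A k) (N k x))"
        unfolding distrib_right by (rule Bochner_Integration.integral_add) (rule intr, auto)+
      with C one have C': "(LINT x|M. cos (T x) * indicator (A k) (N k x)) = ?g * \<phi>" by (simp add: algebra_simps)
      have "(LINT x|M. (1 + sin (T x)) * indicator (A k) (N k x))
          = (LINT x|M. (1::real) * indicator (A k) (N k x)) + (LINT x|M. sin (T x) * indicator (A k) (N k x))"
        unfolding distrib_right by (rule Bochner_Integration.integral_add) (rule intr, auto)+
      with S one have S': "(LINT x|M. sin (T x) * indicator (A k) (N k x)) = 0" by simp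
      have "(CLINT x|M. indicator B x *\<^sub>R iexp (T x))
          = (CLINT x|M. complex_of_real (cos (T x) * indicator (A k) (N k x))
              + \<i> * complex_of_real (sin (T x) * indicator (A k) (N k x)))"
        by (intro Bochner_Integration.integral_cong refl)
           (simp add: indB exp_Euler scaleR_conv_of_real algebra_simps cos_of_real sin_of_real)
      also have "\<dots> = complex_of_real (?g * \<phi>)"
        by (subst Bochner_Integration.integral_add)
           (auto intro!: intr integrable_of_real integrable_mult_right simp del: of_real_mult simp: C' S')
      finally show ?thesis by (simp add: T_def \<phi>_def)
    qed
    have "measure D {x \<in> space D. \<forall>j\<in>J. N j x \<in> A j} = (\<Prod>j\<in>J. measure std_normal_distribution (A j))"
    proof (rule insert.IH)
      fix t
      have "D = density M (\<lambda>x. ennreal (indicator B x / ?g))"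
        unfolding D_def uniform_measure_def eB using gpos
        by (intro density_cong) (auto simp: divide_ennreal indicator_def ennreal_1[symmetric] simp del: ennreal_1)
      then have "(CLINT x|D. iexp (\<Sum>j\<in>J. t j * N j x))
        = (CLINT x|M. (indicator B x / ?g) *\<^sub>R iexp (\<Sum>j\<in>J. t j * N j x))"
        using gpos by (simp only:) (rule integral_density, auto)
      also have "\<dots> = (CLINT x|M. (indicator B x *\<^sub>R iexp (\<Sum>j\<in>J. t j * N j x)) / complex_of_real ?g)"
        by (intro Bochner_Integration.integral_cong refl) (simp add: scaleR_conv_of_real)
      also have "\<dots> = complex_of_real (exp (- (\<Sum>j\<in>J. (t j)\<^sup>2) / 2))"
        by (subst integral_divide_zero, subst restr) (use gpos in simp)
      finally show "(CLINT x|D. iexp (\<Sum>j\<in>J. t j * N j x)) = complex_of_real (exp (- (\<Sum>j\<in>J. (t j)\<^sup>2) / 2))" .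
    qed (use \<open>prob_space D\<close> Nm Am insert.hyps in \<open>auto simp: D_def\<close>)
    moreover have "measure D {x \<in> space D. \<forall>j\<in>J. N j x \<in> A j}
      = measure M (B \<inter> {x \<in> space M. \<forall>j\<in>J. N j x \<in> A j}) / measure M B"
      unfolding D_def by (subst measure_uniform_measure) (use gpos eB insert.hyps in \<open>auto\<close>)
    moreover have "B \<inter> {x \<in> space M. \<forall>j\<in>J. N j x \<in> A j} = {x \<in> space M. \<forall>j\<in>insert k J. N j x \<in> A j}"
      by (auto simp: B_def)
    ultimately show ?thesis using insert.hyps gpos PB by (simp add: field_simps)
  qed
qed

text \<open>Boxes generate the product sigma-algebra, so the box probabilities identify the joint
  law with the product of standard normals.\<close>

lemma (in prob_space) indep_std_normal_of_char:
  fixes N :: "'i \<Rightarrow> 'a \<Rightarrow> real"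
  assumes "finite J" "J \<noteq> {}" and N [measurable]: "\<And>j. j \<in> J \<Longrightarrow> N j \<in> borel_measurable M"
    and ch: "\<And>t. (CLINT x|M. iexp (\<Sum>j\<in>J. t j * N j x)) = complex_of_real (exp (- (\<Sum>j\<in>J. (t j)\<^sup>2) / 2))"
  shows "indep_vars (\<lambda>_. borel) N J" "\<And>j. j \<in> J \<Longrightarrow> distr M borel (N j) = std_normal_distribution"
proof -
  interpret std: real_distribution std_normal_distribution by (rule real_dist_normal_dist)
  note box = std_normal_box_prob[OF \<open>finite J\<close> prob_space_axioms N _ ch]
  show d: "distr M borel (N j) = std_normal_distribution" if j: "j \<in> J" for j
  proof (rule measure_eqI)
    fix A assume "A \<in> sets (distr M borel (N j))"
    then have A [measurable]: "A \<in> sets borel" by simp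
    \<comment> \<open>Filling the other coordinates with \<open>UNIV\<close> turns a box probability
      into a marginal one.\<close>
    have "measure M {x \<in> space M. \<forall>i\<in>J. N i x \<in> (if i = j then A else UNIV)}
      = (\<Prod>i\<in>J. measure std_normal_distribution (if i = j then A else UNIV))"
      by (rule box) auto
    also have "\<dots> = (\<Prod>i\<in>J. if i = j then measure std_normal_distribution A else 1)"
      using std.prob_space by (intro prod.cong) auto
    also have "\<dots> = measure std_normal_distribution A"
      using j \<open>finite J\<close> by (subst prod.delta) auto
    also have "{x \<in> space M. \<forall>i\<in>J. N i x \<in> (if i = j then A else UNIV)} = N j -` A \<inter> space M"
      using j by auto
    finally show "emeasure (distr M borel (N j)) A = emeasure std_normal_distribution A"
      using j by (simp add: emeasure_distr emeasure_eq_measure std.emeasure_eq_measure)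
  qed simp
  interpret P: product_sigma_finite "\<lambda>_::'i. std_normal_distribution"
    by (simp add: product_sigma_finite_def std.sigma_finite_measure_axioms)
  have "distr M (\<Pi>\<^sub>M i\<in>J. borel) (\<lambda>x. \<lambda>i\<in>J. N i x) = (\<Pi>\<^sub>M i\<in>J. std_normal_distribution)"
  proof (rule P.PiM_eqI)
    show "sets (distr M (\<Pi>\<^sub>M i\<in>J. borel) (\<lambda>x. \<lambda>i\<in>J. N i x)) = sets (\<Pi>\<^sub>M i\<in>J. std_normal_distribution)"
      by (simp cong: sets_PiM_cong)
  next
    fix A assume "\<And>i. i \<in> J \<Longrightarrow> A i \<in> sets std_normal_distribution"
    then have A [measurable]: "\<And>i. i \<in> J \<Longrightarrow> A i \<in> sets borel" by simp
    have "emeasure (distr M (\<Pi>\<^sub>M i\<in>J. borel) (\<lambda>x. \<lambda>i\<in>J. N i x)) (Pi\<^sub>E J A)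
      = emeasure M ((\<lambda>x. \<lambda>i\<in>J. N i x) -` (Pi\<^sub>E J A) \<inter> space M)"
      by (rule emeasure_distr) (use \<open>finite J\<close> in \<open>auto intro!: measurable_restrict sets_PiM_I_finite\<close>)
    also have "(\<lambda>x. \<lambda>i\<in>J. N i x) -` (Pi\<^sub>E J A) \<inter> space M = {x \<in> space M. \<forall>i\<in>J. N i x \<in> A i}"
      by (auto simp: PiE_def Pi_def)
    also have "emeasure M \<dots> = (\<Prod>i\<in>J. emeasure std_normal_distribution (A i))"
      by (subst emeasure_eq_measure, subst box) (auto simp: A std.emeasure_eq_measure prod_ennreal)
    finally show "emeasure (distr M (\<Pi>\<^sub>M i\<in>J. borel) (\<lambda>x. \<lambda>i\<in>J. N i x)) (Pi\<^sub>E J A)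
      = (\<Prod>i\<in>J. emeasure std_normal_distribution (A i))" .
  qed fact
  then show "indep_vars (\<lambda>_. borel) N J"
    by (subst indep_vars_iff_distr_eq_PiM') (use assms d in \<open>auto cong: PiM_cong\<close>)
qed

text \<open>Orthonormal rows make \<open>t \<mapsto> v\<close> (with \<open>v i\<close> the sum of
  \<open>t j * q j i\<close>) an isometry. Hence the joint characteristic function of the
  combinations is again \<open>exp (- |t|\<^sup>2 / 2)\<close>, which determines the law.\<close>

lemma (in prob_space) indep_orthonormal_combinations:
  fixes Z :: "'i \<Rightarrow> 'a \<Rightarrow> real" and q :: "'j \<Rightarrow> 'i \<Rightarrow> real"
  assumes "finite I" "indep_vars (\<lambda>_. borel) Z I" "\<sigma> > 0"
    and Z: "\<And>i. i \<in> I \<Longrightarrow> distributed M lborel (Z i) (normal_density 0 \<sigma>)"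
    and "finite J" "J \<noteq> {}"
    and orth: "\<And>j k. j \<in> J \<Longrightarrow> k \<in> J \<Longrightarrow> (\<Sum>i\<in>I. q j i * q k i) = (if j = k then 1 else 0)"
  defines "N \<equiv> \<lambda>j x. (\<Sum>i\<in>I. q j i * Z i x) / \<sigma>"
  shows "indep_vars (\<lambda>_. borel) N J" "\<And>j. j \<in> J \<Longrightarrow> distr M borel (N j) = std_normal_distribution"
proof -
  have Zm [measurable]: "\<And>i. i \<in> I \<Longrightarrow> Z i \<in> borel_measurable M"
    using Z[THEN distributed_measurable] by simp
  have Nm: "N j \<in> borel_measurable M" for j unfolding N_def by measurable
  have chZ: "(CLINT x|M. iexp (u * Z i x)) = complex_of_real (exp (- (u * \<sigma>)\<^sup>2 / 2))" if "i \<in> I" for i u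
  proof -
    have "distributed M lborel (\<lambda>x. Z i x / \<sigma>) std_normal_density"
      using Z[OF that] normal_standard_normal_convert[OF \<open>\<sigma> > 0\<close>, of "Z i" 0] by simp
    then have "distr M lborel (\<lambda>x. Z i x / \<sigma>) = std_normal_distribution"
      by (simp add: distributed_distr_eq_density)
    moreover have "distr M lborel (\<lambda>x. Z i x / \<sigma>) = distr M borel (\<lambda>x. Z i x / \<sigma>)"
      by (rule distr_cong) auto
    ultimately have "char (distr M borel (\<lambda>x. Z i x / \<sigma>)) (u * \<sigma>) = complex_of_real (exp (- (u * \<sigma>)\<^sup>2 / 2))"
      by (simp add: char_std_normal_distribution)
    moreover have "char (distr M borel (\<lambda>x. Z i x / \<sigma>)) (u * \<sigma>) = (CLINT x|M. iexp ((u * \<sigma>) * (Z i x / \<sigma>)))"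
      unfolding char_def using that by (subst integral_distr) auto
    ultimately show ?thesis using \<open>\<sigma> > 0\<close> by simp
  qed
  have "(CLINT x|M. iexp (\<Sum>j\<in>J. t j * N j x)) = complex_of_real (exp (- (\<Sum>j\<in>J. (t j)\<^sup>2) / 2))" for t
  proof -
    define v where "v i = (\<Sum>j\<in>J. t j * q j i)" for i
    have 1: "(\<Sum>j\<in>J. t j * N j x) = (\<Sum>i\<in>I. v i / \<sigma> * Z i x)" for x
      unfolding v_def N_def sum_divide_distrib sum_distrib_left sum_distrib_right
      by (subst sum.swap) (simp add: mult.assoc)
    have "(\<Sum>i\<in>I. (v i)\<^sup>2) = (\<Sum>i\<in>I. \<Sum>j\<in>J. \<Sum>k\<in>J. t j * t k * (q j i * q k i))"
      unfolding v_def power2_eq_square sum_product by (simp add: mult_ac)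
    also have "\<dots> = (\<Sum>j\<in>J. \<Sum>k\<in>J. t j * t k * (\<Sum>i\<in>I. q j i * q k i))"
      by (subst sum.swap, rule sum.cong[OF refl], subst sum.swap) (simp add: sum_distrib_left)
    also have "\<dots> = (\<Sum>j\<in>J. \<Sum>k\<in>J. if j = k then t j * t k else 0)"
      by (intro sum.cong refl) (simp add: orth)
    also have "\<dots> = (\<Sum>j\<in>J. (t j)\<^sup>2)"
      using \<open>finite J\<close> by (simp add: power2_eq_square)
    finally have 2: "(\<Sum>i\<in>I. (v i)\<^sup>2) = (\<Sum>j\<in>J. (t j)\<^sup>2)" .
    have iv: "indep_vars (\<lambda>_. borel) (\<lambda>i x. v i / \<sigma> * Z i x) I"
      by (rule indep_vars_compose2[OF \<open>indep_vars (\<lambda>_. borel) Z I\<close>]) simp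
    have "(CLINT x|M. iexp (\<Sum>i\<in>I. v i / \<sigma> * Z i x)) = char (distr M borel (\<lambda>x. \<Sum>i\<in>I. v i / \<sigma> * Z i x)) 1"
      unfolding char_def by (subst integral_distr) auto
    also have "\<dots> = (\<Prod>i\<in>I. char (distr M borel (\<lambda>x. v i / \<sigma> * Z i x)) 1)"
      by (rule char_distr_sum[OF iv])
    also have "\<dots> = (\<Prod>i\<in>I. (CLINT x|M. iexp (v i / \<sigma> * Z i x)))"
      unfolding char_def by (intro prod.cong refl, subst integral_distr) auto
    also have "\<dots> = (\<Prod>i\<in>I. complex_of_real (exp (- (v i)\<^sup>2 / 2)))"
      using \<open>\<sigma> > 0\<close> by (intro prod.cong refl) (subst chZ, auto)
    also have "\<dots> = complex_of_real (exp (\<Sum>i\<in>I. - (v i)\<^sup>2 / 2))"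
      using \<open>finite I\<close> by (simp add: exp_sum)
    also have "(\<Sum>i\<in>I. - (v i)\<^sup>2 / 2) = - (\<Sum>j\<in>J. (t j)\<^sup>2) / 2"
      unfolding 2[symmetric] by (simp add: sum_negf sum_divide_distrib)
    finally show ?thesis unfolding 1 .
  qed
  from indep_std_normal_of_char[OF \<open>finite J\<close> \<open>J \<noteq> {}\<close> Nm this]
  show "indep_vars (\<lambda>_. borel) N J" "\<And>j. j \<in> J \<Longrightarrow> distr M borel (N j) = std_normal_distribution" .
qed

section \<open>Lindeberg replacement\<close>

text \<open>A quantitative smoothness class: \<open>f1\<close> and \<open>f2\<close> act as first
  and second derivatives, and \<open>L\<close> corresponds to a sixth of a Lipschitz constant of the
  second. Demanding only the Taylor inequality lets a piecewise cubic be verified by algebra. The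
  bound \<open>B\<close> is existential since it serves integrability only; \<open>L\<close> alone
  enters the error estimates.\<close>

definition taylor3 :: "real \<Rightarrow> (real \<Rightarrow> real) \<Rightarrow> bool" where
  "taylor3 L f \<longleftrightarrow> (\<exists>f1 f2 B. f \<in> borel_measurable borel \<and> f1 \<in> borel_measurable borel \<and> f2 \<in> borel_measurable borel \<and>
     (\<forall>x. \<bar>f x\<bar> \<le> B \<and> \<bar>f1 x\<bar> \<le> B \<and> \<bar>f2 x\<bar> \<le> B) \<and>
     (\<forall>x h. \<bar>f (x + h) - f x - f1 x * h - f2 x * h\<^sup>2 / 2\<bar> \<le> L * \<bar>h\<bar> ^ 3))"

lemma taylor3I:
  assumes "f \<in> borel_measurable borel" "f1 \<in> borel_measurable borel" "f2 \<in> borel_measurable borel"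
    "\<And>x. \<bar>f x\<bar> \<le> B" "\<And>x. \<bar>f1 x\<bar> \<le> B" "\<And>x. \<bar>f2 x\<bar> \<le> B"
    "\<And>x h. \<bar>f (x + h) - f x - f1 x * h - f2 x * h\<^sup>2 / 2\<bar> \<le> L * \<bar>h\<bar> ^ 3"
  shows "taylor3 L f"
  unfolding taylor3_def using assms by (intro exI[of _ f1] exI[of _ f2] exI[of _ B] conjI allI)

lemma taylor3E:
  assumes "taylor3 L f"
  obtains f1 f2 B where
    "f \<in> borel_measurable borel" "f1 \<in> borel_measurable borel" "f2 \<in> borel_measurable borel"
    "\<And>x. \<bar>f x\<bar> \<le> B" "\<And>x. \<bar>f1 x\<bar> \<le> B" "\<And>x. \<bar>f2 x\<bar> \<le> B"
    "\<And>x h. \<bar>f (x + h) - f x - f1 x * h - f2 x * h\<^sup>2 / 2\<bar> \<le> L * \<bar>h\<bar> ^ 3"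
proof -
  from assms obtain f1 f2 B where
    *: "f \<in> borel_measurable borel \<and> f1 \<in> borel_measurable borel \<and> f2 \<in> borel_measurable borel \<and>
     (\<forall>x. \<bar>f x\<bar> \<le> B \<and> \<bar>f1 x\<bar> \<le> B \<and> \<bar>f2 x\<bar> \<le> B) \<and>
     (\<forall>x h. \<bar>f (x + h) - f x - f1 x * h - f2 x * h\<^sup>2 / 2\<bar> \<le> L * \<bar>h\<bar> ^ 3)"
    unfolding taylor3_def by (elim exE)
  note 1 = conjunct2[OF *] and 2 = conjunct2[OF conjunct2[OF *]] and 3 = conjunct2[OF conjunct2[OF conjunct2[OF *]]]
  note bd = spec[OF conjunct1[OF 3]]
  show thesis
    by (rule that[OF conjunct1[OF *] conjunct1[OF 1] conjunct1[OF 2] conjunct1[OF bd]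
          conjunct1[OF conjunct2[OF bd]] conjunct2[OF conjunct2[OF bd]]
          spec[OF spec[OF conjunct2[OF 3]]]])
qed

lemma taylor3_bounded:
  assumes "taylor3 L f"
  obtains B where "f \<in> borel_measurable borel" "\<And>x. \<bar>f x\<bar> \<le> B"
  by (rule taylor3E[OF assms]) (rule that)

lemma taylor3_nonneg: assumes "taylor3 L f" shows "0 \<le> L"
proof (rule taylor3E[OF assms])
  fix f1 f2 B
  assume "\<And>x h. \<bar>f (x + h) - f x - f1 x * h - f2 x * h\<^sup>2 / 2\<bar> \<le> L * \<bar>h\<bar> ^ 3"
  from this[of 0 1] show "0 \<le> L" by simp
qed

lemma (in real_distribution) integrable_bounded_shift:
  assumes "f \<in> borel_measurable borel" "\<And>x. \<bar>f x\<bar> \<le> (B::real)"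
  shows "integrable M (\<lambda>v. f (x + v))"
  by (rule integrable_const_bound[where B=B]) (use assms in auto)

lemma (in real_distribution) measurable_average_shift:
  fixes g :: "real \<Rightarrow> real"
  assumes g: "g \<in> borel_measurable borel"
  shows "(\<lambda>x. LINT v|M. g (x + v)) \<in> borel_measurable borel"
proof (rule borel_measurable_lebesgue_integral)
  have id: "(\<lambda>v. v) \<in> borel_measurable M" by (rule measurable_ident_sets) simp
  have "(\<lambda>p. fst p + snd p) \<in> borel_measurable (borel \<Otimes>\<^sub>M M)"
    by (intro borel_measurable_add measurable_fst measurable_compose[OF measurable_snd id])
  from measurable_compose[OF this g] show "(\<lambda>(x, v). g (x + v)) \<in> borel_measurable (borel \<Otimes>\<^sub>M M)"
    by (simp add: case_prod_beta)
qed

text \<open>The Taylor inequality is linear in the triple \<open>f\<close>, \<open>f1\<close>,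
  \<open>f2\<close>, so it can be integrated over shifts with the same \<open>L\<close>; the
  averaged triple is the witness.\<close>

lemma (in real_distribution) taylor3_average:
  assumes "taylor3 L f"
  shows "taylor3 L (\<lambda>x. LINT v|M. f (x + v))"
proof (rule taylor3E[OF assms])
  fix f1 f2 B
  assume m: "f \<in> borel_measurable borel" "f1 \<in> borel_measurable borel" "f2 \<in> borel_measurable borel"
    and bd: "\<And>x. \<bar>f x\<bar> \<le> B" "\<And>x. \<bar>f1 x\<bar> \<le> B" "\<And>x. \<bar>f2 x\<bar> \<le> B"
    and T: "\<And>x h. \<bar>f (x + h) - f x - f1 x * h - f2 x * h\<^sup>2 / 2\<bar> \<le> L * \<bar>h\<bar> ^ 3"
  have meas: "(\<lambda>x. LINT v|M. g (x + v)) \<in> borel_measurable borel" if g: "g \<in> borel_measurable borel" for g :: "real \<Rightarrow> real"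
    by (rule measurable_average_shift[OF g])
  have bound: "\<bar>LINT v|M. g (x + v)\<bar> \<le> B" if "g \<in> borel_measurable borel" "\<And>x. \<bar>g x\<bar> \<le> B" for g :: "real \<Rightarrow> real" and x
  proof -
    have "\<bar>LINT v|M. g (x + v)\<bar> \<le> (LINT v|M. \<bar>g (x + v)\<bar>)" by (rule integral_abs_bound)
    also have "\<dots> \<le> (LINT v|M. B)"
      by (rule integral_mono) (use that integrable_bounded_shift[OF that] in auto)
    finally show ?thesis by (simp add: prob_space[unfolded space_eq_univ])
  qed
  have "\<bar>(LINT v|M. f (x + h + v)) - (LINT v|M. f (x + v)) - (LINT v|M. f1 (x + v)) * h - (LINT v|M. f2 (x + v)) * h\<^sup>2 / 2\<bar> \<le> L * \<bar>h\<bar> ^ 3" for x h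
  proof -
    note I = integrable_bounded_shift[OF m(1) bd(1)] integrable_bounded_shift[OF m(2) bd(2)] integrable_bounded_shift[OF m(3) bd(3)]
    have eq: "(LINT v|M. f (x + h + v)) - (LINT v|M. f (x + v)) - (LINT v|M. f1 (x + v)) * h - (LINT v|M. f2 (x + v)) * h\<^sup>2 / 2
      = (LINT v|M. f ((x + v) + h) - f (x + v) - f1 (x + v) * h - f2 (x + v) * h\<^sup>2 / 2)"
      using I(1)[of "x+h"] I(1)[of x] I(2)[of x] I(3)[of x] by (simp add: ac_simps)
    have "\<bar>LINT v|M. f ((x + v) + h) - f (x + v) - f1 (x + v) * h - f2 (x + v) * h\<^sup>2 / 2\<bar>
      \<le> (LINT v|M. \<bar>f ((x + v) + h) - f (x + v) - f1 (x + v) * h - f2 (x + v) * h\<^sup>2 / 2\<bar>)"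
      by (rule integral_abs_bound)
    also have "\<dots> \<le> (LINT v|M. L * \<bar>h\<bar> ^ 3)"
      by (rule integral_mono)
         (use T[of "x + _" h] I(1)[of "x+h"] I(1)[of x] I(2)[of x] I(3)[of x] in
           \<open>auto intro!: integrable_abs Bochner_Integration.integrable_diff simp: add_ac\<close>)
    finally show ?thesis unfolding eq by (simp add: prob_space[unfolded space_eq_univ])
  qed
  then show ?thesis
    by (intro taylor3I[OF meas[OF m(1)] meas[OF m(2)] meas[OF m(3)] bound[OF m(1) bd(1)] bound[OF m(2) bd(2)] bound[OF m(3) bd(3)]])
qed

lemma abs_power_le_1_plus_power4:
  fixes v :: real assumes "k \<le> 4" shows "\<bar>v\<bar> ^ k \<le> 1 + v ^ 4"
proof (cases "\<bar>v\<bar> \<le> 1")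
  case True
  then have "\<bar>v\<bar> ^ k \<le> 1" by (simp add: power_le_one)
  moreover have "0 \<le> v ^ 4" by simp
  ultimately show ?thesis by linarith
next
  case False
  then have "\<bar>v\<bar> ^ k \<le> \<bar>v\<bar> ^ 4" using assms by (intro power_increasing) auto
  then show ?thesis by (simp add: power_even_abs)
qed

text \<open>The constant \<open>c = f2 x\<close> depends on \<open>f\<close> and \<open>x\<close>
  but not on the random variable. Two centred variables with equal variance are thus compared with
  the same number, whatever spaces they live on. The cubic remainder is absorbed by
  \<open>|h|^3 \<le> 1 + h^4\<close>, so fourth moments suffice.\<close>

lemma taylor3_expectation:
  assumes f: "taylor3 L f"
  obtains c where "\<And>M X s m4. prob_space M \<Longrightarrow> X \<in> borel_measurable M \<Longrightarrow> integrable M (\<lambda>\<omega>. X \<omega> ^ 4) \<Longrightarrow>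
     (LINT \<omega>|M. X \<omega>) = 0 \<Longrightarrow> (LINT \<omega>|M. (X \<omega>)\<^sup>2) = s \<Longrightarrow> (LINT \<omega>|M. X \<omega> ^ 4) \<le> m4 \<Longrightarrow>
     \<bar>(LINT \<omega>|M. f (x + X \<omega>)) - (f x + c * s / 2)\<bar> \<le> L * (1 + m4)"
proof (rule taylor3E[OF f])
  fix f1 f2 B
  assume m: "f \<in> borel_measurable borel" "f1 \<in> borel_measurable borel" "f2 \<in> borel_measurable borel"
    and bd: "\<And>x. \<bar>f x\<bar> \<le> B" "\<And>x. \<bar>f1 x\<bar> \<le> B" "\<And>x. \<bar>f2 x\<bar> \<le> B"
    and T: "\<And>x h. \<bar>f (x + h) - f x - f1 x * h - f2 x * h\<^sup>2 / 2\<bar> \<le> L * \<bar>h\<bar> ^ 3"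
  have L: "0 \<le> L" using taylor3_nonneg[OF f] .
  show thesis
  proof (rule that[of "f2 x"])
    fix M :: "'c measure" and X :: "'c \<Rightarrow> real" and s m4
    assume "prob_space M" and X [measurable]: "X \<in> borel_measurable M" and i4: "integrable M (\<lambda>\<omega>. X \<omega> ^ 4)"
      and e1: "(LINT \<omega>|M. X \<omega>) = 0" and e2: "(LINT \<omega>|M. (X \<omega>)\<^sup>2) = s" and e4: "(LINT \<omega>|M. X \<omega> ^ 4) \<le> m4"
    interpret prob_space M by fact
    have ik: "integrable M (\<lambda>\<omega>. \<bar>X \<omega>\<bar> ^ k)" if "k \<le> 4" for k
      by (rule Bochner_Integration.integrable_bound[where f="\<lambda>\<omega>. 1 + X \<omega> ^ 4"])
         (use i4 abs_power_le_1_plus_power4[OF that] in \<open>auto intro!: AE_I2\<close>)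
    have i1: "integrable M X" using ik[of 1] by (subst integrable_abs_iff[symmetric]) auto
    have i2: "integrable M (\<lambda>\<omega>. (X \<omega>)\<^sup>2)" using ik[of 2] by simp
    have if0: "integrable M (\<lambda>\<omega>. f (x + X \<omega>))"
      by (rule integrable_const_bound[where B=B]) (use bd m in auto)
    have eq: "(LINT \<omega>|M. f (x + X \<omega>)) - (f x + f2 x * s / 2)
       = (LINT \<omega>|M. f (x + X \<omega>) - f x - f1 x * X \<omega> - f2 x * (X \<omega>)\<^sup>2 / 2)"
      using if0 i1 i2 e1 e2 by (simp add: prob_space)
    have "\<bar>LINT \<omega>|M. f (x + X \<omega>) - f x - f1 x * X \<omega> - f2 x * (X \<omega>)\<^sup>2 / 2\<bar>
      \<le> (LINT \<omega>|M. \<bar>f (x + X \<omega>) - f x - f1 x * X \<omega> - f2 x * (X \<omega>)\<^sup>2 / 2\<bar>)"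
      by (rule integral_abs_bound)
    also have "\<dots> \<le> (LINT \<omega>|M. L * (1 + X \<omega> ^ 4))"
    proof (rule integral_mono)
      fix \<omega>
      have "\<bar>f (x + X \<omega>) - f x - f1 x * X \<omega> - f2 x * (X \<omega>)\<^sup>2 / 2\<bar> \<le> L * \<bar>X \<omega>\<bar> ^ 3" by (rule T)
      also have "\<dots> \<le> L * (1 + X \<omega> ^ 4)"
        by (intro mult_left_mono L abs_power_le_1_plus_power4) simp
      finally show "\<bar>f (x + X \<omega>) - f x - f1 x * X \<omega> - f2 x * (X \<omega>)\<^sup>2 / 2\<bar> \<le> L * (1 + X \<omega> ^ 4)" .
    qed (use if0 i1 i2 i4 in auto)
    also have "\<dots> = L * (1 + (LINT \<omega>|M. X \<omega> ^ 4))"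
      using i4 by (simp add: prob_space)
    also have "\<dots> \<le> L * (1 + m4)" using e4 L by (intro mult_left_mono) auto
    finally show "\<bar>(LINT \<omega>|M. f (x + X \<omega>)) - (f x + f2 x * s / 2)\<bar> \<le> L * (1 + m4)" unfolding eq .
  qed
qed

section \<open>Gaussian moments and the replacement of summands\<close>

abbreviation "stdN \<equiv> std_normal_distribution"

lemma stdN_moments:
  "integrable stdN (\<lambda>x. x ^ k)" "(LINT x|stdN. x) = 0" "(LINT x|stdN. x\<^sup>2) = 1" "(LINT x|stdN. x ^ 4) = 3"
proof -
  show "integrable stdN (\<lambda>x. x ^ k)" by (rule integrable_std_normal_distribution_moment)
  show "(LINT x|stdN. x) = 0" using integral_std_normal_distribution_moment_odd[of 1] by simp
  show "(LINT x|stdN. x\<^sup>2) = 1" using std_normal_distribution_even_moments(1)[of 1] by simp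
  show "(LINT x|stdN. x ^ 4) = 3" using std_normal_distribution_even_moments(1)[of 2] by (simp add: fact_numeral)
qed

text \<open>Equality of laws by characteristic functions, tested against a bounded \<open>f\<close>.
  In the replacement argument it merges the newest Gaussian summand with those already
  introduced.\<close>

lemma stdN_convolution:
  fixes f :: "real \<Rightarrow> real"
  assumes f [measurable]: "f \<in> borel_measurable borel" and bd: "\<And>x. \<bar>f x\<bar> \<le> B"
  shows "(LINT g|stdN. LINT h|stdN. f (\<alpha> * g + \<beta> * h)) = (LINT g|stdN. f (sqrt (\<alpha>\<^sup>2 + \<beta>\<^sup>2) * g))"
proof -
  interpret N: real_distribution stdN by (rule real_dist_normal_dist)
  interpret P: pair_prob_space stdN stdN ..
  define R where "R = distr (stdN \<Otimes>\<^sub>M stdN) borel (\<lambda>(g,h). \<alpha> * g + \<beta> * h)"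
  define R' where "R' = distr stdN borel (\<lambda>g. sqrt (\<alpha>\<^sup>2 + \<beta>\<^sup>2) * g)"
  interpret R: real_distribution R unfolding R_def by (rule P.real_distribution_distr) simp
  interpret R': real_distribution R' unfolding R'_def by (rule N.real_distribution_distr) simp
  have "char R t = char R' t" for t
  proof -
    have "char R t = (CLINT p|stdN \<Otimes>\<^sub>M stdN. iexp (t * (\<alpha> * fst p + \<beta> * snd p)))"
      unfolding char_def R_def by (subst integral_distr) (auto simp: case_prod_beta)
    also have "\<dots> = (CLINT g|stdN. CLINT h|stdN. iexp (t * (\<alpha> * g + \<beta> * h)))"
      by (subst P.integral_fst'[symmetric]) (auto intro!: P.integrable_const_bound[where B=1])
    also have "\<dots> = (CLINT g|stdN. CLINT h|stdN. iexp ((t * \<alpha>) * g) * iexp ((t * \<beta>) * h))"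
      by (simp add: exp_add[symmetric] algebra_simps)
    also have "\<dots> = char stdN (t * \<alpha>) * char stdN (t * \<beta>)"
      by (simp add: char_def)
    also have "\<dots> = char stdN (t * sqrt (\<alpha>\<^sup>2 + \<beta>\<^sup>2))"
      by (simp add: char_std_normal_distribution exp_add[symmetric] power_mult_distrib
          add_divide_distrib distrib_left flip: of_real_mult)
    also have "\<dots> = char R' t"
      unfolding char_def R'_def by (subst integral_distr) (auto simp: mult_ac)
    finally show ?thesis .
  qed
  then have "R = R'"
    by (intro Levy_uniqueness R.real_distribution_axioms R'.real_distribution_axioms) auto
  then have "(LINT x|R. f x) = (LINT x|R'. f x)" by simp
  moreover have "(LINT x|R. f x) = (LINT p|(stdN \<Otimes>\<^sub>M stdN). f (\<alpha> * fst p + \<beta> * snd p))"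
    unfolding R_def by (subst integral_distr) (auto simp: case_prod_beta)
  moreover have "(LINT p|(stdN \<Otimes>\<^sub>M stdN). f (\<alpha> * fst p + \<beta> * snd p)) = (LINT g|stdN. LINT h|stdN. f (\<alpha> * g + \<beta> * h))"
    by (subst P.integral_fst'[symmetric]) (auto intro!: P.integrable_const_bound[where B=B] bd)
  moreover have "(LINT x|R'. f x) = (LINT g|stdN. f (sqrt (\<alpha>\<^sup>2 + \<beta>\<^sup>2) * g))"
    unfolding R'_def by (subst integral_distr) auto
  ultimately show ?thesis by simp
qed

text \<open>Since averaging preserves \<open>taylor3\<close>, the summands can be replaced by Gaussians one at a time without
  realising both on a common probability space.\<close>

theorem (in prob_space) Lindeberg_replacement:
  fixes X :: "'i \<Rightarrow> 'a \<Rightarrow> real"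
  assumes "finite F"
  shows "\<lbrakk>indep_vars (\<lambda>_. borel) X F; taylor3 L f; \<And>i. i \<in> F \<Longrightarrow> integrable M (\<lambda>\<omega>. X i \<omega> ^ 4);
    \<And>i. i \<in> F \<Longrightarrow> expectation (X i) = 0; \<And>i. i \<in> F \<Longrightarrow> expectation (\<lambda>\<omega>. (X i \<omega>)\<^sup>2) = v i;
    \<And>i. i \<in> F \<Longrightarrow> expectation (\<lambda>\<omega>. X i \<omega> ^ 4) \<le> m4 i\<rbrakk>
   \<Longrightarrow> \<bar>expectation (\<lambda>\<omega>. f (\<Sum>i\<in>F. X i \<omega>)) - (LINT g|stdN. f (sqrt (\<Sum>i\<in>F. v i) * g))\<bar>
     \<le> L * (\<Sum>i\<in>F. 2 + m4 i + 3 * (v i)\<^sup>2)"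
  using assms
proof (induction F arbitrary: f rule: finite_induct)
  case empty
  interpret N: real_distribution stdN by (rule real_dist_normal_dist)
  show ?case using N.prob_space by (simp add: prob_space)
next
  case (insert j F)
  interpret N: real_distribution stdN by (rule real_dist_normal_dist)
  have rv [measurable]: "X i \<in> borel_measurable M" if "i \<in> insert j F" for i
    using insert.prems(1) that unfolding indep_vars_def by auto
  have rvS [measurable]: "(\<lambda>\<omega>. \<Sum>i\<in>F. X i \<omega>) \<in> borel_measurable M"
    by (rule borel_measurable_sum) (use rv in auto)
  have rvj [measurable]: "X j \<in> borel_measurable M" using rv by simp
  obtain B where f [measurable]: "f \<in> borel_measurable borel" and bd: "\<And>x. \<bar>f x\<bar> \<le> B"
    using taylor3_bounded[OF insert.prems(2)] by blast
  have L: "0 \<le> L" using taylor3_nonneg insert.prems(2) .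
  define P where "P = distr M borel (X j)"
  interpret P: real_distribution P unfolding P_def by (rule real_distribution_distr) simp
  define S where "S = (\<lambda>\<omega>. \<Sum>i\<in>F. X i \<omega>)"
  have S [measurable]: "S \<in> borel_measurable M" unfolding S_def by (rule rvS)
  interpret PS: real_distribution "distr M borel S" by (rule real_distribution_distr) simp
  interpret PP: pair_prob_space P "distr M borel S" ..
  \<comment> \<open>\<open>T\<close> integrates out the true summand \<open>X j\<close>,
    \<open>H\<close> a Gaussian of the same variance. The induction hypothesis is applied to the
    test function \<open>T\<close>, which is why \<open>f\<close> is arbitrary in the
    induction.\<close>
  define T where "T x = (LINT y|P. f (x + y))" for x
  define H where "H x = (LINT g|stdN. f (x + sqrt (v j) * g))" for x
  have T3: "taylor3 L T" unfolding T_def by (rule P.taylor3_average) fact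
  obtain BT where Tm [measurable]: "T \<in> borel_measurable borel" and bT: "\<And>x. \<bar>T x\<bar> \<le> BT"
    using taylor3_bounded[OF T3] by blast
  have vnn: "0 \<le> v i" if "i \<in> insert j F" for i
    using insert.prems(5)[OF that] by (metis integral_nonneg_AE AE_I2 zero_le_power2)
  have "indep_var borel (X j) borel S"
    unfolding S_def by (rule indep_vars_sum) (use insert in auto)
  then have joint: "P \<Otimes>\<^sub>M distr M borel S = distr M (borel \<Otimes>\<^sub>M borel) (\<lambda>\<omega>. (X j \<omega>, S \<omega>))"
    unfolding P_def indep_var_distribution_eq by blast
  have "expectation (\<lambda>\<omega>. f (\<Sum>i\<in>insert j F. X i \<omega>)) = (LINT p|distr M (borel \<Otimes>\<^sub>M borel) (\<lambda>\<omega>. (X j \<omega>, S \<omega>)). (\<lambda>(y, x). f (x + y)) p)"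
    by (subst integral_distr) (use insert.hyps in \<open>auto simp: S_def add.commute\<close>)
  also have "\<dots> = (LINT x|distr M borel S. T x)"
    unfolding joint[symmetric] T_def
  proof (rule PP.integral_snd[symmetric])
    show "integrable (P \<Otimes>\<^sub>M distr M borel S) (\<lambda>(y, x). f (x + y))"
      by (rule PP.integrable_const_bound[where B=B]) (use bd in \<open>auto simp: P_def\<close>)
  qed
  also have "\<dots> = expectation (\<lambda>\<omega>. T (S \<omega>))"
    by (subst integral_distr) auto
  finally have 1: "expectation (\<lambda>\<omega>. f (\<Sum>i\<in>insert j F. X i \<omega>)) = expectation (\<lambda>\<omega>. T (\<Sum>i\<in>F. X i \<omega>))"
    by (simp add: S_def)
  have 2: "\<bar>expectation (\<lambda>\<omega>. T (\<Sum>i\<in>F. X i \<omega>)) - (LINT g|stdN. T (sqrt (\<Sum>i\<in>F. v i) * g))\<bar>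
     \<le> L * (\<Sum>i\<in>F. 2 + m4 i + 3 * (v i)\<^sup>2)"
    by (rule insert.IH[OF _ T3]) (use insert.prems indep_vars_subset[OF insert.prems(1), of F] in auto)
  \<comment> \<open>Both averages are close to the same value \<open>f x + c * v j / 2\<close>. The
    errors are \<open>L * (1 + m4 j)\<close> and \<open>L * (1 + 3 * (v j)\<^sup>2)\<close>, where
    \<open>3 * (v j)\<^sup>2\<close> is the Gaussian fourth moment.\<close>
  have 3: "\<bar>T x - H x\<bar> \<le> L * (2 + m4 j + 3 * (v j)\<^sup>2)" for x
  proof -
    obtain c :: real where c: "\<And>M X s m4. prob_space (M :: real measure) \<Longrightarrow> X \<in> borel_measurable M \<Longrightarrow> integrable M (\<lambda>\<omega>. X \<omega> ^ 4) \<Longrightarrow>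
     (LINT \<omega>|M. X \<omega>) = 0 \<Longrightarrow> (LINT \<omega>|M. (X \<omega>)\<^sup>2) = s \<Longrightarrow> (LINT \<omega>|M. X \<omega> ^ 4) \<le> m4 \<Longrightarrow>
     \<bar>(LINT \<omega>|M. f (x + X \<omega>)) - (f x + c * s / 2)\<bar> \<le> L * (1 + m4)"
      using taylor3_expectation[OF insert.prems(2), of x] by metis
    have "\<bar>(LINT y|P. f (x + y)) - (f x + c * v j / 2)\<bar> \<le> L * (1 + m4 j)"
      by (rule c[of P "\<lambda>y. y"])
         (use insert.prems(3-6)[of j] P.prob_space_axioms in \<open>auto simp: P_def integral_distr integrable_distr_eq\<close>)
    moreover have "\<bar>(LINT g|stdN. f (x + sqrt (v j) * g)) - (f x + c * v j / 2)\<bar> \<le> L * (1 + 3 * (v j)\<^sup>2)"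
    proof (rule c[of stdN "\<lambda>g. sqrt (v j) * g"])
      have "sqrt (v j) ^ 4 = ((sqrt (v j))\<^sup>2)\<^sup>2" by (simp add: power_mult[symmetric])
      then have "sqrt (v j) ^ 4 = (v j)\<^sup>2" using vnn[of j] by simp
      then show "(LINT g|stdN. (sqrt (v j) * g) ^ 4) \<le> 3 * (v j)\<^sup>2"
        by (simp add: power_mult_distrib stdN_moments)
    qed (use N.prob_space_axioms stdN_moments vnn[of j] in \<open>auto simp: power_mult_distrib\<close>)
    ultimately show ?thesis unfolding T_def H_def by (simp add: algebra_simps)
  qed
  have Hm [measurable]: "H \<in> borel_measurable borel" unfolding H_def by measurable
  have bH: "\<bar>H x\<bar> \<le> BT + L * (2 + m4 j + 3 * (v j)\<^sup>2)" for x using 3[of x] bT[of x] by linarith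
  have "(LINT g|stdN. H (sqrt (\<Sum>i\<in>F. v i) * g)) = (LINT g|stdN. f (sqrt ((sqrt (\<Sum>i\<in>F. v i))\<^sup>2 + (sqrt (v j))\<^sup>2) * g))"
    unfolding H_def by (rule stdN_convolution[OF f bd])
  also have "(sqrt (\<Sum>i\<in>F. v i))\<^sup>2 + (sqrt (v j))\<^sup>2 = (\<Sum>i\<in>insert j F. v i)"
    using vnn insert.hyps by (simp add: sum_nonneg add.commute)
  finally have 4: "(LINT g|stdN. H (sqrt (\<Sum>i\<in>F. v i) * g)) = (LINT g|stdN. f (sqrt (\<Sum>i\<in>insert j F. v i) * g))" .
  have iT: "integrable stdN (\<lambda>g. T (s * g))" and iH: "integrable stdN (\<lambda>g. H (s * g))" for s
    by (rule N.integrable_const_bound[OF AE_I2], simp, rule bT, simp)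
       (rule N.integrable_const_bound[OF AE_I2], simp, rule bH, simp)
  have "\<bar>(LINT g|stdN. T (sqrt (\<Sum>i\<in>F. v i) * g)) - (LINT g|stdN. H (sqrt (\<Sum>i\<in>F. v i) * g))\<bar>
     \<le> (LINT g|stdN. \<bar>T (sqrt (\<Sum>i\<in>F. v i) * g) - H (sqrt (\<Sum>i\<in>F. v i) * g)\<bar>)"
    by (subst Bochner_Integration.integral_diff[symmetric, OF iT iH]) (rule integral_abs_bound)
  also have "\<dots> \<le> (LINT g|stdN. L * (2 + m4 j + 3 * (v j)\<^sup>2))"
    by (rule integral_mono) (use 3 iT iH in auto)
  also have "\<dots> = L * (2 + m4 j + 3 * (v j)\<^sup>2)" using N.prob_space by simp
  finally show ?case using 1 2 4 insert.hyps by (simp add: distrib_left)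
qed

text \<open>The truncated cube has second derivative \<open>6 * max 0 x\<close> with Lipschitz
  constant 6, which gives the constant 1. The four sign patterns of \<open>x\<close> and
  \<open>x + h\<close> are checked directly.\<close>

lemma cube_pos_part_taylor:
  fixes x h :: real
  shows "\<bar>(max 0 (x + h)) ^ 3 - (max 0 x) ^ 3 - 3 * (max 0 x)\<^sup>2 * h - 3 * max 0 x * h\<^sup>2\<bar> \<le> \<bar>h\<bar> ^ 3"
proof -
  consider "0 \<le> x" "0 \<le> x + h" | "0 \<le> x" "x + h < 0" | "x < 0" "0 \<le> x + h" | "x < 0" "x + h < 0" by linarith
  then show ?thesis
  proof cases
    case 1
    have "(x + h) ^ 3 - x ^ 3 - 3 * x\<^sup>2 * h - 3 * x * h\<^sup>2 = h ^ 3"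
      by (simp add: power3_eq_cube power2_eq_square algebra_simps)
    then show ?thesis using 1 by (simp add: power_abs)
  next
    case 2
    have "- (x ^ 3) - 3 * x\<^sup>2 * h - 3 * x * h\<^sup>2 = (- x - h) ^ 3 - (- h) ^ 3"
      by (simp add: power3_eq_cube power2_eq_square algebra_simps)
    moreover have "(- x - h) ^ 3 \<le> (- h) ^ 3" by (rule power_mono) (use 2 in auto)
    moreover have "0 \<le> (- x - h) ^ 3" using 2 by simp
    moreover have "\<bar>h\<bar> ^ 3 = (- h) ^ 3" using 2 by (simp add: abs_if)
    ultimately show ?thesis using 2 by simp
  next
    case 3
    then have "(x + h) ^ 3 \<le> h ^ 3" "0 \<le> (x + h) ^ 3" by (auto intro!: power_mono)
    then show ?thesis using 3 by simp
  next
    case 4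
    then show ?thesis by simp
  qed
qed

text \<open>The distribution function of the sum of three independent uniform variables on \<open>[0,1]\<close>.\<close>

definition spline_step :: "real \<Rightarrow> real" where
  "spline_step x = ((max 0 x) ^ 3 - 3 * (max 0 (x - 1)) ^ 3 + 3 * (max 0 (x - 2)) ^ 3 - (max 0 (x - 3)) ^ 3) / 6"

lemma spline_step_0: "x \<le> 0 \<Longrightarrow> spline_step x = 0"
  by (simp add: spline_step_def)

text \<open>Beyond the last knot the numerator is a full third difference of the cube, namely
  \<open>3! = 6\<close>.\<close>

lemma spline_step_1: assumes "x \<ge> 3" shows "spline_step x = 1"
proof -
  have "spline_step x = (x ^ 3 - 3 * (x - 1) ^ 3 + 3 * (x - 2) ^ 3 - (x - 3) ^ 3) / 6"
    using assms by (simp add: spline_step_def)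
  also have "\<dots> = 1" by (simp add: power3_eq_cube algebra_simps)
  finally show ?thesis .
qed

lemma spline_step_range: "0 \<le> spline_step x" "spline_step x \<le> 1"
proof -
  have "0 \<le> spline_step x \<and> spline_step x \<le> 1"
  proof -
    consider "x \<le> 0" | "0 < x" "x \<le> 1" | "1 < x" "x \<le> 2" | "2 < x" "x < 3" | "x \<ge> 3" by linarith
    then show ?thesis
    proof cases
      case 1 then show ?thesis by (simp add: spline_step_0)
    next
      case 2
      then have "spline_step x = x ^ 3 / 6" by (simp add: spline_step_def)
      moreover have "0 \<le> x ^ 3" using 2 by simp
      ultimately show ?thesis using 2 power_le_one[of x 3] by linarith
    next
      case 3
      define u where "u = x - 1"
      have u: "0 \<le> u" "u \<le> 1" using 3 by (auto simp: u_def)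
      have "spline_step x = (x ^ 3 - 3 * (x - 1) ^ 3) / 6" using 3 by (simp add: spline_step_def)
      also have "\<dots> = (1 + 3 * u + 3 * u\<^sup>2 - 2 * u ^ 3) / 6"
        by (simp add: u_def power3_eq_cube power2_eq_square algebra_simps)
      finally have e: "spline_step x = (1 + 3 * u + 3 * u\<^sup>2 - 2 * u ^ 3) / 6" .
      have "u ^ 3 \<le> u\<^sup>2" "u\<^sup>2 \<le> 1" "0 \<le> u ^ 3" "0 \<le> u\<^sup>2"
        using u by (auto intro: power_decreasing power_le_one)
      moreover have "3 * u\<^sup>2 - 2 * u ^ 3 \<le> 1"
      proof -
        have "0 \<le> (1 - u)\<^sup>2 * (1 + 2 * u)" using u by simp
        then show ?thesis by (simp add: power3_eq_cube power2_eq_square algebra_simps)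
      qed
      ultimately have "0 \<le> 1 + 3 * u + 3 * u\<^sup>2 - 2 * u ^ 3" "1 + 3 * u + 3 * u\<^sup>2 - 2 * u ^ 3 \<le> 6" using u by linarith+
      then show ?thesis unfolding e by simp
    next
      case 4
      have "spline_step x = (x ^ 3 - 3 * (x - 1) ^ 3 + 3 * (x - 2) ^ 3) / 6" using 4 by (simp add: spline_step_def)
      also have "\<dots> = 1 - (3 - x) ^ 3 / 6"
        by (simp add: power3_eq_cube field_simps)
      finally show ?thesis using 4 power_le_one[of "3 - x" 3] zero_le_power[of "3 - x" 3] by linarith
    next
      case 5 then show ?thesis by (simp add: spline_step_1)
    qed
  qed
  then show "0 \<le> spline_step x" "spline_step x \<le> 1" by auto
qed

text \<open>Applied to truncated powers of degree at most 2: past the last knot the third difference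
  vanishes, and before it each value lies between 0 and \<open>p 3\<close>, while the coefficients
  of either sign have total weight 4.\<close>

lemma third_difference_bound:
  fixes p :: "real \<Rightarrow> real"
  assumes "\<And>x. 0 \<le> p x" "mono p" "\<And>x. x \<ge> 3 \<Longrightarrow> p x - 3 * p (x - 1) + 3 * p (x - 2) - p (x - 3) = 0"
    "p 3 \<le> c"
  shows "\<bar>p x - 3 * p (x - 1) + 3 * p (x - 2) - p (x - 3)\<bar> \<le> 4 * c"
proof (cases "x \<ge> 3")
  case True
  have "0 \<le> c" using assms(1)[of 3] assms(4) by linarith
  then show ?thesis using assms(3)[OF True] by simp
next
  case False
  have "p x \<le> c" "p (x - 1) \<le> c" "p (x - 2) \<le> c" "p (x - 3) \<le> c"
    using False assms(4) monoD[OF assms(2), of _ 3] by (smt (verit))+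
  then show ?thesis using assms(1)[of x] assms(1)[of "x-1"] assms(1)[of "x-2"] assms(1)[of "x-3"] by linarith
qed

lemma taylor3_spline_step: "taylor3 (4/3) spline_step"
proof (rule taylor3I)
  define p1 where "p1 x = (max 0 x)\<^sup>2" for x :: real
  define p2 where "p2 x = max 0 x" for x :: real
  let ?f1 = "\<lambda>x. (p1 x - 3 * p1 (x - 1) + 3 * p1 (x - 2) - p1 (x - 3)) / 2"
  let ?f2 = "\<lambda>x. p2 x - 3 * p2 (x - 1) + 3 * p2 (x - 2) - p2 (x - 3)"
  show "spline_step \<in> borel_measurable borel" unfolding spline_step_def[abs_def] by measurable
  show "?f1 \<in> borel_measurable borel" unfolding p1_def by measurable
  show "?f2 \<in> borel_measurable borel" unfolding p2_def by measurable
  fix x :: real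
  show "\<bar>spline_step x\<bar> \<le> 36" using spline_step_range[of x] by simp
  have "\<bar>p1 x - 3 * p1 (x - 1) + 3 * p1 (x - 2) - p1 (x - 3)\<bar> \<le> 4 * 9"
  proof (rule third_difference_bound)
    show "mono p1" unfolding p1_def by (intro monoI power_mono) auto
    fix x :: real assume "x \<ge> 3"
    then show "p1 x - 3 * p1 (x - 1) + 3 * p1 (x - 2) - p1 (x - 3) = 0"
      by (simp add: p1_def power2_eq_square algebra_simps)
  qed (auto simp: p1_def)
  then show "\<bar>?f1 x\<bar> \<le> 36" by simp
  have "\<bar>?f2 x\<bar> \<le> 4 * 3"
  proof (rule third_difference_bound)
    show "mono p2" unfolding p2_def by (intro monoI) auto
    fix x :: real assume "x \<ge> 3"
    then show "p2 x - 3 * p2 (x - 1) + 3 * p2 (x - 2) - p2 (x - 3) = 0" by (simp add: p2_def)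
  qed (auto simp: p2_def)
  then show "\<bar>?f2 x\<bar> \<le> 36" by simp
  fix h :: real
  define E where "E x = (max 0 (x + h)) ^ 3 - (max 0 x) ^ 3 - 3 * (max 0 x)\<^sup>2 * h - 3 * max 0 x * h\<^sup>2" for x
  have E: "\<bar>E x\<bar> \<le> \<bar>h\<bar> ^ 3" for x unfolding E_def by (rule cube_pos_part_taylor)
  have "spline_step (x + h) - spline_step x - ?f1 x * h - ?f2 x * h\<^sup>2 / 2
    = (E x - 3 * E (x - 1) + 3 * E (x - 2) - E (x - 3)) / 6"
  proof -
    have "x + h - 1 = x - 1 + h" "x + h - 2 = x - 2 + h" "x + h - 3 = x - 3 + h" by simp_all
    then show ?thesis unfolding spline_step_def E_def p1_def p2_def by (simp add: field_simps)
  qed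
  \<comment> \<open>The constant is \<open>(1 + 3 + 3 + 1) / 6 = 4/3\<close>.\<close>
  moreover have "\<bar>(E x - 3 * E (x - 1) + 3 * E (x - 2) - E (x - 3)) / 6\<bar> \<le> 4/3 * \<bar>h\<bar> ^ 3"
  proof -
    have "\<bar>(a - 3 * b + 3 * c - d) / 6\<bar> \<le> 4/3 * H"
      if "\<bar>a\<bar> \<le> H" "\<bar>b\<bar> \<le> H" "\<bar>c\<bar> \<le> H" "\<bar>d\<bar> \<le> H" for a b c d H :: real
      using that by (simp add: abs_le_iff)
    from this[OF E E E E] show ?thesis .
  qed
  ultimately show "\<bar>spline_step (x + h) - spline_step x - ?f1 x * h - ?f2 x * h\<^sup>2 / 2\<bar> \<le> 4/3 * \<bar>h\<bar> ^ 3"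
    by (simp only:)
qed

lemma taylor3_affine:
  assumes f: "taylor3 L f" and "c > 0"
  shows "taylor3 (L * c ^ 3) (\<lambda>x. f (c * (x - t)))"
proof (rule taylor3E[OF f])
  fix f1 f2 B
  assume m [measurable]: "f \<in> borel_measurable borel" "f1 \<in> borel_measurable borel" "f2 \<in> borel_measurable borel"
    and bd: "\<And>x. \<bar>f x\<bar> \<le> B" "\<And>x. \<bar>f1 x\<bar> \<le> B" "\<And>x. \<bar>f2 x\<bar> \<le> B"
    and T: "\<And>x h. \<bar>f (x + h) - f x - f1 x * h - f2 x * h\<^sup>2 / 2\<bar> \<le> L * \<bar>h\<bar> ^ 3"
  have B: "0 \<le> B" using bd(1)[of 0] by linarith
  show ?thesis
  proof (rule taylor3I)
    show "(\<lambda>x. f (c * (x - t))) \<in> borel_measurable borel" by measurable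
    show "(\<lambda>x. c * f1 (c * (x - t))) \<in> borel_measurable borel" by measurable
    show "(\<lambda>x. c\<^sup>2 * f2 (c * (x - t))) \<in> borel_measurable borel" by measurable
    fix x
    have nn: "0 \<le> c * B" "0 \<le> c\<^sup>2 * B" using B \<open>c > 0\<close> by simp_all
    have i: "\<bar>c * f1 (c * (x - t))\<bar> \<le> c * B" "\<bar>c\<^sup>2 * f2 (c * (x - t))\<bar> \<le> c\<^sup>2 * B"
      unfolding abs_mult using bd \<open>c > 0\<close> by (auto intro!: mult_left_mono)
    show "\<bar>f (c * (x - t))\<bar> \<le> B + c * B + c\<^sup>2 * B" using bd(1)[of "c * (x - t)"] nn by linarith
    show "\<bar>c * f1 (c * (x - t))\<bar> \<le> B + c * B + c\<^sup>2 * B" using i nn B by linarith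
    show "\<bar>c\<^sup>2 * f2 (c * (x - t))\<bar> \<le> B + c * B + c\<^sup>2 * B" using i nn B by linarith
    fix h
    have "c * (x + h - t) = c * (x - t) + c * h" by (simp add: algebra_simps)
    then show "\<bar>f (c * (x + h - t)) - f (c * (x - t)) - c * f1 (c * (x - t)) * h - c\<^sup>2 * f2 (c * (x - t)) * h\<^sup>2 / 2\<bar> \<le> L * c ^ 3 * \<bar>h\<bar> ^ 3"
      using T[of "c * (x - t)" "c * h"] \<open>c > 0\<close>
      by (simp add: power_mult_distrib abs_mult mult_ac)
  qed
qed

lemma taylor3_diff:
  assumes f: "taylor3 L f" and g: "taylor3 L' g"
  shows "taylor3 (L + L') (\<lambda>x. f x - g x)"
proof (rule taylor3E[OF f], rule taylor3E[OF g])
  fix f1 f2 B g1 g2 B'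
  assume m [measurable]: "f \<in> borel_measurable borel" "f1 \<in> borel_measurable borel" "f2 \<in> borel_measurable borel"
    and bd: "\<And>x. \<bar>f x\<bar> \<le> B" "\<And>x. \<bar>f1 x\<bar> \<le> B" "\<And>x. \<bar>f2 x\<bar> \<le> B"
    and T: "\<And>x h. \<bar>f (x + h) - f x - f1 x * h - f2 x * h\<^sup>2 / 2\<bar> \<le> L * \<bar>h\<bar> ^ 3"
    and m' [measurable]: "g \<in> borel_measurable borel" "g1 \<in> borel_measurable borel" "g2 \<in> borel_measurable borel"
    and bd': "\<And>x. \<bar>g x\<bar> \<le> B'" "\<And>x. \<bar>g1 x\<bar> \<le> B'" "\<And>x. \<bar>g2 x\<bar> \<le> B'"
    and T': "\<And>x h. \<bar>g (x + h) - g x - g1 x * h - g2 x * h\<^sup>2 / 2\<bar> \<le> L' * \<bar>h\<bar> ^ 3"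
  show ?thesis
  proof (rule taylor3I)
    show "(\<lambda>x. f x - g x) \<in> borel_measurable borel" by measurable
    show "(\<lambda>x. f1 x - g1 x) \<in> borel_measurable borel" by measurable
    show "(\<lambda>x. f2 x - g2 x) \<in> borel_measurable borel" by measurable
    fix x
    show "\<bar>f x - g x\<bar> \<le> B + B'" using bd(1)[of x] bd'(1)[of x] by linarith
    show "\<bar>f1 x - g1 x\<bar> \<le> B + B'" using bd(2)[of x] bd'(2)[of x] by linarith
    show "\<bar>f2 x - g2 x\<bar> \<le> B + B'" using bd(3)[of x] bd'(3)[of x] by linarith
    fix h
    have "f (x + h) - g (x + h) - (f x - g x) - (f1 x - g1 x) * h - (f2 x - g2 x) * h\<^sup>2 / 2
      = (f (x + h) - f x - f1 x * h - f2 x * h\<^sup>2 / 2) - (g (x + h) - g x - g1 x * h - g2 x * h\<^sup>2 / 2)"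
      by (simp add: left_diff_distrib diff_divide_distrib)
    then show "\<bar>f (x + h) - g (x + h) - (f x - g x) - (f1 x - g1 x) * h - (f2 x - g2 x) * h\<^sup>2 / 2\<bar> \<le> (L + L') * \<bar>h\<bar> ^ 3"
      using T[of x h] T'[of x h] unfolding distrib_right by linarith
  qed
qed

text \<open>The spline rises over an interval of length 3; rescaling to length
  \<open>\<delta>\<close> multiplies the remainder constant by \<open>(3 / \<delta>)^3\<close>, and
  \<open>4/3 * 27 = 36\<close>.\<close>

lemma smooth_step:
  fixes t \<delta> :: real
  assumes "\<delta> > 0"
  obtains f where "taylor3 (36 / \<delta> ^ 3) f" "\<And>x. 0 \<le> f x" "\<And>x. f x \<le> 1"
    "\<And>x. x \<le> t \<Longrightarrow> f x = 0" "\<And>x. x \<ge> t + \<delta> \<Longrightarrow> f x = 1"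
proof
  let ?f = "\<lambda>x. spline_step (3 / \<delta> * (x - t))"
  have "taylor3 (4/3 * (3 / \<delta>) ^ 3) ?f"
    by (rule taylor3_affine[OF taylor3_spline_step]) (use assms in simp)
  then show "taylor3 (36 / \<delta> ^ 3) ?f" by (simp add: power_divide)
  show "?f x = 0" if "x \<le> t" for x
    by (rule spline_step_0) (use that assms in \<open>simp add: mult_nonneg_nonpos divide_nonpos_pos\<close>)
  show "?f x = 1" if "x \<ge> t + \<delta>" for x
    by (rule spline_step_1) (use that assms in \<open>simp add: field_simps\<close>)
qed (use spline_step_range in auto)


text \<open>A smooth step from \<open>t - \<delta>\<close> to \<open>t\<close> dominates the
  indicator of the tail and is itself dominated by the indicator of the tail at
  \<open>t - \<delta>\<close>. The first bound is used for the sum, the second for the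
  Gaussian.\<close>

theorem (in prob_space) Lindeberg_tail:
  fixes X :: "'i \<Rightarrow> 'a \<Rightarrow> real"
  assumes F: "finite F" and X: "indep_vars (\<lambda>_. borel) X F" "\<And>i. i \<in> F \<Longrightarrow> integrable M (\<lambda>\<omega>. X i \<omega> ^ 4)"
    "\<And>i. i \<in> F \<Longrightarrow> expectation (X i) = 0" "\<And>i. i \<in> F \<Longrightarrow> expectation (\<lambda>\<omega>. (X i \<omega>)\<^sup>2) = v i"
    "\<And>i. i \<in> F \<Longrightarrow> expectation (\<lambda>\<omega>. X i \<omega> ^ 4) \<le> m4 i"
    and \<delta>: "\<delta> > 0"
  shows "prob {\<omega> \<in> space M. (\<Sum>i\<in>F. X i \<omega>) \<ge> t}
    \<le> measure stdN {g. sqrt (\<Sum>i\<in>F. v i) * g > t - \<delta>} + 36 / \<delta> ^ 3 * (\<Sum>i\<in>F. 2 + m4 i + 3 * (v i)\<^sup>2)"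
proof -
  interpret N: real_distribution stdN by (rule real_dist_normal_dist)
  obtain f where f: "taylor3 (36 / \<delta> ^ 3) f" and r: "\<And>x. 0 \<le> f x" "\<And>x. f x \<le> 1"
    and f0: "\<And>x. x \<le> t - \<delta> \<Longrightarrow> f x = 0" and f1: "\<And>x. x \<ge> t - \<delta> + \<delta> \<Longrightarrow> f x = 1"
    using smooth_step[OF \<delta>, of "t - \<delta>"] by blast
  have fm [measurable]: "f \<in> borel_measurable borel" using taylor3_bounded[OF f] by blast
  have rv: "X i \<in> borel_measurable M" if "i \<in> F" for i
    using X(1) that unfolding indep_vars_def by auto
  have S [measurable]: "(\<lambda>\<omega>. \<Sum>i\<in>F. X i \<omega>) \<in> borel_measurable M"
    by (rule borel_measurable_sum) (use rv in auto)
  have "prob {\<omega> \<in> space M. (\<Sum>i\<in>F. X i \<omega>) \<ge> t} = expectation (indicator {\<omega> \<in> space M. (\<Sum>i\<in>F. X i \<omega>) \<ge> t})"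
    by simp
  also have "\<dots> \<le> expectation (\<lambda>\<omega>. f (\<Sum>i\<in>F. X i \<omega>))"
    by (rule integral_mono) (use r f1 in \<open>auto intro!: integrable_const_bound[where B=1] simp: indicator_def\<close>)
  also have "\<dots> \<le> (LINT g|stdN. f (sqrt (\<Sum>i\<in>F. v i) * g)) + 36 / \<delta> ^ 3 * (\<Sum>i\<in>F. 2 + m4 i + 3 * (v i)\<^sup>2)"
    using Lindeberg_replacement[OF F X(1) f X(2-5)] by linarith
  also have "(LINT g|stdN. f (sqrt (\<Sum>i\<in>F. v i) * g)) \<le> (LINT g|stdN. indicator {g. sqrt (\<Sum>i\<in>F. v i) * g > t - \<delta>} g)"
    by (rule integral_mono) (use r f0 in \<open>auto intro!: N.integrable_const_bound[where B=1] simp: indicator_def not_less\<close>)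
  also have "\<dots> = measure stdN {g. sqrt (\<Sum>i\<in>F. v i) * g > t - \<delta>}" by simp
  finally show ?thesis by simp
qed

text \<open>The test function is the difference of two smooth steps: it rises on
  \<open>[c, c + \<delta>]\<close>, equals 1 on the middle third and falls on the last third. Its
  constant is \<open>36 + 36 = 72\<close>.\<close>

theorem (in prob_space) Lindeberg_window:
  fixes X :: "'i \<Rightarrow> 'a \<Rightarrow> real"
  assumes F: "finite F" and X: "indep_vars (\<lambda>_. borel) X F" "\<And>i. i \<in> F \<Longrightarrow> integrable M (\<lambda>\<omega>. X i \<omega> ^ 4)"
    "\<And>i. i \<in> F \<Longrightarrow> expectation (X i) = 0" "\<And>i. i \<in> F \<Longrightarrow> expectation (\<lambda>\<omega>. (X i \<omega>)\<^sup>2) = v i"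
    "\<And>i. i \<in> F \<Longrightarrow> expectation (\<lambda>\<omega>. X i \<omega> ^ 4) \<le> m4 i"
    and \<delta>: "\<delta> > 0"
  shows "measure stdN {g. c + \<delta> \<le> sqrt (\<Sum>i\<in>F. v i) * g \<and> sqrt (\<Sum>i\<in>F. v i) * g \<le> c + 2 * \<delta>}
      - 72 / \<delta> ^ 3 * (\<Sum>i\<in>F. 2 + m4 i + 3 * (v i)\<^sup>2)
    \<le> prob {\<omega> \<in> space M. c \<le> (\<Sum>i\<in>F. X i \<omega>) \<and> (\<Sum>i\<in>F. X i \<omega>) \<le> c + 3 * \<delta>}"
proof -
  interpret N: real_distribution stdN by (rule real_dist_normal_dist)
  obtain f where f: "taylor3 (36 / \<delta> ^ 3) f" and r: "\<And>x. 0 \<le> f x" "\<And>x. f x \<le> 1"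
    and f0: "\<And>x. x \<le> c \<Longrightarrow> f x = 0" and f1: "\<And>x. x \<ge> c + \<delta> \<Longrightarrow> f x = 1"
    using smooth_step[OF \<delta>, of "c"] by blast
  obtain h where h: "taylor3 (36 / \<delta> ^ 3) h" and rh: "\<And>x. 0 \<le> h x" "\<And>x. h x \<le> 1"
    and h0: "\<And>x. x \<le> c + 2 * \<delta> \<Longrightarrow> h x = 0" and h1: "\<And>x. x \<ge> c + 2 * \<delta> + \<delta> \<Longrightarrow> h x = 1"
    using smooth_step[OF \<delta>, of "c + 2 * \<delta>"] by blast
  define w where "w x = f x - h x" for x
  have w: "taylor3 (72 / \<delta> ^ 3) w"
    using taylor3_diff[OF f h] by (simp add: w_def[abs_def] flip: add_divide_distrib)
  have wm [measurable]: "w \<in> borel_measurable borel" using taylor3_bounded[OF w] by blast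
  have w_bd: "\<bar>w x\<bar> \<le> 1" for x using r[of x] rh[of x] by (simp add: w_def abs_le_iff)
  have w_le: "w x \<le> indicator {x. c \<le> x \<and> x \<le> c + 3 * \<delta>} x" for x
    using r[of x] rh[of x] f0[of x] h1[of x] f1[of x] \<delta> by (auto simp: w_def indicator_def not_le)
  have w_ge: "indicator {x. c + \<delta> \<le> x \<and> x \<le> c + 2 * \<delta>} x \<le> w x" for x
  proof (cases "x \<le> c + 2 * \<delta>")
    case True then show ?thesis using r[of x] f1[of x] h0[of x] by (auto simp: w_def indicator_def)
  next
    case False
    then have "f x = 1" using f1[of x] \<delta> by simp
    then show ?thesis using rh[of x] False by (simp add: w_def)
  qed
  have rv: "X i \<in> borel_measurable M" if "i \<in> F" for i
    using X(1) that unfolding indep_vars_def by auto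
  have S [measurable]: "(\<lambda>\<omega>. \<Sum>i\<in>F. X i \<omega>) \<in> borel_measurable M"
    by (rule borel_measurable_sum) (use rv in auto)
  let ?s = "sqrt (\<Sum>i\<in>F. v i)"
  have "measure stdN {g. c + \<delta> \<le> ?s * g \<and> ?s * g \<le> c + 2 * \<delta>} = (LINT g|stdN. indicator {g. c + \<delta> \<le> ?s * g \<and> ?s * g \<le> c + 2 * \<delta>} g)"
    by simp
  also have "\<dots> \<le> (LINT g|stdN. w (?s * g))"
  proof (rule integral_mono)
    show "integrable stdN (\<lambda>g. w (?s * g))" by (rule N.integrable_const_bound[where B=1]) (use w_bd in auto)
    fix g show "indicator {g. c + \<delta> \<le> ?s * g \<and> ?s * g \<le> c + 2 * \<delta>} g \<le> w (?s * g)"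
      using w_ge[of "?s * g"] by (simp add: indicator_def)
  qed (auto intro!: N.integrable_const_bound[where B=1])
  also have "\<dots> \<le> expectation (\<lambda>\<omega>. w (\<Sum>i\<in>F. X i \<omega>)) + 72 / \<delta> ^ 3 * (\<Sum>i\<in>F. 2 + m4 i + 3 * (v i)\<^sup>2)"
    using Lindeberg_replacement[OF F X(1) w X(2-5)] by linarith
  also have "expectation (\<lambda>\<omega>. w (\<Sum>i\<in>F. X i \<omega>))
     \<le> expectation (indicator {\<omega> \<in> space M. c \<le> (\<Sum>i\<in>F. X i \<omega>) \<and> (\<Sum>i\<in>F. X i \<omega>) \<le> c + 3 * \<delta>})"
  proof (rule integral_mono)
    show "integrable M (\<lambda>\<omega>. w (\<Sum>i\<in>F. X i \<omega>))" by (rule integrable_const_bound[where B=1]) (use w_bd in auto)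
    fix \<omega> assume "\<omega> \<in> space M"
    then show "w (\<Sum>i\<in>F. X i \<omega>) \<le> indicator {\<omega> \<in> space M. c \<le> (\<Sum>i\<in>F. X i \<omega>) \<and> (\<Sum>i\<in>F. X i \<omega>) \<le> c + 3 * \<delta>} \<omega>"
      using w_le[of "\<Sum>i\<in>F. X i \<omega>"] by (simp add: indicator_def)
  qed (auto intro!: integrable_const_bound[where B=1])
  finally show ?thesis by simp
qed

text \<open>On the interval the normal density is at least its value at
  \<open>r / s\<close>.\<close>

lemma stdN_window_lower_bound:
  assumes "s > 0" "b \<ge> a" "\<bar>a\<bar> \<le> r" "\<bar>b\<bar> \<le> r"
  shows "measure stdN {g. a \<le> s * g \<and> s * g \<le> b} \<ge> (b - a) / (s * sqrt (2 * pi)) * exp (- r\<^sup>2 / (2 * s\<^sup>2))"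
proof -
  interpret N: real_distribution stdN by (rule real_dist_normal_dist)
  define k where "k = exp (- r\<^sup>2 / (2 * s\<^sup>2)) / sqrt (2 * pi)"
  have k0: "0 \<le> k" by (simp add: k_def)
  have set: "{g. a \<le> s * g \<and> s * g \<le> b} = {a / s..b / s}"
    using assms by (auto simp: field_simps)
  have kle: "k \<le> std_normal_density g" if "g \<in> {a / s..b / s}" for g
  proof -
    have "\<bar>s * g\<bar> \<le> r" using that assms by (auto simp: field_simps abs_le_iff)
    then have "(s * g)\<^sup>2 \<le> r\<^sup>2" using power_mono[of "\<bar>s * g\<bar>" r 2] by simp
    then have "g\<^sup>2 \<le> r\<^sup>2 / s\<^sup>2" using assms by (simp add: power_mult_distrib field_simps)
    then show ?thesis unfolding k_def std_normal_density_def by (simp add: divide_right_mono field_simps)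
  qed
  have "ennreal (k * (b / s - a / s)) = (\<integral>\<^sup>+g. ennreal k * indicator {a / s..b / s} g \<partial>lborel)"
    using k0 assms by (simp add: nn_integral_cmult ennreal_mult' divide_right_mono)
  also have "\<dots> \<le> (\<integral>\<^sup>+g. ennreal (std_normal_density g) * indicator {a / s..b / s} g \<partial>lborel)"
    by (rule nn_integral_mono) (use kle in \<open>auto simp: indicator_def intro!: ennreal_leI\<close>)
  also have "\<dots> = emeasure stdN {a / s..b / s}" by (simp add: emeasure_density)
  finally have "k * (b / s - a / s) \<le> measure stdN {a / s..b / s}"
    by (simp add: N.emeasure_eq_measure)
  moreover have "k * (b / s - a / s) = (b - a) / (s * sqrt (2 * pi)) * exp (- r\<^sup>2 / (2 * s\<^sup>2))"
    using assms by (simp add: k_def field_simps)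
  ultimately show ?thesis unfolding set by simp
qed

section \<open>Random coding\<close>

text \<open>Averaged over a codeword drawn from \<open>\<nu>\<close>, the part of \<open>A\<close>
  not yet covered shrinks by the factor \<open>1 - p\<close>; hence some fixed codeword does at
  least as well. Repeating this replaces the analysis of an independent random codebook.\<close>

lemma greedy_covering:
  fixes P :: "'a measure" and \<nu> :: "'b measure"
  assumes "prob_space P" "prob_space \<nu>" and E [measurable]: "E \<in> sets (P \<Otimes>\<^sub>M \<nu>)" and A [measurable]: "A \<in> sets P"
    and p: "\<And>y. y \<in> A \<Longrightarrow> p \<le> measure \<nu> {x \<in> space \<nu>. (y, x) \<in> E}" and p1: "p \<le> 1"
  shows "\<exists>c. (\<forall>i. c i \<in> space \<nu>) \<and> measure P {y \<in> A. \<forall>i<K. (y, c i) \<notin> E} \<le> (1 - p) ^ K"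
proof (induction K)
  case 0
  interpret P: prob_space P by fact
  interpret \<nu>: prob_space \<nu> by fact
  obtain x where "x \<in> space \<nu>" using \<nu>.not_empty by blast
  then show ?case by (intro exI[of _ "\<lambda>_. x"]) simp
next
  case (Suc K)
  interpret P: prob_space P by fact
  interpret \<nu>: prob_space \<nu> by fact
  interpret PN: pair_prob_space P \<nu> ..
  obtain c where c: "\<And>i. c i \<in> space \<nu>" and IH: "measure P {y \<in> A. \<forall>i<K. (y, c i) \<notin> E} \<le> (1 - p) ^ K"
    using Suc.IH by blast
  define R where "R = {y \<in> A. \<forall>i<K. (y, c i) \<notin> E}"
  have Em: "{y \<in> space P. (y, x) \<in> E} \<in> sets P" if "x \<in> space \<nu>" for x
    using sets_Pair2[OF E, of x] sets.sets_into_space[OF E] by (simp add: vimage_def space_pair_measure) (smt (verit) Collect_cong mem_Sigma_iff subset_iff)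
  have "R = A - (\<Union>i\<in>{..<K}. {y \<in> space P. (y, c i) \<in> E})"
    using sets.sets_into_space[OF A] by (auto simp: R_def)
  then have R [measurable]: "R \<in> sets P" using Em[OF c] by simp
  have RA: "R \<subseteq> A" by (auto simp: R_def)
  define \<phi> where "\<phi> y x = indicator R y * (1 - indicator E (y, x) :: real)" for y x
  have \<phi>m [measurable]: "(\<lambda>(y, x). \<phi> y x) \<in> borel_measurable (P \<Otimes>\<^sub>M \<nu>)"
    unfolding \<phi>_def by (simp add: case_prod_beta)
  have int: "integrable (P \<Otimes>\<^sub>M \<nu>) (\<lambda>(y, x). \<phi> y x)"
    by (rule PN.integrable_const_bound[where B=1]) (auto simp: \<phi>_def indicator_def)
  have f: "(LINT y|P. \<phi> y x) = measure P {y \<in> R. (y, x) \<notin> E}" if "x \<in> space \<nu>" for x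
  proof -
    have "(LINT y|P. \<phi> y x) = (LINT y|P. indicator {y \<in> R. (y, x) \<notin> E} y)"
      by (intro Bochner_Integration.integral_cong) (auto simp: \<phi>_def indicator_def)
    also have "{y \<in> R. (y, x) \<notin> E} \<inter> space P = {y \<in> R. (y, x) \<notin> E}" using sets.sets_into_space[OF R] by auto
    then have "(LINT y|P. indicator {y \<in> R. (y, x) \<notin> E} y) = measure P {y \<in> R. (y, x) \<notin> E}" by simp
    finally show ?thesis .
  qed
  \<comment> \<open>If every codeword left more than \<open>(1 - p) * measure P R\<close> uncovered,
    so would the average; Fubini and the lower bound \<open>p\<close> on each section of
    \<open>E\<close> contradict this.\<close>
  have "\<exists>x\<in>space \<nu>. (LINT y|P. \<phi> y x) \<le> (1 - p) * measure P R"
  proof (rule ccontr)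
    assume "\<not> ?thesis"
    then have "(1 - p) * measure P R < (LINT x|\<nu>. LINT y|P. \<phi> y x)"
      by (intro \<nu>.expectation_greater PN.integrable_snd[OF int] AE_I2) auto
    also have "\<dots> = (LINT y|P. LINT x|\<nu>. \<phi> y x)"
      by (rule PN.Fubini_integral[OF int])
    also have "\<dots> \<le> (LINT y|P. indicator R y * (1 - p))"
    proof (rule integral_mono)
      show "integrable P (\<lambda>y. LINT x|\<nu>. \<phi> y x)" using PN.integrable_fst'[OF int] by simp
      show "integrable P (\<lambda>y. indicator R y * (1 - p))"
        by (rule P.integrable_const_bound[where B="\<bar>1 - p\<bar>"]) (auto simp: indicator_def)
      fix y assume y: "y \<in> space P"
      show "(LINT x|\<nu>. \<phi> y x) \<le> indicator R y * (1 - p)"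
      proof (cases "y \<in> R")
        case True
        have m: "{x \<in> space \<nu>. (y, x) \<in> E} \<in> sets \<nu>"
          using y by measurable
        have "(LINT x|\<nu>. \<phi> y x) = (LINT x|\<nu>. 1 - indicator {x \<in> space \<nu>. (y, x) \<in> E} x)"
          using True by (intro Bochner_Integration.integral_cong) (auto simp: \<phi>_def indicator_def)
        also have "\<dots> = 1 - measure \<nu> {x \<in> space \<nu>. (y, x) \<in> E}"
        proof -
          have "integrable \<nu> (\<lambda>x. indicator {x \<in> space \<nu>. (y, x) \<in> E} x :: real)"
            by (rule \<nu>.integrable_const_bound[where B=1]) (use m in \<open>auto simp: indicator_def\<close>)
          then show ?thesis using m by (subst Bochner_Integration.integral_diff) (auto simp: \<nu>.prob_space)
        qed
        also have "\<dots> \<le> 1 - p" using p[of y] True RA by auto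
        finally show ?thesis using True by simp
      qed (simp add: \<phi>_def)
    qed
    also have "\<dots> = (1 - p) * measure P R" using R by simp
    finally show False by simp
  qed
  then obtain x where x: "x \<in> space \<nu>" and le: "measure P {y \<in> R. (y, x) \<notin> E} \<le> (1 - p) * measure P R"
    using f by auto
  define c' where "c' = c(K := x)"
  have "{y \<in> A. \<forall>i<Suc K. (y, c' i) \<notin> E} = {y \<in> R. (y, x) \<notin> E}"
    unfolding R_def c'_def by (auto simp: less_Suc_eq)
  moreover have "(1 - p) * measure P R \<le> (1 - p) ^ Suc K"
    using IH p1 by (simp add: R_def mult_left_mono)
  ultimately show ?case using le c x
    by (intro exI[of _ c']) (auto simp: c'_def)
qed

text \<open>The encoder sends the first codeword within distance \<open>d\<close>, and message 1 if
  there is none. Codewords are numbered from 0 and messages from 1, hence the shifts by one in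
  \<open>f\<close> and \<open>g\<close>.\<close>

lemma Rop_le_of_codebook:
  fixes M :: "'w measure"
  assumes "prob_space M" and U [measurable]: "\<And>i. i \<in> {1..n} \<Longrightarrow> U i \<in> borel_measurable M" and K: "K \<ge> 1" and n: "n > 0"
    and err: "measure M {\<omega> \<in> space M. \<forall>i<K. distortion n (\<lambda>i. U i \<omega>) (c i) > d} \<le> eps"
  shows "Rop M U n d eps \<le> ln (real K) / real n"
proof -
  define ok where "ok x i \<longleftrightarrow> i < K \<and> distortion n x (c i) \<le> d" for x i
  define f where "f x = (if \<exists>i. ok x i then Suc (LEAST i. ok x i) else 1)" for x
  define g where "g j = c (j - 1)" for j
  have f_ok: "f x \<ge> 1" "f x - 1 < K" "distortion n x (c (f x - 1)) \<le> d" if "\<exists>i. ok x i" for x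
  proof -
    have "ok x (LEAST i. ok x i)" using that by (rule LeastI_ex)
    then have "ok x (f x - 1)" "f x \<ge> 1" using that by (simp_all add: f_def)
    then show "f x \<ge> 1" "f x - 1 < K" "distortion n x (c (f x - 1)) \<le> d" by (auto simp: ok_def)
  qed
  have ev: "{\<omega> \<in> space M. distortion n (\<lambda>i. U i \<omega>) (g (f (\<lambda>i. U i \<omega>))) > d}
      = {\<omega> \<in> space M. \<forall>i<K. distortion n (\<lambda>i. U i \<omega>) (c i) > d}" (is "?L = ?R")
  proof (intro Collect_cong conj_cong refl)
    fix \<omega>
    let ?x = "\<lambda>i. U i \<omega>"
    show "distortion n ?x (g (f ?x)) > d \<longleftrightarrow> (\<forall>i<K. distortion n ?x (c i) > d)"
    proof (cases "\<exists>i. ok ?x i")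
      case True
      then have "distortion n ?x (g (f ?x)) \<le> d" using f_ok(3)[OF True] by (simp add: g_def)
      then show ?thesis using True by (auto simp: ok_def not_less)
    next
      case False
      then show ?thesis using K by (auto simp: f_def g_def ok_def not_le)
    qed
  qed
  have D: "(\<lambda>\<omega>. distortion n (\<lambda>i. U i \<omega>) (c i)) \<in> borel_measurable M" for i
    unfolding distortion_def by measurable
  have code: "is_code M U n K d eps f g"
    unfolding is_code_def
  proof (intro conjI allI impI)
    fix x show "f x \<in> {1..K}"
    proof (cases "\<exists>i. ok x i")
      case True
      then show ?thesis using f_ok(1,2)[OF True] by auto
    next
      case False
      then show ?thesis using K by (simp add: f_def)
    qed
  next
    fix x y :: "nat \<Rightarrow> real" assume "\<forall>i\<in>{1..n}. x i = y i"
    then have "distortion n x z = distortion n y z" for z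
      unfolding distortion_def by (intro arg_cong2[where f="(*)"] refl sum.cong) auto
    then have "ok x = ok y" by (simp add: ok_def fun_eq_iff)
    then show "f x = f y" by (simp add: f_def)
  next
    show "{\<omega> \<in> space M. distortion n (\<lambda>i. U i \<omega>) (g (f (\<lambda>i. U i \<omega>))) > d} \<in> sets M"
      unfolding ev using D by measurable
  qed (use err in \<open>simp add: ev\<close>)
  define S where "S = {Mc. \<exists>f g. is_code M U n Mc d eps f g}"
  have KS: "K \<in> S" using code by (auto simp: S_def)
  \<comment> \<open>The infimum is attained, so it belongs to an actual code and is at least 1; the
    logarithm is then monotone in the required range.\<close>
  have "Inf S \<in> S" using KS Inf_nat_def1[of S] by blast
  then have "1 \<le> Inf S" by (auto simp: S_def is_code_def)
  moreover have "Inf S \<le> K" using KS by (rule cInf_lower) simp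
  ultimately have "ln (real (Inf S)) \<le> ln (real K)" by simp
  then show ?thesis unfolding Rop_def S_def[symmetric] by (simp add: divide_right_mono)
qed

section \<open>The Gaussian tail function and its inverse\<close>

lemma Qfun_eq: "Qfun x = measure stdN {x<..}"
proof -
  have "measure stdN {x<..} = (LINT t|stdN. indicator {x<..} t)" by simp
  also have "\<dots> = (LINT t|lborel. std_normal_density t *\<^sub>R indicator {x<..} t)"
    by (rule integral_density) auto
  also have "\<dots> = Qfun x"
    unfolding Qfun_def interval_lebesgue_integral_def set_lebesgue_integral_def
    by (auto intro!: Bochner_Integration.integral_cong simp: indicator_def einterval_def)
  finally show ?thesis by simp
qed

lemma Qfun_diff: assumes "x \<le> y" shows "Qfun x - Qfun y = measure stdN {x<..y}"
proof -
  interpret N: real_distribution stdN by (rule real_dist_normal_dist)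
  have "measure stdN ({x<..y} \<union> {y<..}) = measure stdN {x<..y} + measure stdN {y<..}"
    by (rule N.finite_measure_Union) auto
  moreover have "{x<..y} \<union> {y<..} = {x<..}" using assms by auto
  ultimately show ?thesis by (simp add: Qfun_eq)
qed

text \<open>Only the closed right half of the interval is used, whence the factor 2, and
  \<open>\<bar>x\<bar> + 1\<close> bounds the modulus of its points. This converts an excess error
  probability of order \<open>1 / ln n\<close> into a shift of the quantile of the same
  order.\<close>

lemma Qfun_decrease:
  assumes "0 \<le> h" "h \<le> 1"
  shows "Qfun (x + h) \<le> Qfun x - h / (2 * sqrt (2 * pi)) * exp (- (\<bar>x\<bar> + 1)\<^sup>2 / 2)"
proof -
  interpret N: real_distribution stdN by (rule real_dist_normal_dist)
  show ?thesis
  proof (cases "h = 0")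
    case False
    have "h / (2 * sqrt (2 * pi)) * exp (- (\<bar>x\<bar> + 1)\<^sup>2 / 2) \<le> measure stdN {g. x + h / 2 \<le> 1 * g \<and> 1 * g \<le> x + h}"
      using stdN_window_lower_bound[of 1 "x + h / 2" "x + h" "\<bar>x\<bar> + 1"] assms by (auto simp: field_simps)
    also have "\<dots> \<le> measure stdN {x<..x + h}"
      using assms False by (intro N.finite_measure_mono) auto
    finally show ?thesis using Qfun_diff[of x "x + h"] assms by simp
  qed simp
qed

lemma Qfun_strict: assumes "x < y" shows "Qfun y < Qfun x"
proof -
  define h where "h = min 1 (y - x)"
  have h: "0 < h" "h \<le> 1" "x + h \<le> y" using assms by (auto simp: h_def)
  have "Qfun y \<le> Qfun (x + h)" using Qfun_diff[OF h(3)] by (smt (verit) measure_nonneg)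
  also have "\<dots> < Qfun x"
  proof -
    have "0 < h / (2 * sqrt (2 * pi)) * exp (- (\<bar>x\<bar> + 1)\<^sup>2 / 2)" using h by simp
    then show ?thesis using Qfun_decrease[of h x] h by linarith
  qed
  finally show ?thesis .
qed

text \<open>The definite description needs existence, from the intermediate value theorem for the
  continuous distribution function, and uniqueness, from strict monotonicity.\<close>

lemma Qfun_Qinv:
  assumes "0 < eps" "eps < 1"
  shows "Qfun (Qinv eps) = eps"
proof -
  interpret N: real_distribution stdN by (rule real_dist_normal_dist)
  have Q: "Qfun x = 1 - cdf stdN x" for x
  proof -
    have "measure stdN (space stdN - {..x}) = 1 - measure stdN {..x}" by (rule N.prob_compl) simp
    moreover have "space stdN - {..x} = {x<..}" by auto
    ultimately show ?thesis by (simp add: Qfun_eq cdf_def)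
  qed
  have cont: "isCont (cdf stdN) x" for x
  proof -
    have "emeasure stdN {x} = 0"
      by (simp add: emeasure_density nn_integral_cmult_indicator)
    then show ?thesis by (simp add: N.isCont_cdf N.emeasure_eq_measure)
  qed
  have "\<exists>x. cdf stdN x > 1 - eps"
  proof -
    have "eventually (\<lambda>x. cdf stdN x > 1 - eps) at_top"
      using order_tendstoD(1)[OF N.cdf_lim_at_top_prob] assms by simp
    then show ?thesis by (auto simp: eventually_at_top_linorder)
  qed
  then obtain b where b: "cdf stdN b > 1 - eps" ..
  have "\<exists>x. cdf stdN x < 1 - eps"
  proof -
    have "eventually (\<lambda>x. cdf stdN x < 1 - eps) at_bot"
      using order_tendstoD(2)[OF N.cdf_lim_at_bot] assms by simp
    then show ?thesis by (auto simp: eventually_at_bot_linorder)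
  qed
  then obtain a where a: "cdf stdN a < 1 - eps" ..
  have "a \<le> b" using N.cdf_nondecreasing[of b a] a b by linarith
  have "\<exists>x\<ge>a. x \<le> b \<and> cdf stdN x = 1 - eps"
    by (rule IVT) (use a b \<open>a \<le> b\<close> cont in auto)
  then obtain x where "cdf stdN x = 1 - eps" by auto
  then have x: "Qfun x = eps" using Q[of x] by simp
  show ?thesis unfolding Qinv_def
  proof (rule theI)
    fix y assume "Qfun y = eps"
    then show "y = x" using x Qfun_strict[of x y] Qfun_strict[of y x] by (cases x y rule: linorder_cases) auto
  qed fact
qed

section \<open>Averages of the spectrum\<close>

lemma gspec_bounds:
  assumes "a > 1"
  shows "(a - 1)\<^sup>2 \<le> gspec a w" "gspec a w \<le> (a + 1)\<^sup>2" "gspec a w > 0"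
proof -
  have "2 * a * cos w \<le> 2 * a * 1" "2 * a * (- 1) \<le> 2 * a * cos w"
    using assms by (intro mult_left_mono; simp)+
  then show 1: "(a - 1)\<^sup>2 \<le> gspec a w" "gspec a w \<le> (a + 1)\<^sup>2"
    by (auto simp: gspec_def power2_eq_square algebra_simps)
  have "0 < (a - 1)\<^sup>2" using assms by simp
  then show "gspec a w > 0" using 1 by linarith
qed

lemma gspec_minus [simp]: "gspec a (- w) = gspec a w"
  by (simp add: gspec_def)

lemma continuous_on_gspec [continuous_intros]: "continuous_on A (gspec a)"
  unfolding gspec_def by (intro continuous_intros)

text \<open>Averaged over \<open>w\<close>, this relates the averages for \<open>a\<close> and \<open>a\<^sup>2\<close>; iterating \<open>a \<mapsto> a\<^sup>2\<close> determines them.\<close>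

lemma gspec_doubling: "gspec a w * gspec a (pi - w) = gspec (a\<^sup>2) (2 * w)"
proof -
  have c: "cos (2 * w) = 2 * (cos w)\<^sup>2 - 1" by (rule cos_double_cos)
  show ?thesis
    unfolding gspec_def c by (simp add: cos_diff power2_eq_square algebra_simps)
qed

lemma gspec_pi_sum: "gspec a w + gspec a (pi - w) = 2 * (1 + a\<^sup>2)"
  by (simp add: gspec_def cos_diff)

lemma integral_reflect_0_pi:
  fixes f :: "real \<Rightarrow> real"
  shows "integral {0..pi} (\<lambda>w. f (pi - w)) = integral {0..pi} f"
  using Henstock_Kurzweil_Integration.integral_reflect_real[where f="\<lambda>w. f (pi - w)" and a=0 and b=pi]
    integral_shift_real_ivl[of 0 pi pi f] by (simp add: add.commute)

lemma integral_double_angle: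
  fixes f :: "real \<Rightarrow> real"
  assumes f: "continuous_on UNIV f" and even: "\<And>w. f (2 * pi - w) = f w"
  shows "integral {0..pi} (\<lambda>w. f (2 * w)) = integral {0..pi} f"
proof -
  have cf: "continuous_on A f" for A using f continuous_on_subset by blast
  have "(f has_integral integral {0..2 * pi} f) (cbox 0 (2 * pi))"
    unfolding cbox_interval by (intro integrable_integral integrable_continuous_interval cf)
  from has_integral_affinity'[OF this, of 2 0]
  have 1: "2 * integral {0..pi} (\<lambda>w. f (2 * w)) = integral {0..2 * pi} f"
    by (simp add: has_integral_iff)
  have "integral {0..2 * pi} f = integral {0..pi} f + integral {pi..2 * pi} f"
    by (rule Henstock_Kurzweil_Integration.integral_combine[symmetric]) (auto intro!: integrable_continuous_interval cf)
  also have "integral {pi..2 * pi} f = integral {0..pi} (\<lambda>w. f (w + pi))"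
    using integral_shift_real_ivl[of pi pi "2 * pi" f] by simp
  also have "\<dots> = integral {0..pi} (\<lambda>w. f (pi - w))"
  proof (rule Henstock_Kurzweil_Integration.integral_cong)
    fix w show "f (w + pi) = f (pi - w)" using even[of "w + pi"] by (simp add: algebra_simps)
  qed
  also have "\<dots> = integral {0..pi} f" by (rule integral_reflect_0_pi)
  finally show ?thesis using 1 by simp
qed

lemma gspec_2pi: "gspec a (2 * pi - w) = gspec a w"
  by (simp add: gspec_def)

text \<open>Jensen's formula by real means. Doubling gives \<open>L (b\<^sup>2) = 2 * L b\<close>,
  which \<open>2 * pi * ln b\<close> satisfies as well; along \<open>b = a ^ (2 ^ k)\<close> the
  discrepancy is multiplied by \<open>2 ^ k\<close> and yet stays bounded, so it is zero.\<close>

lemma integral_ln_gspec: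
  assumes "a > 1"
  shows "integral {0..pi} (\<lambda>w. ln (gspec a w)) = 2 * pi * ln a"
proof -
  define L where "L b = integral {0..pi} (\<lambda>w. ln (gspec b w))" for b
  have cl: "continuous_on A (\<lambda>w. ln (gspec b w))" if "b > 1" for A b
    using gspec_bounds(3)[OF that] by (intro continuous_intros) (auto simp: less_imp_neq[symmetric])
  have dbl: "L (b\<^sup>2) = 2 * L b" if b: "b > 1" for b
  proof -
    have b2: "b\<^sup>2 > 1" using b by simp
    have il: "(\<lambda>w. ln (gspec b w)) integrable_on {0..pi}" by (intro integrable_continuous_interval cl b)
    have il': "(\<lambda>w. ln (gspec b (pi - w))) integrable_on {0..pi}"
      using gspec_bounds(3)[OF b]
      by (intro integrable_continuous_interval continuous_on_ln continuous_on_compose2[OF continuous_on_gspec]) (auto intro!: continuous_intros simp: less_imp_neq[symmetric])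
    have "2 * L b = integral {0..pi} (\<lambda>w. ln (gspec b w)) + integral {0..pi} (\<lambda>w. ln (gspec b (pi - w)))"
      using integral_reflect_0_pi[of "\<lambda>w. ln (gspec b w)"] by (simp add: L_def)
    also have "\<dots> = integral {0..pi} (\<lambda>w. ln (gspec b w) + ln (gspec b (pi - w)))"
      by (rule Henstock_Kurzweil_Integration.integral_add[symmetric]) fact+
    also have "\<dots> = integral {0..pi} (\<lambda>w. ln (gspec (b\<^sup>2) (2 * w)))"
      unfolding gspec_doubling[symmetric]
      by (intro Henstock_Kurzweil_Integration.integral_cong ln_mult_pos[symmetric] gspec_bounds(3) b)
    also have "\<dots> = L (b\<^sup>2)"
      unfolding L_def by (rule integral_double_angle) (auto intro!: cl b2 simp: gspec_2pi)
    finally show ?thesis by simp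
  qed
  define b where "b k = a ^ (2 ^ k)" for k :: nat
  have b: "b k > 1" for k unfolding b_def using assms by (simp add: one_less_power)
  have bS: "b (Suc k) = (b k)\<^sup>2" for k by (simp add: b_def power_mult[symmetric] mult.commute)
  have Lb: "L (b k) = 2 ^ k * L a" for k
    by (induction k) (simp_all add: bS dbl b, simp add: b_def)
  \<comment> \<open>From \<open>(b - 1)\<^sup>2 \<le> g \<le> (b + 1)\<^sup>2\<close> the integrand
    is within \<open>2 * ln (b / (b - 1))\<close> of \<open>2 * ln b\<close>, and this is largest at
    the smallest value \<open>b = a\<close>.\<close>
  have bd: "\<bar>L (b k) - 2 * pi * ln (b k)\<bar> \<le> pi * (2 * ln (a / (a - 1)))" for k
  proof -
    have k: "b k \<ge> a" unfolding b_def using assms self_le_power[of a "2 ^ k"] by simp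
    have ic: "(\<lambda>w. ln (gspec (b k) w)) integrable_on {0..pi}" by (intro integrable_continuous_interval cl b)
    have pt: "\<bar>ln (gspec (b k) w) - 2 * ln (b k)\<bar> \<le> 2 * ln (a / (a - 1))" for w
    proof -
      have g: "(b k - 1)\<^sup>2 \<le> gspec (b k) w" "gspec (b k) w \<le> (b k + 1)\<^sup>2" "0 < gspec (b k) w"
        using gspec_bounds[OF b] by auto
      have b1: "b k > 1" by (rule b)
      have "ln ((b k - 1)\<^sup>2) \<le> ln (gspec (b k) w)" using g b1 by (subst ln_le_cancel_iff) auto
      then have 1: "2 * ln (b k - 1) \<le> ln (gspec (b k) w)" using b1 by (simp add: ln_realpow)
      have "ln (gspec (b k) w) \<le> ln ((b k + 1)\<^sup>2)" using g b1 by (subst ln_le_cancel_iff) auto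
      then have 2: "ln (gspec (b k) w) \<le> 2 * ln (b k + 1)" using b1 by (simp add: ln_realpow)
      have "b k / (b k - 1) \<le> a / (a - 1)" using k assms b1 by (simp add: field_simps)
      then have "ln (b k / (b k - 1)) \<le> ln (a / (a - 1))" using assms b1 by (subst ln_le_cancel_iff) auto
      then have 3: "ln (b k) - ln (b k - 1) \<le> ln (a / (a - 1))" using b1 by (simp add: ln_div)
      have "(b k + 1) / b k \<le> b k / (b k - 1)" using b1 by (simp add: field_simps)
      then have "ln ((b k + 1) / b k) \<le> ln (b k / (b k - 1))" using b1 by (subst ln_le_cancel_iff) auto
      then have 4: "ln (b k + 1) - ln (b k) \<le> ln (b k) - ln (b k - 1)" using b1 by (simp add: ln_div)
      show ?thesis using 1 2 3 4 by (simp add: abs_le_iff)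
    qed
    have "integral {0..pi} (\<lambda>w. ln (gspec (b k) w) - 2 * ln (b k)) = L (b k) - 2 * pi * ln (b k)"
      unfolding L_def by (subst Henstock_Kurzweil_Integration.integral_diff[OF ic]) auto
    moreover have "\<bar>integral {0..pi} (\<lambda>w. ln (gspec (b k) w) - 2 * ln (b k))\<bar> \<le> (2 * ln (a / (a - 1))) * (pi - 0)"
    proof -
      have "continuous_on {0..pi} (\<lambda>w. ln (gspec (b k) w) - 2 * ln (b k))"
        by (intro continuous_on_diff continuous_on_const cl b)
      then show ?thesis
        using integral_bound[of 0 pi "\<lambda>w. ln (gspec (b k) w) - 2 * ln (b k)" "2 * ln (a / (a - 1))"] pt by simp
    qed
    ultimately show ?thesis by (simp add: mult.commute)
  qed
  have lnb: "ln (b k) = 2 ^ k * ln a" for k unfolding b_def using assms by (simp add: ln_realpow)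
  have small: "\<bar>L a - 2 * pi * ln a\<bar> \<le> pi * (2 * ln (a / (a - 1))) * (1/2) ^ k" for k
  proof -
    have "2 ^ k * \<bar>L a - 2 * pi * ln a\<bar> = \<bar>L (b k) - 2 * pi * ln (b k)\<bar>"
    proof -
      have "L (b k) - 2 * pi * ln (b k) = 2 ^ k * (L a - 2 * pi * ln a)"
        by (simp add: Lb lnb right_diff_distrib)
      then show ?thesis by (simp add: abs_mult)
    qed
    also have "\<dots> \<le> pi * (2 * ln (a / (a - 1)))" by (rule bd)
    finally show ?thesis by (simp add: field_simps power_one_over)
  qed
  have "(\<lambda>k. pi * (2 * ln (a / (a - 1))) * (1/2) ^ k) \<longlonglongrightarrow> pi * (2 * ln (a / (a - 1))) * 0"
    by (intro tendsto_mult tendsto_const LIMSEQ_realpow_zero) auto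
  then have "\<bar>L a - 2 * pi * ln a\<bar> \<le> 0"
    by (intro LIMSEQ_le_const[of _ 0]) (use small in \<open>auto\<close>)
  then show ?thesis by (simp add: L_def)
qed

text \<open>Doubling gives \<open>(b\<^sup>2 + 1) * P (b\<^sup>2) = P b\<close>, so
  \<open>(b\<^sup>2 - 1) * P b\<close> is invariant under squaring \<open>b\<close>, and it tends to
  \<open>pi\<close> as \<open>b\<close> grows. This identifies \<open>sig2 / (a\<^sup>2 - 1)\<close>
  as the mean of the spectrum, the largest distortion that a water level can produce.\<close>

lemma integral_inverse_gspec:
  assumes "a > 1"
  shows "integral {0..pi} (\<lambda>w. 1 / gspec a w) = pi / (a\<^sup>2 - 1)"
proof -
  define P where "P b = integral {0..pi} (\<lambda>w. 1 / gspec b w)" for b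
  have cl: "continuous_on A (\<lambda>w. 1 / gspec b w)" if "b > 1" for A b
    using gspec_bounds(3)[OF that] by (intro continuous_intros) (auto simp: less_imp_neq[symmetric])
  have dbl: "(b\<^sup>2 + 1) * P (b\<^sup>2) = P b" if b: "b > 1" for b
  proof -
    have b2: "b\<^sup>2 > 1" using b by simp
    have il: "(\<lambda>w. 1 / gspec b w) integrable_on {0..pi}" by (intro integrable_continuous_interval cl b)
    have il': "(\<lambda>w. 1 / gspec b (pi - w)) integrable_on {0..pi}"
      using gspec_bounds(3)[OF b]
      by (intro integrable_continuous_interval continuous_on_divide continuous_on_compose2[OF continuous_on_gspec]) (auto intro!: continuous_intros simp: less_imp_neq[symmetric])
    have "2 * P b = integral {0..pi} (\<lambda>w. 1 / gspec b w) + integral {0..pi} (\<lambda>w. 1 / gspec b (pi - w))"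
      using integral_reflect_0_pi[of "\<lambda>w. 1 / gspec b w"] by (simp add: P_def)
    also have "\<dots> = integral {0..pi} (\<lambda>w. 1 / gspec b w + 1 / gspec b (pi - w))"
      by (rule Henstock_Kurzweil_Integration.integral_add[symmetric]) fact+
    also have "\<dots> = integral {0..pi} (\<lambda>w. 2 * (1 + b\<^sup>2) * (1 / gspec (b\<^sup>2) (2 * w)))"
    proof (rule Henstock_Kurzweil_Integration.integral_cong)
      fix w
      have "gspec b w > 0" "gspec b (pi - w) > 0" using gspec_bounds(3)[OF b] by auto
      then have "1 / gspec b w + 1 / gspec b (pi - w) = (gspec b w + gspec b (pi - w)) / (gspec b w * gspec b (pi - w))"
        by (simp add: field_simps)
      then show "1 / gspec b w + 1 / gspec b (pi - w) = 2 * (1 + b\<^sup>2) * (1 / gspec (b\<^sup>2) (2 * w))"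
        unfolding gspec_doubling gspec_pi_sum by simp
    qed
    also have "\<dots> = 2 * (1 + b\<^sup>2) * integral {0..pi} (\<lambda>w. 1 / gspec (b\<^sup>2) (2 * w))" by (rule integral_mult_right)
    also have "integral {0..pi} (\<lambda>w. 1 / gspec (b\<^sup>2) (2 * w)) = P (b\<^sup>2)"
      unfolding P_def by (rule integral_double_angle) (auto intro!: cl b2 simp: gspec_2pi)
    finally show ?thesis by (simp add: algebra_simps)
  qed
  define b where "b k = a ^ (2 ^ k)" for k :: nat
  have b: "b k > 1" for k unfolding b_def using assms by (simp add: one_less_power)
  have bS: "b (Suc k) = (b k)\<^sup>2" for k by (simp add: b_def power_mult[symmetric] mult.commute)
  have Pb: "((b k)\<^sup>2 - 1) * P (b k) = (a\<^sup>2 - 1) * P a" for k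
  proof (induction k)
    case 0 then show ?case by (simp add: b_def)
  next
    case (Suc k)
    have "((b (Suc k))\<^sup>2 - 1) * P (b (Suc k)) = ((b k)\<^sup>2 - 1) * (((b k)\<^sup>2 + 1) * P ((b k)\<^sup>2))"
      by (simp add: bS power2_eq_square algebra_simps)
    then show ?case using Suc dbl[OF b] by simp
  qed
  have "((b k)\<^sup>2 - 1) * P (b k) \<in> {pi * ((b k - 1) / (b k + 1)) .. pi * ((b k + 1) / (b k - 1))}" for k
  proof -
    have b1: "b k > 1" by (rule b)
    have ic: "(\<lambda>w. 1 / gspec (b k) w) integrable_on {0..pi}" by (intro integrable_continuous_interval cl b)
    have i1: "(\<lambda>w. 1 / (b k + 1)\<^sup>2) integrable_on {0..pi}" "(\<lambda>w. 1 / (b k - 1)\<^sup>2) integrable_on {0..pi}" by auto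
    have "integral {0..pi} (\<lambda>w. 1 / (b k + 1)\<^sup>2) \<le> P (b k)" unfolding P_def
      by (intro integral_le i1 ic divide_left_mono gspec_bounds(2)[OF b]) (use gspec_bounds(3)[OF b] b1 in auto)
    then have 1: "pi / (b k + 1)\<^sup>2 \<le> P (b k)" by simp
    have "P (b k) \<le> integral {0..pi} (\<lambda>w. 1 / (b k - 1)\<^sup>2)" unfolding P_def
      by (intro integral_le i1 ic divide_left_mono gspec_bounds(1)[OF b]) (use gspec_bounds(3)[OF b] b1 in auto)
    then have 2: "P (b k) \<le> pi / (b k - 1)\<^sup>2" by simp
    have e: "(b k)\<^sup>2 - 1 = (b k - 1) * (b k + 1)" by (simp add: power2_eq_square algebra_simps)
    have pos: "0 \<le> (b k)\<^sup>2 - 1" using b1 by simp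
    have "((b k)\<^sup>2 - 1) * (pi / (b k + 1)\<^sup>2) = pi * ((b k - 1) / (b k + 1))"
      unfolding e using b1 by (simp add: power2_eq_square divide_simps)
    moreover have "((b k)\<^sup>2 - 1) * (pi / (b k - 1)\<^sup>2) = pi * ((b k + 1) / (b k - 1))"
      unfolding e using b1 by (simp add: power2_eq_square divide_simps)
    ultimately show ?thesis using mult_left_mono[OF 1 pos] mult_left_mono[OF 2 pos] by auto
  qed
  then have sandwich: "pi * ((b k - 1) / (b k + 1)) \<le> (a\<^sup>2 - 1) * P a" "(a\<^sup>2 - 1) * P a \<le> pi * ((b k + 1) / (b k - 1))" for k
    unfolding Pb by auto
  have binf: "filterlim b at_top sequentially"
  proof (rule filterlim_at_top_mono)
    show "filterlim (\<lambda>k. a ^ k) at_top sequentially" using assms by real_asymp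
    show "\<forall>\<^sub>F k in sequentially. a ^ k \<le> b k"
      unfolding b_def using assms by (intro always_eventually allI power_increasing) (auto intro: less_imp_le[OF less_exp])
  qed
  have "((\<lambda>x::real. pi * ((x - 1) / (x + 1))) \<longlongrightarrow> pi) at_top" "((\<lambda>x::real. pi * ((x + 1) / (x - 1))) \<longlongrightarrow> pi) at_top"
    by real_asymp+
  from filterlim_compose[OF this(1) binf] filterlim_compose[OF this(2) binf]
  have "pi \<le> (a\<^sup>2 - 1) * P a" "(a\<^sup>2 - 1) * P a \<le> pi"
    using sandwich by (auto intro: LIMSEQ_le_const LIMSEQ_le_const2)
  then have "(a\<^sup>2 - 1) * P a = pi" by simp
  moreover have "a\<^sup>2 - 1 > 0" using assms by simp
  ultimately show ?thesis by (simp add: P_def field_simps)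
qed

lemma LBINT_even:
  fixes f :: "real \<Rightarrow> real"
  assumes f: "continuous_on UNIV f" and even: "\<And>w. f (- w) = f w"
  shows "(LBINT w=-pi..pi. f w) = 2 * integral {0..pi} f"
proof -
  have cf: "continuous_on A f" for A using f continuous_on_subset by blast
  have "(LBINT w=ereal (-pi)..ereal pi. f w) = integral {-pi..pi} f"
    by (rule interval_integral_eq_integral) (auto intro!: borel_integrable_atLeastAtMost' cf)
  also have "\<dots> = integral {-pi..0} f + integral {0..pi} f"
    by (rule Henstock_Kurzweil_Integration.integral_combine[symmetric]) (auto intro!: integrable_continuous_interval cf)
  also have "integral {-pi..0} f = integral {0..pi} f"
    using Henstock_Kurzweil_Integration.integral_reflect_real[where f=f and a=0 and b=pi] by (simp add: even)
  finally show ?thesis by simp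
qed

section \<open>Riemann sums at the sine frequencies\<close>

lemma freq_0 [simp]: "freq n 0 = 0"
  by (simp add: freq_def)

lemma freq_self: "n > 0 \<Longrightarrow> freq n n = pi"
  by (simp add: freq_def)

lemma freq_Suc: "freq n (Suc k) = freq n k + pi / real n"
  by (simp add: freq_def add_divide_distrib distrib_right)

text \<open>The right-endpoint rule on \<open>n\<close> cells of length \<open>h = pi / n\<close>
  errs by at most \<open>K * h * h\<close> per cell, in total \<open>K * pi\<close> after division
  by \<open>h\<close>. The term \<open>\<bar>f pi\<bar>\<close> pays for the endpoint
  \<open>k = n\<close>, which is not a sine frequency.\<close>

lemma Riemann_sum_error:
  fixes f :: "real \<Rightarrow> real"
  assumes lip: "\<And>x y. \<bar>f x - f y\<bar> \<le> K * \<bar>x - y\<bar>" and n: "n > 0"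
  shows "\<bar>(\<Sum>k\<in>{1..<n}. f (freq n k)) - real n / pi * integral {0..pi} f\<bar> \<le> K * pi + \<bar>f pi\<bar>"
proof -
  have K: "0 \<le> K" using lip[of 1 0] by simp
  have "K-lipschitz_on UNIV f"
    using lip K by (intro lipschitz_onI) (auto simp: dist_real_def)
  then have "continuous_on UNIV f" by (rule lipschitz_on_continuous_on)
  then have cf: "continuous_on A f" for A using continuous_on_subset by blast
  define h where "h = pi / real n"
  have h: "h > 0" using n by (simp add: h_def)
  let ?x = "freq n"
  have "integral {0..?x m} f = (\<Sum>k<m. integral {?x k..?x (Suc k)} f)" for m
  proof (induction m)
    case (Suc m)
    have "integral {0..?x (Suc m)} f = integral {0..?x m} f + integral {?x m..?x (Suc m)} f"
      by (rule Henstock_Kurzweil_Integration.integral_combine[symmetric])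
         (auto intro!: integrable_continuous_interval cf simp: freq_def divide_right_mono)
    then show ?case using Suc by simp
  qed simp
  from this[of n] have I: "integral {0..pi} f = (\<Sum>k<n. integral {?x k..?x (Suc k)} f)"
    using n by (simp add: freq_self)
  have each: "\<bar>h * f (?x (Suc k)) - integral {?x k..?x (Suc k)} f\<bar> \<le> K * h * h" for k
  proof -
    have w: "?x (Suc k) - ?x k = h" "?x k \<le> ?x (Suc k)" using h by (auto simp: freq_Suc h_def)
    have "norm (integral {?x k..?x (Suc k)} (\<lambda>w. f (?x (Suc k)) - f w)) \<le> K * h * (?x (Suc k) - ?x k)"
    proof (rule integral_bound)
      fix t assume t: "t \<in> {?x k..?x (Suc k)}"
      have "\<bar>f (?x (Suc k)) - f t\<bar> \<le> K * \<bar>?x (Suc k) - t\<bar>" by (rule lip)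
      also have "\<dots> \<le> K * h" using t w K by (intro mult_left_mono) auto
      finally show "norm (f (?x (Suc k)) - f t) \<le> K * h" by simp
    qed (use w in \<open>auto intro!: continuous_on_diff continuous_on_const cf\<close>)
    moreover have "integral {?x k..?x (Suc k)} (\<lambda>w. f (?x (Suc k)) - f w) = h * f (?x (Suc k)) - integral {?x k..?x (Suc k)} f"
      using w by (subst Henstock_Kurzweil_Integration.integral_diff) (auto intro!: integrable_continuous_interval cf)
    ultimately show ?thesis using w by simp
  qed
  have "\<bar>h * (\<Sum>k<n. f (?x (Suc k))) - integral {0..pi} f\<bar> = \<bar>\<Sum>k<n. h * f (?x (Suc k)) - integral {?x k..?x (Suc k)} f\<bar>"
    unfolding I by (simp add: sum_subtractf sum_distrib_left)
  also have "\<dots> \<le> (\<Sum>k<n. \<bar>h * f (?x (Suc k)) - integral {?x k..?x (Suc k)} f\<bar>)" by (rule sum_abs)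
  also have "\<dots> \<le> (\<Sum>k<n. K * h * h)" by (rule sum_mono) (rule each)
  also have "\<dots> = K * pi * h" using n by (simp add: h_def)
  finally have E: "\<bar>h * (\<Sum>k<n. f (?x (Suc k))) - integral {0..pi} f\<bar> \<le> K * pi * h" .
  have "(\<Sum>k<n. f (?x (Suc k))) = (\<Sum>k\<in>{1..<Suc n}. f (?x k))"
    by (rule sum.reindex_bij_witness[of _ "\<lambda>k. k - 1" Suc]) auto
  also have "\<dots> = (\<Sum>k\<in>{1..<n}. f (?x k)) + f pi"
    using n by (simp add: freq_self)
  finally have S: "(\<Sum>k<n. f (?x (Suc k))) = (\<Sum>k\<in>{1..<n}. f (?x k)) + f pi" .
  have "\<bar>(\<Sum>k<n. f (?x (Suc k))) - real n / pi * integral {0..pi} f\<bar> = \<bar>h * (\<Sum>k<n. f (?x (Suc k))) - integral {0..pi} f\<bar> / h"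
  proof -
    have "(\<Sum>k<n. f (?x (Suc k))) - real n / pi * integral {0..pi} f = (h * (\<Sum>k<n. f (?x (Suc k))) - integral {0..pi} f) / h"
      using n by (simp add: h_def field_simps)
    then show ?thesis using h by simp
  qed
  also have "\<dots> \<le> K * pi" using E h by (simp add: field_simps)
  finally show ?thesis using S by linarith
qed

text \<open>The spectral density; at \<open>w = freq n k\<close> it is the variance of the random
  part of the \<open>k\<close>-th sine coefficient once the end point is accounted for.\<close>

definition svar :: "real \<Rightarrow> real \<Rightarrow> real \<Rightarrow> real" where
  "svar a sig2 w = sig2 / gspec a w"

lemma svar_bounds:
  assumes "a > 1" "sig2 > 0"
  shows "sig2 / (a + 1)\<^sup>2 \<le> svar a sig2 w" "svar a sig2 w \<le> sig2 / (a - 1)\<^sup>2" "0 < svar a sig2 w"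
  using gspec_bounds[OF assms(1), of w] assms by (auto simp: svar_def intro!: divide_left_mono)

lemma gspec_lipschitz:
  assumes "a > 1"
  shows "\<bar>gspec a x - gspec a y\<bar> \<le> 2 * a * \<bar>x - y\<bar>"
proof -
  have "\<bar>cos x - cos y\<bar> \<le> \<bar>x - y\<bar>"
  proof -
    have "1-lipschitz_on UNIV (cos :: real \<Rightarrow> real)"
      by (rule bounded_derivative_imp_lipschitz[where f'="\<lambda>x h. - sin x * h"])
         (auto intro!: derivative_eq_intros onorm_le simp: abs_mult mult_left_le_one_le)
    from lipschitz_onD[OF this] show ?thesis by (simp add: dist_real_def)
  qed
  moreover have "gspec a x - gspec a y = 2 * a * (cos y - cos x)" by (simp add: gspec_def algebra_simps)
  ultimately show ?thesis using assms by (simp add: abs_mult abs_minus_commute)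
qed

lemma svar_lipschitz:
  assumes "a > 1" "sig2 > 0"
  shows "\<bar>svar a sig2 x - svar a sig2 y\<bar> \<le> (sig2 * (2 * a) / (a - 1) ^ 4) * \<bar>x - y\<bar>"
proof -
  have g: "(a - 1)\<^sup>2 \<le> gspec a x" "(a - 1)\<^sup>2 \<le> gspec a y" "gspec a x > 0" "gspec a y > 0" and p: "(a - 1)\<^sup>2 > 0"
    using gspec_bounds[OF assms(1)] assms by auto
  have "svar a sig2 x - svar a sig2 y = sig2 * (gspec a y - gspec a x) / (gspec a x * gspec a y)"
    using g by (simp add: svar_def field_simps)
  then have "\<bar>svar a sig2 x - svar a sig2 y\<bar> = sig2 * \<bar>gspec a y - gspec a x\<bar> / (gspec a x * gspec a y)"
    using g assms by (simp add: abs_mult)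
  also have "\<dots> \<le> sig2 * (2 * a * \<bar>x - y\<bar>) / ((a - 1)\<^sup>2 * (a - 1)\<^sup>2)"
    using gspec_lipschitz[OF assms(1), of y x] g(1,2) p assms less_imp_le[OF g(3)]
    by (intro frac_le mult_left_mono mult_mono) (auto simp: abs_minus_commute)
  also have "\<dots> = (sig2 * (2 * a) / (a - 1) ^ 4) * \<bar>x - y\<bar>"
    by (simp add: power4_eq_xxxx power2_eq_square mult.assoc)
  finally show ?thesis .
qed

lemma svar_minus [simp]: "svar a sig2 (- w) = svar a sig2 w"
  by (simp add: svar_def)

lemma continuous_on_svar [continuous_intros]:
  assumes "a > 1" shows "continuous_on A (svar a sig2)"
  unfolding svar_def using gspec_bounds(3)[OF assms] by (intro continuous_intros) (auto simp: less_imp_neq[symmetric])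

lemma svar_0: "svar a sig2 0 = sig2 / (a - 1)\<^sup>2"
  by (simp add: svar_def gspec_def power2_eq_square algebra_simps)

lemma integral_svar:
  assumes "a > 1"
  shows "integral {0..pi} (svar a sig2) = pi * (sig2 / (a\<^sup>2 - 1))"
proof -
  have "integral {0..pi} (svar a sig2) = integral {0..pi} (\<lambda>w. sig2 * (1 / gspec a w))"
    by (simp add: svar_def[abs_def])
  also have "\<dots> = sig2 * integral {0..pi} (\<lambda>w. 1 / gspec a w)" by (rule integral_mult_right)
  finally show ?thesis using integral_inverse_gspec[OF assms] by simp
qed

text \<open>The water volume \<open>W\<close> is continuous, starts at 0 and is constant once the
  level exceeds the peak \<open>sig2 / (a - 1)\<^sup>2\<close>. Since \<open>pi * d\<close> lies
  strictly below this plateau, a level exists, is below the peak, and is unique by strict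
  monotonicity there.\<close>

lemma water_level_props:
  assumes a: "a > 1" and s: "sig2 > 0" and d: "0 < d" "d < sig2 / (a\<^sup>2 - 1)"
  shows "water_level a sig2 d > 0" "integral {0..pi} (\<lambda>w. min (water_level a sig2 d) (svar a sig2 w)) = pi * d"
    "water_level a sig2 d < sig2 / (a - 1)\<^sup>2"
proof -
  define W where "W th = integral {0..pi} (\<lambda>w. min th (svar a sig2 w))" for th
  have cm: "continuous_on A (\<lambda>w. min th (svar a sig2 w))" for A th
    by (intro continuous_intros a)
  have im: "(\<lambda>w. min th (svar a sig2 w)) integrable_on {0..pi}" for th
    by (intro integrable_continuous_interval cm)
  have LB: "(LBINT w=-pi..pi. min th (sig2 / gspec a w)) = 2 * W th" for th
    unfolding W_def svar_def[symmetric] by (rule LBINT_even) (auto intro: cm)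
  have W_large: "W th = pi * (sig2 / (a\<^sup>2 - 1))" if "th \<ge> sig2 / (a - 1)\<^sup>2" for th
  proof -
    have "min th (svar a sig2 w) = svar a sig2 w" for w using that svar_bounds(2)[OF a s, of w] by simp
    then show ?thesis unfolding W_def using integral_svar[OF a, of sig2] by simp
  qed
  have lipW: "\<bar>W x - W y\<bar> \<le> pi * \<bar>x - y\<bar>" for x y
  proof -
    have "W x - W y = integral {0..pi} (\<lambda>w. min x (svar a sig2 w) - min y (svar a sig2 w))"
      unfolding W_def by (rule Henstock_Kurzweil_Integration.integral_diff[symmetric]) (rule im)+
    moreover have "norm (integral {0..pi} (\<lambda>w. min x (svar a sig2 w) - min y (svar a sig2 w))) \<le> \<bar>x - y\<bar> * (pi - 0)"
      by (rule integral_bound) (auto intro!: continuous_on_diff cm)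
    ultimately show ?thesis by (simp add: mult.commute)
  qed
  then have "pi-lipschitz_on UNIV W" by (intro lipschitz_onI) (auto simp: dist_real_def)
  then have "continuous_on UNIV W" by (rule lipschitz_on_continuous_on)
  then have contW: "continuous_on A W" for A using continuous_on_subset by blast
  let ?m = "sig2 / (a - 1)\<^sup>2"
  have m: "?m > 0" using a s by simp
  have pd: "pi * d < pi * (sig2 / (a\<^sup>2 - 1))" using d by (intro mult_strict_left_mono) auto
  have Wm: "W ?m > pi * d" using W_large[of ?m] pd by simp
  have W0: "W 0 = 0"
  proof -
    have "min 0 (svar a sig2 w) = 0" for w using svar_bounds(3)[OF a s, of w] by simp
    then show ?thesis by (simp add: W_def)
  qed
  have "\<exists>th\<ge>0. th \<le> ?m \<and> W th = pi * d"
    by (rule IVT') (use W0 Wm d m contW in auto)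
  then obtain th where th: "0 \<le> th" "th \<le> ?m" "W th = pi * d" by auto
  have lt: "x < ?m" if "W x = pi * d" for x using W_large[of x] that pd by (cases "x < ?m") simp_all
  have pos: "0 < th" using th W0 d by (cases "th = 0") auto
  \<comment> \<open>Equal volumes would force the two truncated spectra to agree everywhere, but at
    the peak \<open>w = 0\<close> they differ as soon as the lower level is below the peak.\<close>
  have mono: "W x \<noteq> W y" if "0 < x" "x < y" "x < ?m" for x y
  proof
    assume eq: "W x = W y"
    have "integral {0..pi} (\<lambda>w. min y (svar a sig2 w) - min x (svar a sig2 w)) = 0"
      using eq unfolding W_def by (subst Henstock_Kurzweil_Integration.integral_diff[OF im im]) simp
    moreover have "continuous_on {0..pi} (\<lambda>w. min y (svar a sig2 w) - min x (svar a sig2 w))"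
      by (intro continuous_on_diff cm)
    ultimately have "\<forall>w\<in>{0..pi}. min y (svar a sig2 w) - min x (svar a sig2 w) = 0"
      using that by (subst (asm) integral_eq_0_iff) auto
    then have "min y (svar a sig2 0) - min x (svar a sig2 0) = 0" by (rule bspec) simp
    then show False using that by (simp add: svar_0 min_def split: if_splits)
  qed
  have WL: "water_level a sig2 d = th"
    unfolding water_level_def LB
  proof (rule the_equality)
    show "0 < th \<and> d = 1 / (2 * pi) * (2 * W th)" using pos th by simp
    fix x assume "0 < x \<and> d = 1 / (2 * pi) * (2 * W x)"
    then have x: "0 < x" "W x = pi * d" by (auto simp: field_simps)
    then show "x = th" using mono[of x th] mono[of th x] lt[of x] lt[of th] pos th
      by (cases x th rule: linorder_cases) auto
  qed
  show "water_level a sig2 d > 0" "integral {0..pi} (\<lambda>w. min (water_level a sig2 d) (svar a sig2 w)) = pi * d"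
    "water_level a sig2 d < ?m"
    using pos th lt[of th] by (auto simp: WL W_def)
qed

text \<open>Jensen's formula for the spectrum splits \<open>RU\<close> into the rate \<open>ln a\<close> needed for the
  final state plus the rate of the stationary residual.\<close>

lemma RU_eq:
  assumes a: "a > 1" and s: "sig2 > 0" and th: "water_level a sig2 d > 0"
  shows "RU a sig2 d = ln a + 1 / pi * integral {0..pi} (\<lambda>w. 1/2 * ln (max 1 (svar a sig2 w / water_level a sig2 d)))"
proof -
  let ?th = "water_level a sig2 d"
  have g: "gspec a w > 0" for w by (rule gspec_bounds(3)[OF a])
  have c1: "continuous_on A (\<lambda>w. ln (gspec a w))" for A
    using g by (intro continuous_intros) (auto simp: less_imp_neq[symmetric])
  have c2: "continuous_on A (\<lambda>w. 1/2 * ln (max 1 (svar a sig2 w / ?th)))" for A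
    using th by (intro continuous_intros a) (auto simp: max_def)
  have e: "1/2 * ln (max (gspec a w) (sig2 / ?th)) = 1/2 * ln (gspec a w) + 1/2 * ln (max 1 (svar a sig2 w / ?th))" for w
  proof -
    have "max (gspec a w) (sig2 / ?th) = gspec a w * max 1 (svar a sig2 w / ?th)"
      using g[of w] th by (simp add: svar_def max_def field_simps)
    moreover have "0 < max 1 (svar a sig2 w / ?th)" by simp
    ultimately show ?thesis using g[of w] by (simp only: ln_mult_pos distrib_left)
  qed
  have "(LBINT w=-pi..pi. 1/2 * ln (max (gspec a w) (sig2 / ?th)))
     = 2 * integral {0..pi} (\<lambda>w. 1/2 * ln (max (gspec a w) (sig2 / ?th)))"
  proof (rule LBINT_even)
    show "continuous_on UNIV (\<lambda>w. 1/2 * ln (max (gspec a w) (sig2 / ?th)))"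
      unfolding e by (intro continuous_on_add continuous_on_mult continuous_on_const c1 c2)
  qed simp
  also have "integral {0..pi} (\<lambda>w. 1/2 * ln (max (gspec a w) (sig2 / ?th)))
    = integral {0..pi} (\<lambda>w. 1/2 * ln (gspec a w)) + integral {0..pi} (\<lambda>w. 1/2 * ln (max 1 (svar a sig2 w / ?th)))"
    unfolding e
    by (rule Henstock_Kurzweil_Integration.integral_add)
       (intro integrable_continuous_interval c2 continuous_on_mult continuous_on_const c1)+
  also have "integral {0..pi} (\<lambda>w. 1/2 * ln (gspec a w)) = 1/2 * integral {0..pi} (\<lambda>w. ln (gspec a w))"
    by (rule integral_mult_right)
  finally show ?thesis unfolding RU_def integral_ln_gspec[OF a] by (simp add: field_simps)
qed

lemma VU_eq:
  assumes a: "a > 1" and s: "sig2 > 0" and th: "water_level a sig2 d > 0"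
  shows "VU a sig2 d = 1 / pi * integral {0..pi} (\<lambda>w. 1/2 * (min 1 (svar a sig2 w / water_level a sig2 d))\<^sup>2)"
proof -
  let ?th = "water_level a sig2 d"
  have e: "min 1 ((sig2 / (?th * gspec a w))\<^sup>2) = (min 1 (svar a sig2 w / ?th))\<^sup>2" for w
  proof -
    define x where "x = svar a sig2 w / ?th"
    have x: "x > 0" using svar_bounds(3)[OF a s, of w] th by (simp add: x_def)
    have "sig2 / (?th * gspec a w) = x" by (simp add: x_def svar_def mult.commute)
    then show ?thesis using x unfolding x_def[symmetric]
      by (simp add: min_def power2_le_iff_abs_le abs_square_le_1 not_le) (smt (verit) one_le_power power_le_one)
  qed
  have c: "continuous_on A (\<lambda>w. (min 1 (svar a sig2 w / ?th))\<^sup>2)" for A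
    using th by (intro continuous_intros a) auto
  have "(LBINT w=-pi..pi. min 1 ((sig2 / (?th * gspec a w))\<^sup>2)) = 2 * integral {0..pi} (\<lambda>w. (min 1 (svar a sig2 w / ?th))\<^sup>2)"
    unfolding e by (rule LBINT_even) (auto intro: c)
  moreover have "integral {0..pi} (\<lambda>w. 1/2 * (min 1 (svar a sig2 w / ?th))\<^sup>2) = 1/2 * integral {0..pi} (\<lambda>w. (min 1 (svar a sig2 w / ?th))\<^sup>2)"
    by (rule integral_mult_right)
  ultimately show ?thesis unfolding VU_def by simp
qed

lemma ln_max_lipschitz:
  fixes x y :: real
  shows "\<bar>ln (max 1 x) - ln (max 1 y)\<bar> \<le> \<bar>x - y\<bar>"
proof -
  have *: "ln (max 1 x) - ln (max 1 y) \<le> \<bar>x - y\<bar>" for x y :: real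
  proof -
    have "ln (max 1 x) - ln (max 1 y) = ln (max 1 x / max 1 y)" using ln_div[of "max 1 x" "max 1 y"] by (simp add: max_def)
    also have "\<dots> \<le> max 1 x / max 1 y - 1" by (rule ln_le_minus_one) simp
    also have "\<dots> = (max 1 x - max 1 y) / max 1 y" by (simp add: diff_divide_distrib max_def)
    also have "\<dots> \<le> \<bar>max 1 x - max 1 y\<bar> / 1" by (rule frac_le) auto
    also have "\<dots> \<le> \<bar>x - y\<bar>" by auto
    finally show ?thesis .
  qed
  show ?thesis using *[of x y] *[of y x] by (simp add: abs_le_iff abs_minus_commute)
qed

lemma square_lipschitz_unit:
  fixes x y :: real
  assumes "0 \<le> x" "x \<le> 1" "0 \<le> y" "y \<le> 1"
  shows "\<bar>x\<^sup>2 - y\<^sup>2\<bar> \<le> 2 * \<bar>x - y\<bar>"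
proof -
  have "\<bar>x\<^sup>2 - y\<^sup>2\<bar> = \<bar>x + y\<bar> * \<bar>x - y\<bar>" by (simp add: abs_mult[symmetric] power2_eq_square algebra_simps)
  also have "\<dots> \<le> 2 * \<bar>x - y\<bar>" using assms by (intro mult_right_mono) auto
  finally show ?thesis .
qed

text \<open>Truncation at the water level makes all four integrands Lipschitz in \<open>w\<close>,
  so the sums are known up to a constant, which is \<open>O(1 / n)\<close> in the rate. The positive
  \<open>\<kappa>\<close> guarantees that the variance of the distance under the conditional
  codeword law grows linearly in \<open>n\<close>.\<close>

lemma spectral_sums:
  assumes a: "a > 1" and s: "sig2 > 0" and d: "0 < d" "d < sig2 / (a\<^sup>2 - 1)"
  defines "th \<equiv> water_level a sig2 d"
  obtains C \<kappa> where "\<kappa> > 0" "C > 0"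
    "\<And>n. n > 0 \<Longrightarrow> \<bar>(\<Sum>k\<in>{1..<n}. min th (svar a sig2 (freq n k))) - real n * d\<bar> \<le> C"
    "\<And>n. n > 0 \<Longrightarrow> \<bar>(\<Sum>k\<in>{1..<n}. 1/2 * ln (max 1 (svar a sig2 (freq n k) / th))) - real n * (RU a sig2 d - ln a)\<bar> \<le> C"
    "\<And>n. n > 0 \<Longrightarrow> \<bar>(\<Sum>k\<in>{1..<n}. 1/2 * (min 1 (svar a sig2 (freq n k) / th))\<^sup>2) - real n * VU a sig2 d\<bar> \<le> C"
    "\<And>n. n > 0 \<Longrightarrow> \<bar>(\<Sum>k\<in>{1..<n}. (max 0 (1 - th / svar a sig2 (freq n k)))\<^sup>2) - real n * \<kappa>\<bar> \<le> C"
proof -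
  note wl = water_level_props[OF a s d, folded th_def]
  let ?s = "svar a sig2"
  define K where "K = sig2 * (2 * a) / (a - 1) ^ 4"
  have K: "\<bar>?s x - ?s y\<bar> \<le> K * \<bar>x - y\<bar>" for x y unfolding K_def by (rule svar_lipschitz[OF a s])
  have Kth: "\<bar>?s x / th - ?s y / th\<bar> \<le> K / th * \<bar>x - y\<bar>" for x y
    using K[of x y] wl(1) by (simp add: diff_divide_distrib[symmetric] divide_right_mono)
  define f1 where "f1 w = min th (?s w)" for w
  define f2 where "f2 w = 1/2 * ln (max 1 (?s w / th))" for w
  define f3 where "f3 w = 1/2 * (min 1 (?s w / th))\<^sup>2" for w
  define f4 where "f4 w = (max 0 (1 - th / ?s w))\<^sup>2" for w
  have l1: "\<bar>f1 x - f1 y\<bar> \<le> K * \<bar>x - y\<bar>" for x y using K[of x y] unfolding f1_def by linarith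
  have l2: "\<bar>f2 x - f2 y\<bar> \<le> K / th * \<bar>x - y\<bar>" for x y
    using ln_max_lipschitz[of "?s x / th" "?s y / th"] Kth[of x y] unfolding f2_def by linarith
  have l3: "\<bar>f3 x - f3 y\<bar> \<le> K / th * \<bar>x - y\<bar>" for x y
  proof -
    have p: "0 \<le> ?s w / th" for w using svar_bounds(3)[OF a s, of w] wl(1) by simp
    have "\<bar>(min 1 (?s x / th))\<^sup>2 - (min 1 (?s y / th))\<^sup>2\<bar> \<le> 2 * \<bar>min 1 (?s x / th) - min 1 (?s y / th)\<bar>"
      by (rule square_lipschitz_unit) (use p[of x] p[of y] in auto)
    moreover have "\<bar>min 1 (?s x / th) - min 1 (?s y / th)\<bar> \<le> \<bar>?s x / th - ?s y / th\<bar>" by linarith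
    ultimately have "\<bar>(min 1 (?s x / th))\<^sup>2 - (min 1 (?s y / th))\<^sup>2\<bar> \<le> 2 * (K / th * \<bar>x - y\<bar>)"
      using Kth[of x y] by linarith
    then show ?thesis unfolding f3_def by (simp add: abs_if split: if_splits)
  qed
  have l4: "\<bar>f4 x - f4 y\<bar> \<le> (4 * a * th / sig2) * \<bar>x - y\<bar>" for x y
  proof -
    have e: "th / ?s w = th / sig2 * gspec a w" for w by (simp add: svar_def)
    have p: "0 < th / ?s w" for w using svar_bounds(3)[OF a s, of w] wl(1) by simp
    have "\<bar>f4 x - f4 y\<bar> \<le> 2 * \<bar>max 0 (1 - th / ?s x) - max 0 (1 - th / ?s y)\<bar>"
      unfolding f4_def by (rule square_lipschitz_unit) (use p[of x] p[of y] in auto)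
    also have "\<dots> \<le> 2 * \<bar>th / ?s x - th / ?s y\<bar>"
    proof -
      have "\<bar>max 0 (1 - u) - max 0 (1 - v)\<bar> \<le> \<bar>u - v\<bar>" for u v :: real by linarith
      then show ?thesis by simp
    qed
    also have "\<dots> = 2 * (th / sig2) * \<bar>gspec a x - gspec a y\<bar>"
    proof -
      have "\<bar>th / sig2 * gspec a x - th / sig2 * gspec a y\<bar> = th / sig2 * \<bar>gspec a x - gspec a y\<bar>"
        unfolding right_diff_distrib[symmetric] abs_mult using wl(1) s by simp
      then show ?thesis unfolding e by simp
    qed
    also have "\<dots> \<le> 2 * (th / sig2) * (2 * a * \<bar>x - y\<bar>)"
      using wl(1) s by (intro mult_left_mono gspec_lipschitz[OF a]) auto
    finally show ?thesis by (simp add: mult_ac)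
  qed
  have c4: "continuous_on {0..pi} f4"
  proof -
    have "(4 * a * th / sig2)-lipschitz_on UNIV f4"
      using l4 a s wl(1) by (intro lipschitz_onI) (auto simp: dist_real_def)
    then have "continuous_on UNIV f4" by (rule lipschitz_on_continuous_on)
    then show ?thesis using continuous_on_subset by blast
  qed
  define \<kappa> where "\<kappa> = 1 / pi * integral {0..pi} f4"
  \<comment> \<open>The water level is strictly below the spectrum at \<open>w = 0\<close>, so the
    continuous nonnegative \<open>f4\<close> is positive there.\<close>
  have "integral {0..pi} f4 \<noteq> 0"
  proof
    assume "integral {0..pi} f4 = 0"
    then have "\<forall>w\<in>{0..pi}. f4 w = 0"
      using c4 by (subst (asm) integral_eq_0_iff) (auto simp: f4_def)
    then have "f4 0 = 0" by (rule bspec) simp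
    then show False using wl a s by (simp add: f4_def svar_0 max_def field_simps split: if_splits)
  qed
  moreover have "integral {0..pi} f4 \<ge> 0"
    by (rule Henstock_Kurzweil_Integration.integral_nonneg) (auto intro!: integrable_continuous_interval c4 simp: f4_def)
  ultimately have \<kappa>: "\<kappa> > 0" by (simp add: \<kappa>_def)
  define C where "C = 1 + (K * pi + \<bar>f1 pi\<bar>) + (K / th * pi + \<bar>f2 pi\<bar>) + (K / th * pi + \<bar>f3 pi\<bar>) + (4 * a * th / sig2 * pi + \<bar>f4 pi\<bar>)"
  have K0: "0 \<le> K" using a s by (simp add: K_def)
  have nn: "0 \<le> K * pi" "0 \<le> K / th * pi" "0 \<le> 4 * a * th / sig2 * pi"
    using K0 a s wl(1) by simp_all
  have i1: "real n / pi * integral {0..pi} f1 = real n * d" for n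
    using wl(2) by (simp add: f1_def[abs_def])
  have i2: "real n / pi * integral {0..pi} f2 = real n * (RU a sig2 d - ln a)" for n
    using RU_eq[OF a s wl(1)[unfolded th_def]] by (simp add: f2_def[abs_def] th_def)
  have i3: "real n / pi * integral {0..pi} f3 = real n * VU a sig2 d" for n
    using VU_eq[OF a s wl(1)[unfolded th_def]] by (simp add: f3_def[abs_def] th_def)
  show thesis
  proof (rule that[of \<kappa> C])
    show "C > 0" unfolding C_def using nn by linarith
    fix n :: nat assume n: "n > 0"
    show "\<bar>(\<Sum>k\<in>{1..<n}. min th (?s (freq n k))) - real n * d\<bar> \<le> C"
      using Riemann_sum_error[OF l1 n] nn unfolding i1 C_def f1_def[symmetric] by linarith
    show "\<bar>(\<Sum>k\<in>{1..<n}. 1/2 * ln (max 1 (?s (freq n k) / th))) - real n * (RU a sig2 d - ln a)\<bar> \<le> C"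
      using Riemann_sum_error[OF l2 n] nn unfolding i2 C_def f2_def[symmetric] by linarith
    show "\<bar>(\<Sum>k\<in>{1..<n}. 1/2 * (min 1 (?s (freq n k) / th))\<^sup>2) - real n * VU a sig2 d\<bar> \<le> C"
      using Riemann_sum_error[OF l3 n] nn unfolding i3 C_def f3_def[symmetric] by linarith
    show "\<bar>(\<Sum>k\<in>{1..<n}. (max 0 (1 - th / ?s (freq n k)))\<^sup>2) - real n * \<kappa>\<bar> \<le> C"
      using Riemann_sum_error[OF l4 n] nn unfolding C_def f4_def[symmetric] \<kappa>_def by simp
  qed fact
qed

section \<open>Change of measure for Gaussian codewords\<close>

text \<open>It suffices to compare the measures on boxes, where the integral of the product density
  factorises.\<close>

lemma PiM_density:
  fixes N :: "'i \<Rightarrow> 'a measure"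
  assumes I: "finite I" and N: "\<And>i. prob_space (N i)" and f [measurable]: "\<And>i. i \<in> I \<Longrightarrow> f i \<in> borel_measurable (N i)"
    and D: "\<And>i. prob_space (N' i)" and N': "\<And>i. i \<in> I \<Longrightarrow> N' i = density (N i) (f i)"
  shows "PiM I N' = density (PiM I N) (\<lambda>x. \<Prod>i\<in>I. f i (x i))"
proof -
  interpret N: product_prob_space N by (simp add: product_prob_spaceI N)
  interpret D: product_prob_space N' by (simp add: product_prob_spaceI D)
  have "density (PiM I N) (\<lambda>x. \<Prod>i\<in>I. f i (x i)) = PiM I N'"
  proof (rule D.PiM_eqI)
    have "sets (PiM I N) = sets (PiM I N')" by (rule sets_PiM_cong) (auto simp: N')
    then show "sets (density (PiM I N) (\<lambda>x. \<Prod>i\<in>I. f i (x i))) = sets (PiM I N')" by simp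
  next
    fix A assume "\<And>i. i \<in> I \<Longrightarrow> A i \<in> sets (N' i)"
    then have A [measurable]: "\<And>i. i \<in> I \<Longrightarrow> A i \<in> sets (N i)" by (simp add: N')
    have PA: "Pi\<^sub>E I A \<in> sets (PiM I N)" using I A by (rule sets_PiM_I_finite)
    have "emeasure (density (PiM I N) (\<lambda>x. \<Prod>i\<in>I. f i (x i))) (Pi\<^sub>E I A)
      = (\<integral>\<^sup>+x. (\<Prod>i\<in>I. f i (x i)) * indicator (Pi\<^sub>E I A) x \<partial>PiM I N)"
      by (rule emeasure_density) (use PA I in \<open>auto intro!: borel_measurable_prod_ennreal\<close>)
    also have "\<dots> = (\<integral>\<^sup>+x. (\<Prod>i\<in>I. f i (x i) * indicator (A i) (x i)) \<partial>PiM I N)"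
    proof (rule nn_integral_cong)
      fix x assume x: "x \<in> space (PiM I N)"
      have "(indicator (Pi\<^sub>E I A) x :: ennreal) = (\<Prod>i\<in>I. indicator (A i) (x i))"
      proof (cases "x \<in> Pi\<^sub>E I A")
        case True
        then have "(\<Prod>i\<in>I. indicator (A i) (x i)) = (1::ennreal)" by (intro prod.neutral) (auto simp: PiE_def Pi_def)
        then show ?thesis using True by simp
      next
        case False
        then obtain i where "i \<in> I" "x i \<notin> A i" using x by (auto simp: space_PiM PiE_def Pi_def)
        then have "(\<Prod>i\<in>I. indicator (A i) (x i)) = (0::ennreal)" using I by (intro prod_zero bexI[of _ i]) auto
        then show ?thesis using False by simp
      qed
      then show "(\<Prod>i\<in>I. f i (x i)) * indicator (Pi\<^sub>E I A) x = (\<Prod>i\<in>I. f i (x i) * indicator (A i) (x i))"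
        by (simp add: prod.distrib)
    qed
    also have "\<dots> = (\<Prod>i\<in>I. \<integral>\<^sup>+x. f i x * indicator (A i) x \<partial>N i)"
      by (rule N.product_nn_integral_prod) (use I in auto)
    also have "\<dots> = (\<Prod>i\<in>I. emeasure (N' i) (A i))"
      by (intro prod.cong refl) (simp add: N' emeasure_density)
    finally show "emeasure (density (PiM I N) (\<lambda>x. \<Prod>i\<in>I. f i (x i))) (Pi\<^sub>E I A) = (\<Prod>i\<in>I. emeasure (N' i) (A i))" .
  qed fact
  then show ?thesis by simp
qed

lemma prob_space_PiM_coordinates:
  fixes N :: "'i \<Rightarrow> real measure"
  assumes I: "finite I" "I \<noteq> {}" and N: "\<And>i. prob_space (N i)" and s: "\<And>i. sets (N i) = sets borel"
  shows "prob_space.indep_vars (PiM I N) (\<lambda>_. borel) (\<lambda>i x. x i) I"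
    "\<And>i. i \<in> I \<Longrightarrow> distr (PiM I N) borel (\<lambda>x. x i) = N i"
proof -
  interpret N: product_prob_space N by (simp add: product_prob_spaceI N)
  have pP: "prob_space (PiM I N)" by (rule prob_space_PiM) (rule N)
  have sp: "space (N i) = UNIV" for i using sets_eq_imp_space_eq[OF s] by simp
  have m: "(\<lambda>x. x i) \<in> borel_measurable (PiM I N)" if "i \<in> I" for i
    using measurable_component_singleton[OF that, of N] measurable_cong_sets[OF refl s] by blast
  show d: "distr (PiM I N) borel (\<lambda>x. x i) = N i" if "i \<in> I" for i
  proof -
    have "distr (PiM I N) borel (\<lambda>x. x i) = distr (PiM I N) (N i) (\<lambda>x. x i)"
      by (rule distr_cong) (auto simp: s)
    also have "\<dots> = N i" by (rule distr_PiM_component) (use that N in auto)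
    finally show ?thesis .
  qed
  have "distr (PiM I N) (\<Pi>\<^sub>M i\<in>I. borel) (\<lambda>x. \<lambda>i\<in>I. x i) = distr (PiM I N) (PiM I N) (\<lambda>x. x)"
  proof (rule distr_cong)
    show "sets (\<Pi>\<^sub>M i\<in>I. borel) = sets (PiM I N)" by (rule sets_PiM_cong) (auto simp: s)
    fix x assume "x \<in> space (PiM I N)"
    then show "(\<lambda>i\<in>I. x i) = x" by (auto simp: space_PiM)
  qed simp
  also have "\<dots> = PiM I N" by (rule distr_id)
  also have "\<dots> = (\<Pi>\<^sub>M i\<in>I. distr (PiM I N) borel (\<lambda>x. x i))"
    by (rule PiM_cong) (auto simp: d)
  finally show "prob_space.indep_vars (PiM I N) (\<lambda>_. borel) (\<lambda>i x. x i) I"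
    by (subst prob_space.indep_vars_iff_distr_eq_PiM'[OF pP]) (use I m in auto)
qed

section \<open>Moments of squared Gaussian distances\<close>

abbreviation normalM :: "real \<Rightarrow> real \<Rightarrow> real measure" where
  "normalM \<mu> \<sigma> \<equiv> density lborel (\<lambda>x. ennreal (normal_density \<mu> \<sigma> x))"

lemma normalM_affine:
  assumes "\<sigma> > 0"
  shows "normalM \<mu> \<sigma> = distr stdN borel (\<lambda>g. \<mu> + \<sigma> * g)"
proof -
  interpret N: real_distribution stdN by (rule real_dist_normal_dist)
  have "distributed stdN lborel (\<lambda>x. x) (\<lambda>x. ennreal (std_normal_density x))"
    unfolding distributed_def by (auto simp: distr_id2)
  from N.normal_density_affine[OF this, of \<sigma> \<mu>] assms
  have "distributed stdN lborel (\<lambda>x. \<mu> + \<sigma> * x) (\<lambda>x. ennreal (normal_density \<mu> \<sigma> x))" by simp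
  then have "distr stdN lborel (\<lambda>x. \<mu> + \<sigma> * x) = normalM \<mu> \<sigma>" by (rule distributed_distr_eq_density)
  moreover have "distr stdN lborel (\<lambda>x. \<mu> + \<sigma> * x) = distr stdN borel (\<lambda>x. \<mu> + \<sigma> * x)" by (rule distr_cong) auto
  ultimately show ?thesis by simp
qed

lemma stdN_moments_high:
  "(LINT x|stdN. x ^ 3) = 0" "(LINT x|stdN. x ^ 6) = 15" "(LINT x|stdN. x ^ 8) = 105"
proof -
  show "(LINT x|stdN. x ^ 3) = 0" using integral_std_normal_distribution_moment_odd[of 3] by simp
  show "(LINT x|stdN. x ^ 6) = 15" using std_normal_distribution_even_moments(1)[of 3] by (simp add: fact_numeral)
  show "(LINT x|stdN. x ^ 8) = 105" using std_normal_distribution_even_moments(1)[of 4] by (simp add: fact_numeral)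
qed

lemma chi_moments:
  "integrable stdN (\<lambda>g. (g\<^sup>2 - 1) ^ 4)" "(LINT g|stdN. g\<^sup>2 - 1) = 0" "(LINT g|stdN. (g\<^sup>2 - 1)\<^sup>2) = 2" "(LINT g|stdN. (g\<^sup>2 - 1) ^ 4) = 60"
proof -
  interpret N: real_distribution stdN by (rule real_dist_normal_dist)
  note I = integrable_std_normal_distribution_moment
  have e4: "(g\<^sup>2 - 1) ^ 4 = g ^ 8 - 4 * g ^ 6 + 6 * g ^ 4 - 4 * g\<^sup>2 + 1" for g :: real
    by (simp add: eval_nat_numeral algebra_simps)
  have e2: "(g\<^sup>2 - 1)\<^sup>2 = g ^ 4 - 2 * g\<^sup>2 + 1" for g :: real
    by (simp add: eval_nat_numeral algebra_simps)
  show "integrable stdN (\<lambda>g. (g\<^sup>2 - 1) ^ 4)" unfolding e4 using I by (intro Bochner_Integration.integrable_add Bochner_Integration.integrable_diff integrable_mult_right) auto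
  have one: "(LINT g|stdN. 1) = (1::real)" using N.prob_space by simp
  show "(LINT g|stdN. g\<^sup>2 - 1) = 0" using I[of 2] stdN_moments one by simp
  show "(LINT g|stdN. (g\<^sup>2 - 1)\<^sup>2) = 2" unfolding e2 using I[of 2] I[of 4] stdN_moments one by simp
  show "(LINT g|stdN. (g\<^sup>2 - 1) ^ 4) = 60" unfolding e4 using I[of 2] I[of 4] I[of 6] I[of 8] stdN_moments stdN_moments_high one by simp
qed

text \<open>\<open>X\<close> is the centred squared distance in one coordinate. With
  \<open>(u - v)^4 \<le> 8 * u^4 + 8 * v^4\<close> the constants are
  \<open>8 * 16 * 3 = 384\<close>, from the Gaussian fourth moment, and \<open>8 * 60 = 480\<close>,
  from the fourth moment of \<open>g\<^sup>2 - 1\<close>.\<close>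

lemma shifted_square_moments:
  fixes m \<tau> :: real
  defines "X \<equiv> \<lambda>g. (m - \<tau> * g)\<^sup>2 - (m\<^sup>2 + \<tau>\<^sup>2)"
  shows "integrable stdN (\<lambda>g. X g ^ 4)" "(LINT g|stdN. X g) = 0" "(LINT g|stdN. (X g)\<^sup>2) = 4 * m\<^sup>2 * \<tau>\<^sup>2 + 2 * \<tau> ^ 4"
    "(LINT g|stdN. X g ^ 4) \<le> 384 * m ^ 4 * \<tau> ^ 4 + 480 * \<tau> ^ 8"
proof -
  interpret N: real_distribution stdN by (rule real_dist_normal_dist)
  note I = integrable_std_normal_distribution_moment
  have X: "X g = \<tau>\<^sup>2 * (g\<^sup>2 - 1) - 2 * m * \<tau> * g" for g
    by (simp add: X_def power2_eq_square algebra_simps)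
  have Ic: "integrable stdN (\<lambda>g. (g\<^sup>2 - 1))" using I[of 2] by simp
  have I1: "integrable stdN (\<lambda>g. g)" using I[of 1] by simp
  show "(LINT g|stdN. X g) = 0" unfolding X using chi_moments(2) stdN_moments(2) Ic I1 by simp
  have one: "(LINT g|stdN. 1) = (1::real)" using N.prob_space by simp
  have X2: "(X g)\<^sup>2 = \<tau> ^ 4 * g ^ 4 + (4 * m\<^sup>2 * \<tau>\<^sup>2 - 2 * \<tau> ^ 4) * g\<^sup>2 + \<tau> ^ 4 - 4 * m * \<tau> ^ 3 * g ^ 3 + 4 * m * \<tau> ^ 3 * g" for g
    unfolding X by (simp add: eval_nat_numeral algebra_simps)
  show "(LINT g|stdN. (X g)\<^sup>2) = 4 * m\<^sup>2 * \<tau>\<^sup>2 + 2 * \<tau> ^ 4"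
    unfolding X2 using I[of 2] I[of 3] I[of 4] I1 stdN_moments stdN_moments_high one by simp
  have le: "X g ^ 4 \<le> 128 * m ^ 4 * \<tau> ^ 4 * g ^ 4 + 8 * \<tau> ^ 8 * (g\<^sup>2 - 1) ^ 4" for g
  proof -
    define u v where "u = \<tau>\<^sup>2 * (g\<^sup>2 - 1)" and "v = 2 * m * \<tau> * g"
    have sq: "(p - q)\<^sup>2 \<le> 2 * p\<^sup>2 + 2 * q\<^sup>2" for p q :: real using zero_le_power2[of "p + q"] by (simp add: power2_eq_square algebra_simps)
    have "(u - v) ^ 4 = ((u - v)\<^sup>2)\<^sup>2" by simp
    also have "\<dots> \<le> (2 * u\<^sup>2 + 2 * v\<^sup>2)\<^sup>2" using sq[of u v] by (intro power_mono) auto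
    also have "\<dots> \<le> 2 * (2 * u\<^sup>2)\<^sup>2 + 2 * (2 * v\<^sup>2)\<^sup>2" using sq[of "2 * u\<^sup>2" "- (2 * v\<^sup>2)"] by simp
    also have "\<dots> = 128 * m ^ 4 * \<tau> ^ 4 * g ^ 4 + 8 * \<tau> ^ 8 * (g\<^sup>2 - 1) ^ 4"
      by (simp add: u_def v_def power_mult_distrib flip: power_mult)
    finally show ?thesis unfolding X u_def v_def .
  qed
  have IR: "integrable stdN (\<lambda>g. 128 * m ^ 4 * \<tau> ^ 4 * g ^ 4 + 8 * \<tau> ^ 8 * (g\<^sup>2 - 1) ^ 4)"
    by (intro Bochner_Integration.integrable_add integrable_mult_right I chi_moments(1))
  show IX: "integrable stdN (\<lambda>g. X g ^ 4)"
    by (rule Bochner_Integration.integrable_bound[OF IR]) (use le in \<open>auto simp: X intro!: AE_I2 order_trans[OF _ abs_ge_self]\<close>)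
  have "(LINT g|stdN. X g ^ 4) \<le> (LINT g|stdN. 128 * m ^ 4 * \<tau> ^ 4 * g ^ 4 + 8 * \<tau> ^ 8 * (g\<^sup>2 - 1) ^ 4)"
    by (rule integral_mono[OF IX IR le])
  also have "\<dots> = 384 * m ^ 4 * \<tau> ^ 4 + 480 * \<tau> ^ 8"
    using I[of 4] chi_moments(1) by (simp add: stdN_moments chi_moments)
  finally show "(LINT g|stdN. X g ^ 4) \<le> 384 * m ^ 4 * \<tau> ^ 4 + 480 * \<tau> ^ 8" .
qed

text \<open>Bayes' rule for the backward channel \<open>y = x + noise\<close>, where
  \<open>x\<close> has variance \<open>s - th\<close> and the noise variance \<open>th\<close>. The
  last factor is the conditional density of \<open>x\<close> given \<open>y\<close>; the factors
  before it are the density of \<open>y\<close> divided by the density of \<open>y\<close> given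
  \<open>x\<close>.\<close>

lemma tilted_normal_density:
  fixes s th y x :: real
  assumes "th > 0" "s > th"
  shows "normal_density 0 (sqrt (s - th)) x
    = sqrt (th / s) * exp (- y\<^sup>2 / (2 * s)) * exp ((y - x)\<^sup>2 / (2 * th))
      * normal_density ((1 - th / s) * y) (sqrt (th * (1 - th / s))) x"
proof -
  have s: "s > 0" "s - th > 0" "1 - th / s > 0" using assms by (auto simp: field_simps)
  have e: "- x\<^sup>2 / (2 * (s - th)) = - y\<^sup>2 / (2 * s) + (y - x)\<^sup>2 / (2 * th) - (x - (1 - th / s) * y)\<^sup>2 / (2 * (th * (1 - th / s)))"
  proof -
    have r: "1 - th / s = (s - th) / s" using s by (simp add: field_simps)
    have "2 * s * th * (s - th) * (- y\<^sup>2 / (2 * s) + (y - x)\<^sup>2 / (2 * th) - (x - (1 - th / s) * y)\<^sup>2 / (2 * (th * (1 - th / s))))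
      = - (th * (s - th)) * y\<^sup>2 + s * (s - th) * (y - x)\<^sup>2 - (s * x - (s - th) * y)\<^sup>2"
      unfolding r using s assms by (simp add: field_simps power2_eq_square)
    also have "\<dots> = - s * th * x\<^sup>2" by (simp add: power2_eq_square algebra_simps)
    also have "\<dots> = 2 * s * th * (s - th) * (- x\<^sup>2 / (2 * (s - th)))" using s by (simp add: field_simps)
    finally have "2 * s * th * (s - th) * (- x\<^sup>2 / (2 * (s - th))) = 2 * s * th * (s - th)
      * (- y\<^sup>2 / (2 * s) + (y - x)\<^sup>2 / (2 * th) - (x - (1 - th / s) * y)\<^sup>2 / (2 * (th * (1 - th / s))))" by (rule sym)
    moreover have "2 * s * th * (s - th) \<noteq> 0" using s assms by simp
    ultimately show ?thesis by (rule mult_left_cancel[THEN iffD1, rotated])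
  qed
  have c: "1 / sqrt (2 * pi * (s - th)) = sqrt (th / s) * (1 / sqrt (2 * pi * (th * (1 - th / s))))"
  proof -
    have "2 * pi * (th * (1 - th / s)) = (th / s) * (2 * pi * (s - th))" using s by (simp add: field_simps)
    then have "sqrt (2 * pi * (th * (1 - th / s))) = sqrt (th / s) * sqrt (2 * pi * (s - th))"
      by (simp only: real_sqrt_mult)
    moreover have "sqrt (th / s) > 0" using s assms by simp
    ultimately show ?thesis using s(1) assms(1) by simp
  qed
  have q: "(sqrt (s - th))\<^sup>2 = s - th" "(sqrt (th * (1 - th / s)))\<^sup>2 = th * (1 - th / s)" using s assms by simp_all
  show ?thesis
    unfolding normal_density_def q diff_0_right e exp_add exp_diff c by (simp add: exp_minus field_simps)
qed

text \<open>The variance \<open>s k - th\<close> is that of the optimal reproduction under reverse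
  water-filling. The value 1 outside \<open>J\<close> is a dummy that makes every factor of the
  family a probability measure.\<close>

definition codeword_measure :: "nat set \<Rightarrow> real \<Rightarrow> (nat \<Rightarrow> real) \<Rightarrow> (nat \<Rightarrow> real) measure" where
  "codeword_measure J th s = PiM J (\<lambda>k. normalM 0 (if k \<in> J then sqrt (s k - th) else 1))"

lemma prob_space_normalM: "\<sigma> > 0 \<Longrightarrow> prob_space (normalM \<mu> \<sigma>)"
  by (rule prob_space_normal_density)

lemma prob_space_codeword_measure:
  assumes "\<And>k. k \<in> J \<Longrightarrow> s k > th"
  shows "prob_space (codeword_measure J th s)"
  unfolding codeword_measure_def by (intro prob_space_PiM prob_space_normalM) (use assms in auto)

lemma sets_codeword_measure: "sets (codeword_measure J th s) = sets (PiM J (\<lambda>_. borel))"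
  unfolding codeword_measure_def by (rule sets_PiM_cong) auto

text \<open>Change of measure to the conditional law of the codeword given the source, under which the
  distance to the source concentrates at the admissible value.\<close>

lemma codeword_ball_tilted:
  fixes y :: "nat \<Rightarrow> real"
  assumes J: "finite J" and th: "th > 0" and s: "\<And>k. k \<in> J \<Longrightarrow> s k > th"
  defines "N' \<equiv> \<lambda>k. normalM (if k \<in> J then (1 - th / s k) * y k else 0) (if k \<in> J then sqrt (th * (1 - th / s k)) else 1)"
  shows "(\<Prod>k\<in>J. sqrt (th / s k) * exp (- (y k)\<^sup>2 / (2 * s k))) * exp ((D - \<delta>) / (2 * th))
     * measure (PiM J N') {x \<in> space (PiM J N'). D - \<delta> \<le> (\<Sum>k\<in>J. (y k - x k)\<^sup>2) \<and> (\<Sum>k\<in>J. (y k - x k)\<^sup>2) \<le> D}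
    \<le> measure (codeword_measure J th s) {x \<in> space (codeword_measure J th s). (\<Sum>k\<in>J. (y k - x k)\<^sup>2) \<le> D}"
proof -
  let ?\<nu> = "codeword_measure J th s"
  \<comment> \<open>The likelihood ratio of the codeword law against its conditional law given the
    source.\<close>
  define w where "w k x = sqrt (th / s k) * exp (- (y k)\<^sup>2 / (2 * s k)) * exp ((y k - x)\<^sup>2 / (2 * th))" for k x
  have sp: "s k > 0" "1 - th / s k > 0" if "k \<in> J" for k using s[OF that] th by (auto simp: field_simps)
  have w0: "0 \<le> w k x" if "k \<in> J" for k x using sp[OF that] th by (simp add: w_def)
  have pN': "prob_space (N' k)" for k unfolding N'_def by (rule prob_space_normalM) (use sp th in auto)
  have pN: "prob_space (normalM 0 (if k \<in> J then sqrt (s k - th) else 1))" for k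
    by (rule prob_space_normalM) (use s in auto)
  interpret P': prob_space "PiM J N'" by (rule prob_space_PiM) (rule pN')
  interpret P: prob_space ?\<nu> by (rule prob_space_codeword_measure) (rule s)
  have sets': "sets (PiM J N') = sets (PiM J (\<lambda>_. borel))" by (rule sets_PiM_cong) (auto simp: N'_def)
  have sp': "space (PiM J N') = space (PiM J (\<lambda>_. borel :: real measure))" by (rule sets_eq_imp_space_eq) (rule sets')
  have Sm0: "(\<lambda>x. \<Sum>k\<in>J. (y k - x k)\<^sup>2) \<in> borel_measurable (PiM J (\<lambda>_. borel))" by measurable
  have Sm [measurable]: "(\<lambda>x. \<Sum>k\<in>J. (y k - x k)\<^sup>2) \<in> borel_measurable (PiM J N')"
    using Sm0 by (simp add: measurable_cong_sets[OF sets' refl])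
  have dens: "?\<nu> = density (PiM J N') (\<lambda>x. \<Prod>k\<in>J. ennreal (w k (x k)))"
    unfolding codeword_measure_def
  proof (rule PiM_density)
    fix k assume k: "k \<in> J"
    show "(\<lambda>x. ennreal (w k x)) \<in> borel_measurable (N' k)" unfolding w_def N'_def by measurable
    have "ennreal (normal_density 0 (sqrt (s k - th)) x)
        = ennreal (normal_density ((1 - th / s k) * y k) (sqrt (th * (1 - th / s k))) x) * ennreal (w k x)" for x
      unfolding tilted_normal_density[OF th s[OF k], of x "y k"] w_def[symmetric]
      using w0[OF k] by (simp add: ennreal_mult' mult.commute)
    then show "normalM 0 (if k \<in> J then sqrt (s k - th) else 1) = density (N' k) (\<lambda>x. ennreal (w k x))"
      using k unfolding N'_def w_def by (simp add: density_density_eq)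
  qed (use J pN pN' in auto)
  define Q where "Q = (\<Prod>k\<in>J. sqrt (th / s k) * exp (- (y k)\<^sup>2 / (2 * s k)))"
  have Q0: "0 \<le> Q" unfolding Q_def by (rule prod_nonneg) (use sp th in \<open>auto simp: less_imp_le\<close>)
  define S where "S x = (\<Sum>k\<in>J. (y k - x k)\<^sup>2)" for x
  have Smm [measurable]: "S \<in> borel_measurable (PiM J N')" unfolding S_def by (rule Sm)
  have prodw: "(\<Prod>k\<in>J. ennreal (w k (x k))) = ennreal (Q * exp (S x / (2 * th)))" for x
  proof -
    have "(\<Prod>k\<in>J. ennreal (w k (x k))) = ennreal (\<Prod>k\<in>J. w k (x k))" by (rule prod_ennreal) (rule w0)
    also have "(\<Prod>k\<in>J. w k (x k)) = Q * (\<Prod>k\<in>J. exp ((y k - x k)\<^sup>2 / (2 * th)))"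
      unfolding w_def Q_def by (rule prod.distrib)
    also have "(\<Prod>k\<in>J. exp ((y k - x k)\<^sup>2 / (2 * th))) = exp (S x / (2 * th))"
      using J by (simp add: exp_sum S_def sum_divide_distrib)
    finally show ?thesis .
  qed
  let ?W = "{x \<in> space (PiM J N'). D - \<delta> \<le> S x \<and> S x \<le> D}"
  let ?B = "{x \<in> space (PiM J N'). S x \<le> D}"
  have "ennreal (Q * exp ((D - \<delta>) / (2 * th)) * measure (PiM J N') ?W)
     = ennreal (Q * exp ((D - \<delta>) / (2 * th))) * (\<integral>\<^sup>+x. indicator ?W x \<partial>PiM J N')"
    using Q0 by (simp add: P'.emeasure_eq_measure ennreal_mult')
  also have "\<dots> = (\<integral>\<^sup>+x. ennreal (Q * exp ((D - \<delta>) / (2 * th))) * indicator ?W x \<partial>PiM J N')"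
    by (rule nn_integral_cmult[symmetric]) measurable
  \<comment> \<open>The product of the ratios increases with the distance \<open>S x\<close>, so on
    the window it is at least its value at the lower edge \<open>D - \<delta>\<close>. A narrow
    window therefore loses only the factor \<open>exp (- \<delta> / (2 * th))\<close>.\<close>
  also have "\<dots> \<le> (\<integral>\<^sup>+x. (\<Prod>k\<in>J. ennreal (w k (x k))) * indicator ?B x \<partial>PiM J N')"
  proof (rule nn_integral_mono)
    fix x
    show "ennreal (Q * exp ((D - \<delta>) / (2 * th))) * indicator ?W x \<le> (\<Prod>k\<in>J. ennreal (w k (x k))) * indicator ?B x"
    proof (cases "x \<in> ?W")
      case True
      then have "Q * exp ((D - \<delta>) / (2 * th)) \<le> Q * exp (S x / (2 * th))"
        using Q0 th by (intro mult_left_mono) (auto simp: divide_right_mono)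
      then show ?thesis using True unfolding prodw by (simp add: ennreal_leI)
    qed simp
  qed
  also have "\<dots> = emeasure ?\<nu> ?B"
    unfolding dens by (rule emeasure_density[symmetric]) (auto simp: prodw)
  also have "\<dots> = ennreal (measure ?\<nu> ?B)" by (rule P.emeasure_eq_measure)
  finally have "Q * exp ((D - \<delta>) / (2 * th)) * measure (PiM J N') ?W \<le> measure ?\<nu> ?B"
    by simp
  moreover have "space ?\<nu> = space (PiM J N')"
    unfolding sp' by (rule sets_eq_imp_space_eq) (rule sets_codeword_measure)
  ultimately show ?thesis unfolding Q_def S_def by simp
qed

text \<open>Under the conditional law the distance is a sum of independent terms with means
  \<open>(m k)\<^sup>2 + q k\<close> and variances \<open>v k\<close>. The window has length
  \<open>3 * \<delta>\<close> and ends at the admissible value \<open>D\<close>; \<open>r\<close>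
  bounds how far its middle third lies from the mean.\<close>

lemma codeword_window_prob:
  fixes y :: "nat \<Rightarrow> real"
  assumes J: "finite J" "J \<noteq> {}" and th: "th > 0" and s: "\<And>k. k \<in> J \<Longrightarrow> s k > th" and \<delta>: "\<delta> > 0"
  defines "N' \<equiv> \<lambda>k. normalM (if k \<in> J then (1 - th / s k) * y k else 0) (if k \<in> J then sqrt (th * (1 - th / s k)) else 1)"
    and "m \<equiv> \<lambda>k. th / s k * y k" and "q \<equiv> \<lambda>k. th * (1 - th / s k)"
  defines "v \<equiv> \<lambda>k. 4 * (m k)\<^sup>2 * q k + 2 * (q k)\<^sup>2"
  assumes V: "0 < V0" "V0 \<le> (\<Sum>k\<in>J. v k)" "(\<Sum>k\<in>J. v k) \<le> V1"
    and r: "\<bar>D - 3 * \<delta> - (\<Sum>k\<in>J. (m k)\<^sup>2 + q k)\<bar> + 3 * \<delta> \<le> r"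
  shows "\<delta> / (sqrt V1 * sqrt (2 * pi)) * exp (- r\<^sup>2 / (2 * V0))
      - 72 / \<delta> ^ 3 * (\<Sum>k\<in>J. 2 + (384 * (m k) ^ 4 * (q k)\<^sup>2 + 480 * (q k) ^ 4) + 3 * (v k)\<^sup>2)
    \<le> measure (PiM J N') {x \<in> space (PiM J N'). D - 3 * \<delta> \<le> (\<Sum>k\<in>J. (y k - x k)\<^sup>2) \<and> (\<Sum>k\<in>J. (y k - x k)\<^sup>2) \<le> D}"
proof -
  have qp: "q k > 0" if "k \<in> J" for k using s[OF that] th by (auto simp: q_def field_simps)
  have pN': "prob_space (N' k)" for k unfolding N'_def by (rule prob_space_normalM) (use qp in \<open>auto simp: q_def\<close>)
  have sN': "sets (N' k) = sets borel" for k by (simp add: N'_def)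
  interpret P: prob_space "PiM J N'" by (rule prob_space_PiM) (rule pN')
  note co = prob_space_PiM_coordinates[where N=N', OF J pN' sN']
  define X where "X k x = (y k - x k)\<^sup>2 - ((m k)\<^sup>2 + q k)" for k and x :: "nat \<Rightarrow> real"
  have tr: "(LINT x|PiM J N'. \<phi> (X k x)) = (LINT g|stdN. \<phi> ((m k - sqrt (q k) * g)\<^sup>2 - ((m k)\<^sup>2 + (sqrt (q k))\<^sup>2)))"
    and tri: "integrable (PiM J N') (\<lambda>x. \<phi> (X k x)) \<longleftrightarrow> integrable stdN (\<lambda>g. \<phi> ((m k - sqrt (q k) * g)\<^sup>2 - ((m k)\<^sup>2 + (sqrt (q k))\<^sup>2)))"
    if k: "k \<in> J" and [measurable]: "\<phi> \<in> borel_measurable borel" for k and \<phi> :: "real \<Rightarrow> real"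
  proof -
    have cm [measurable]: "(\<lambda>x. x k) \<in> borel_measurable (PiM J N')"
      using measurable_component_singleton[OF k, of N'] measurable_cong_sets[OF refl sN'] by blast
    have am: "(\<lambda>g. (1 - th / s k) * y k + sqrt (q k) * g) \<in> borel_measurable stdN" by simp
    define \<psi> where "\<psi> z = \<phi> ((y k - z)\<^sup>2 - ((m k)\<^sup>2 + q k))" for z
    have \<psi>m [measurable]: "\<psi> \<in> borel_measurable borel" unfolding \<psi>_def by measurable
    have N'k: "N' k = distr stdN borel (\<lambda>g. (1 - th / s k) * y k + sqrt (q k) * g)"
      unfolding N'_def using k normalM_affine[of "sqrt (q k)" "(1 - th / s k) * y k"] qp[OF k] by (simp add: q_def)
    \<comment> \<open>The residual \<open>y k - x k\<close> has mean \<open>m k\<close> and standard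
      deviation \<open>sqrt (q k)\<close>, which is the form treated in
      \<open>shifted_square_moments\<close>.\<close>
    have e: "\<psi> ((1 - th / s k) * y k + sqrt (q k) * g) = \<phi> ((m k - sqrt (q k) * g)\<^sup>2 - ((m k)\<^sup>2 + (sqrt (q k))\<^sup>2))" for g
    proof -
      have "y k - ((1 - th / s k) * y k + sqrt (q k) * g) = m k - sqrt (q k) * g" by (simp add: m_def algebra_simps)
      moreover have "(sqrt (q k))\<^sup>2 = q k" using qp[OF k] by simp
      ultimately show ?thesis unfolding \<psi>_def by (simp only:)
    qed
    have "(LINT x|PiM J N'. \<phi> (X k x)) = (LINT x|PiM J N'. \<psi> (x k))" by (simp add: X_def \<psi>_def)
    also have "\<dots> = (LINT z|distr (PiM J N') borel (\<lambda>x. x k). \<psi> z)" by (rule integral_distr[OF cm \<psi>m, symmetric])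
    also have "\<dots> = (LINT z|N' k. \<psi> z)" by (simp only: co(2)[OF k])
    also have "\<dots> = (LINT g|stdN. \<psi> ((1 - th / s k) * y k + sqrt (q k) * g))" unfolding N'k by (rule integral_distr[OF am \<psi>m])
    finally show "(LINT x|PiM J N'. \<phi> (X k x)) = (LINT g|stdN. \<phi> ((m k - sqrt (q k) * g)\<^sup>2 - ((m k)\<^sup>2 + (sqrt (q k))\<^sup>2)))"
      unfolding e .
    have "integrable (PiM J N') (\<lambda>x. \<phi> (X k x)) \<longleftrightarrow> integrable (PiM J N') (\<lambda>x. \<psi> (x k))" by (simp add: X_def \<psi>_def)
    also have "\<dots> \<longleftrightarrow> integrable (distr (PiM J N') borel (\<lambda>x. x k)) \<psi>" by (rule integrable_distr_eq[OF cm \<psi>m, symmetric])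
    also have "\<dots> \<longleftrightarrow> integrable (N' k) \<psi>" by (simp only: co(2)[OF k])
    also have "\<dots> \<longleftrightarrow> integrable stdN (\<lambda>g. \<psi> ((1 - th / s k) * y k + sqrt (q k) * g))" unfolding N'k by (rule integrable_distr_eq[OF am \<psi>m])
    finally show "integrable (PiM J N') (\<lambda>x. \<phi> (X k x)) \<longleftrightarrow> integrable stdN (\<lambda>g. \<phi> ((m k - sqrt (q k) * g)\<^sup>2 - ((m k)\<^sup>2 + (sqrt (q k))\<^sup>2)))"
      unfolding e .
  qed
  have sq: "sqrt (q k) ^ 2 = q k" "sqrt (q k) ^ 4 = (q k)\<^sup>2" "sqrt (q k) ^ 8 = (q k) ^ 4" if "k \<in> J" for k
  proof -
    show 1: "sqrt (q k) ^ 2 = q k" using qp[OF that] by simp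
    show "sqrt (q k) ^ 4 = (q k)\<^sup>2" using power_mult[of "sqrt (q k)" 2 2] 1 by simp
    show "sqrt (q k) ^ 8 = (q k) ^ 4" using power_mult[of "sqrt (q k)" 2 4] 1 by simp
  qed
  have ind: "P.indep_vars (\<lambda>_. borel) X J"
    unfolding X_def[abs_def] by (rule P.indep_vars_compose2[OF co(1)]) measurable
  have W: "measure stdN {g. (D - 3 * \<delta> - (\<Sum>k\<in>J. (m k)\<^sup>2 + q k)) + \<delta> \<le> sqrt (\<Sum>k\<in>J. v k) * g
        \<and> sqrt (\<Sum>k\<in>J. v k) * g \<le> (D - 3 * \<delta> - (\<Sum>k\<in>J. (m k)\<^sup>2 + q k)) + 2 * \<delta>}
      - 72 / \<delta> ^ 3 * (\<Sum>k\<in>J. 2 + (384 * (m k) ^ 4 * (q k)\<^sup>2 + 480 * (q k) ^ 4) + 3 * (v k)\<^sup>2)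
    \<le> P.prob {x \<in> space (PiM J N'). (D - 3 * \<delta> - (\<Sum>k\<in>J. (m k)\<^sup>2 + q k)) \<le> (\<Sum>k\<in>J. X k x)
        \<and> (\<Sum>k\<in>J. X k x) \<le> (D - 3 * \<delta> - (\<Sum>k\<in>J. (m k)\<^sup>2 + q k)) + 3 * \<delta>}"
  proof (rule P.Lindeberg_window[OF J(1) ind _ _ _ _ \<delta>])
    fix k assume k: "k \<in> J"
    note M = shifted_square_moments[of "m k" "sqrt (q k)"]
    show "integrable (PiM J N') (\<lambda>x. X k x ^ 4)" using tri[OF k, of "\<lambda>z. z ^ 4"] M(1) by simp
    show "P.expectation (X k) = 0" using tr[OF k, of "\<lambda>z. z"] M(2) by simp
    show "P.expectation (\<lambda>x. (X k x)\<^sup>2) = v k" using tr[OF k, of "\<lambda>z. z\<^sup>2"] M(3) sq[OF k] by (simp add: v_def)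
    show "P.expectation (\<lambda>x. X k x ^ 4) \<le> 384 * m k ^ 4 * (q k)\<^sup>2 + 480 * q k ^ 4"
      using tr[OF k, of "\<lambda>z. z ^ 4"] M(4) sq[OF k] by simp
  qed
  let ?c = "D - 3 * \<delta> - (\<Sum>k\<in>J. (m k)\<^sup>2 + q k)"
  have "(\<Sum>k\<in>J. X k x) = (\<Sum>k\<in>J. (y k - x k)\<^sup>2) - (\<Sum>k\<in>J. (m k)\<^sup>2 + q k)" for x
    by (simp add: X_def sum_subtractf)
  then have set: "{x \<in> space (PiM J N'). ?c \<le> (\<Sum>k\<in>J. X k x) \<and> (\<Sum>k\<in>J. X k x) \<le> ?c + 3 * \<delta>}
     = {x \<in> space (PiM J N'). D - 3 * \<delta> \<le> (\<Sum>k\<in>J. (y k - x k)\<^sup>2) \<and> (\<Sum>k\<in>J. (y k - x k)\<^sup>2) \<le> D}"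
    by (intro Collect_cong conj_cong) auto
  let ?V = "\<Sum>k\<in>J. v k"
  have Vp: "?V > 0" using V by linarith
  \<comment> \<open>The unknown variance is replaced by \<open>V1\<close> in the prefactor and by
    \<open>V0\<close> in the exponent, each time in the pessimistic direction.\<close>
  have "\<delta> / (sqrt V1 * sqrt (2 * pi)) * exp (- r\<^sup>2 / (2 * V0)) \<le> \<delta> / (sqrt ?V * sqrt (2 * pi)) * exp (- r\<^sup>2 / (2 * ?V))"
  proof (rule mult_mono)
    show "\<delta> / (sqrt V1 * sqrt (2 * pi)) \<le> \<delta> / (sqrt ?V * sqrt (2 * pi))"
      using \<delta> V Vp by (intro divide_left_mono mult_right_mono) auto
    have "r\<^sup>2 / (2 * ?V) \<le> r\<^sup>2 / (2 * V0)" using V Vp by (intro divide_left_mono) auto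
    then show "exp (- r\<^sup>2 / (2 * V0)) \<le> exp (- r\<^sup>2 / (2 * ?V))" by simp
  qed (use \<delta> Vp in auto)
  also have "\<dots> = ((?c + 2 * \<delta>) - (?c + \<delta>)) / (sqrt ?V * sqrt (2 * pi)) * exp (- r\<^sup>2 / (2 * (sqrt ?V)\<^sup>2))"
    using Vp by simp
  also have "\<dots> \<le> measure stdN {g. ?c + \<delta> \<le> sqrt ?V * g \<and> sqrt ?V * g \<le> ?c + 2 * \<delta>}"
    by (rule stdN_window_lower_bound) (use Vp \<delta> r in auto)
  finally show ?thesis using W unfolding set by linarith
qed

text \<open>\<open>N\<close> are the whitened coefficients of a fixed source, with three typicality
  conditions: the first bounds the centred tilted information by \<open>t\<close>, the second keeps
  the conditional mean distance near \<open>D\<close>, and the third controls variances and fourth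
  moments. The exponent is then the water-filling rate plus \<open>t\<close>, up to the width of the
  window.\<close>

lemma codeword_prob_bound:
  fixes s N :: "nat \<Rightarrow> real"
  assumes K: "finite K" and th: "th > 0" and s: "\<And>k. k \<in> K \<Longrightarrow> s k > 0" and \<delta>: "\<delta> > 0"
  defines "J \<equiv> {k \<in> K. s k > th}"
  assumes V0: "V0 > 0" "V0 \<le> 2 * th\<^sup>2 * (\<Sum>k\<in>K. (max 0 (1 - th / s k))\<^sup>2)"
    and Y: "(\<Sum>k\<in>K. 1/2 * min 1 (s k / th) * ((N k)\<^sup>2 - 1)) \<le> t"
    and R: "\<bar>\<Sum>k\<in>K. (if s k > th then th\<^sup>2 / s k else s k) * ((N k)\<^sup>2 - 1)\<bar> \<le> R"
    and T: "(\<Sum>k\<in>K. 1 + N k ^ 4) \<le> T"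
    and C: "\<bar>D - (\<Sum>k\<in>K. min th (s k))\<bar> \<le> C"
    and pos: "0 \<le> \<delta> / (sqrt (6 * th\<^sup>2 * T) * sqrt (2 * pi)) * exp (- (R + C + 6 * \<delta>)\<^sup>2 / (2 * V0)) - 36288 * (1 + th ^ 4) * T / \<delta> ^ 3"
  shows "exp (- ((\<Sum>k\<in>K. 1/2 * ln (max 1 (s k / th))) + t + (C + 3 * \<delta>) / (2 * th)))
     * (\<delta> / (sqrt (6 * th\<^sup>2 * T) * sqrt (2 * pi)) * exp (- (R + C + 6 * \<delta>)\<^sup>2 / (2 * V0)) - 36288 * (1 + th ^ 4) * T / \<delta> ^ 3)
    \<le> measure (codeword_measure J th s) {x \<in> space (codeword_measure J th s).
        (\<Sum>k\<in>K. (sqrt (s k) * N k - (if k \<in> J then x k else 0))\<^sup>2) \<le> D}"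
proof -
  have J: "finite J" "J \<subseteq> K" and sJ: "\<And>k. k \<in> J \<Longrightarrow> s k > th" using K by (auto simp: J_def)
  have notJ: "s k \<le> th" if "k \<in> K - J" for k using that by (auto simp: J_def)
  have split: "(\<Sum>k\<in>K. f k) = (\<Sum>k\<in>K - J. f k) + (\<Sum>k\<in>J. f k)" for f :: "nat \<Rightarrow> real"
    using sum.subset_diff[OF J(2) K] .
  define y where "y k = sqrt (s k) * N k" for k
  define m where "m k = th / s k * y k" for k
  define q where "q k = th * (1 - th / s k)" for k
  define v where "v k = 4 * (m k)\<^sup>2 * q k + 2 * (q k)\<^sup>2" for k
  \<comment> \<open>Components below the water level are reproduced by 0, so their distortion is
    fixed by the source and is deducted from \<open>D\<close>.\<close>
  define Sin where "Sin = (\<Sum>k\<in>K - J. s k * (N k)\<^sup>2)"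
  define B where "B = \<delta> / (sqrt (6 * th\<^sup>2 * T) * sqrt (2 * pi)) * exp (- (R + C + 6 * \<delta>)\<^sup>2 / (2 * V0)) - 36288 * (1 + th ^ 4) * T / \<delta> ^ 3"
  have qb: "0 < q k" "q k \<le> th" if "k \<in> J" for k
    using sJ[OF that] th by (auto simp: q_def field_simps)
  have m2: "(m k)\<^sup>2 = th\<^sup>2 / s k * (N k)\<^sup>2" if "k \<in> J" for k
    using sJ[OF that] th by (simp add: m_def y_def power_mult_distrib power_divide power2_eq_square[of "s k"])
  have m2b: "(m k)\<^sup>2 \<le> th * (N k)\<^sup>2" if "k \<in> J" for k
  proof -
    have "th\<^sup>2 / s k \<le> th" using sJ[OF that] th by (simp add: field_simps power2_eq_square)
    then show ?thesis unfolding m2[OF that] by (intro mult_right_mono) auto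
  qed
  have n24: "(N k)\<^sup>2 \<le> 1 + N k ^ 4" for k using abs_power_le_1_plus_power4[of 2 "N k"] by simp
  have m4b: "m k ^ 4 \<le> th\<^sup>2 * N k ^ 4" if "k \<in> J" for k
  proof -
    have "((m k)\<^sup>2)\<^sup>2 \<le> (th * (N k)\<^sup>2)\<^sup>2" using m2b[OF that] by (intro power_mono) auto
    then show ?thesis by (simp add: power_mult_distrib flip: power_mult)
  qed
  have vb: "v k \<le> 6 * th\<^sup>2 * (1 + N k ^ 4)" "(v k)\<^sup>2 \<le> 32 * th ^ 4 * N k ^ 4 + 8 * th ^ 4"
    "2 * (q k)\<^sup>2 \<le> v k" if k: "k \<in> J" for k
  proof -
    have q2: "(q k)\<^sup>2 \<le> th\<^sup>2" using qb[OF k] by (intro power_mono) auto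
    have "(m k)\<^sup>2 * q k \<le> (th * (N k)\<^sup>2) * th" using m2b[OF k] qb[OF k] th by (intro mult_mono) auto
    then have v1: "v k \<le> 4 * (th\<^sup>2 * (N k)\<^sup>2) + 2 * th\<^sup>2" using q2 by (simp add: v_def power2_eq_square[of th] mult_ac)
    have "4 * (th\<^sup>2 * (N k)\<^sup>2) + 2 * th\<^sup>2 \<le> 4 * (th\<^sup>2 * (1 + N k ^ 4)) + 2 * (th\<^sup>2 * (1 + N k ^ 4))"
    proof (rule add_mono)
      show "4 * (th\<^sup>2 * (N k)\<^sup>2) \<le> 4 * (th\<^sup>2 * (1 + N k ^ 4))" using n24[of k] by (simp add: mult_left_mono)
      have "th\<^sup>2 * 1 \<le> th\<^sup>2 * (1 + N k ^ 4)" by (intro mult_left_mono) auto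
      then show "2 * th\<^sup>2 \<le> 2 * (th\<^sup>2 * (1 + N k ^ 4))" by simp
    qed
    then show "v k \<le> 6 * th\<^sup>2 * (1 + N k ^ 4)" using v1 by linarith
    have "0 \<le> v k" using qb[OF k] by (simp add: v_def)
    then have "(v k)\<^sup>2 \<le> (4 * (th\<^sup>2 * (N k)\<^sup>2) + 2 * th\<^sup>2)\<^sup>2" using v1 by (intro power_mono)
    also have "\<dots> \<le> 2 * (4 * (th\<^sup>2 * (N k)\<^sup>2))\<^sup>2 + 2 * (2 * th\<^sup>2)\<^sup>2"
    proof -
      have sq: "(p + q)\<^sup>2 \<le> 2 * p\<^sup>2 + 2 * q\<^sup>2" for p q :: real using zero_le_power2[of "p - q"] by (simp add: power2_eq_square algebra_simps)
      show ?thesis by (rule sq)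
    qed
    also have "\<dots> = 32 * th ^ 4 * N k ^ 4 + 8 * th ^ 4" by (simp add: power_mult_distrib flip: power_mult)
    finally show "(v k)\<^sup>2 \<le> 32 * th ^ 4 * N k ^ 4 + 8 * th ^ 4" .
    show "2 * (q k)\<^sup>2 \<le> v k" using qb[OF k] by (simp add: v_def)
  qed
  have Tn: "0 \<le> (\<Sum>k\<in>K - J. 1 + N k ^ 4)" by (rule sum_nonneg) simp
  then have TJ: "(\<Sum>k\<in>J. 1 + N k ^ 4) \<le> T" using T split[of "\<lambda>k. 1 + N k ^ 4"] by linarith
  have V0': "V0 \<le> (\<Sum>k\<in>J. v k)"
  proof -
    have "(\<Sum>k\<in>K. (max 0 (1 - th / s k))\<^sup>2) = (\<Sum>k\<in>J. (max 0 (1 - th / s k))\<^sup>2)"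
    proof -
      have "(\<Sum>k\<in>K - J. (max 0 (1 - th / s k))\<^sup>2) = 0"
      proof (rule sum.neutral, rule ballI)
        fix k assume k: "k \<in> K - J"
        then have "1 - th / s k \<le> 0" using notJ[OF k] s[of k] by (simp add: field_simps)
        then show "(max 0 (1 - th / s k))\<^sup>2 = 0" by simp
      qed
      then show ?thesis using split[of "\<lambda>k. (max 0 (1 - th / s k))\<^sup>2"] by simp
    qed
    then have "V0 \<le> (\<Sum>k\<in>J. 2 * th\<^sup>2 * (max 0 (1 - th / s k))\<^sup>2)" using V0(2) by (simp add: sum_distrib_left)
    also have "\<dots> \<le> (\<Sum>k\<in>J. v k)"
    proof (rule sum_mono)
      fix k assume k: "k \<in> J"
      have "1 - th / s k > 0" using sJ[OF k] th by (simp add: field_simps)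
      then have "2 * th\<^sup>2 * (max 0 (1 - th / s k))\<^sup>2 = 2 * (q k)\<^sup>2" by (simp add: q_def power_mult_distrib)
      then show "2 * th\<^sup>2 * (max 0 (1 - th / s k))\<^sup>2 \<le> v k" using vb(3)[OF k] by simp
    qed
    finally show ?thesis .
  qed
  have Jne: "J \<noteq> {}" using V0' V0(1) by auto
  have V1: "(\<Sum>k\<in>J. v k) \<le> 6 * th\<^sup>2 * T"
  proof -
    have "(\<Sum>k\<in>J. v k) \<le> (\<Sum>k\<in>J. 6 * th\<^sup>2 * (1 + N k ^ 4))" by (rule sum_mono) (rule vb(1))
    also have "\<dots> = 6 * th\<^sup>2 * (\<Sum>k\<in>J. 1 + N k ^ 4)" by (simp only: sum_distrib_left)
    also have "\<dots> \<le> 6 * th\<^sup>2 * T" using TJ by (intro mult_left_mono) auto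
    finally show ?thesis .
  qed
  \<comment> \<open>With \<open>a = th ^ 4\<close> and \<open>b = N k ^ 4\<close> each summand is at
    most \<open>2 + 480 * (a * b) + 504 * a\<close>, hence at most
    \<open>504 * (1 + a) * (1 + b)\<close>; and \<open>72 * 504 = 36288\<close>.\<close>
  have err: "72 / \<delta> ^ 3 * (\<Sum>k\<in>J. 2 + (384 * (m k) ^ 4 * (q k)\<^sup>2 + 480 * (q k) ^ 4) + 3 * (v k)\<^sup>2) \<le> 36288 * (1 + th ^ 4) * T / \<delta> ^ 3"
  proof -
    have "(\<Sum>k\<in>J. 2 + (384 * (m k) ^ 4 * (q k)\<^sup>2 + 480 * (q k) ^ 4) + 3 * (v k)\<^sup>2) \<le> (\<Sum>k\<in>J. 504 * (1 + th ^ 4) * (1 + N k ^ 4))"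
    proof (rule sum_mono)
      fix k assume k: "k \<in> J"
      have q2: "(q k)\<^sup>2 \<le> th\<^sup>2" and q4: "(q k) ^ 4 \<le> th ^ 4" using qb[OF k] by (auto intro!: power_mono)
      have "(m k) ^ 4 * (q k)\<^sup>2 \<le> (th\<^sup>2 * N k ^ 4) * th\<^sup>2" using m4b[OF k] q2 by (intro mult_mono) auto
      also have "\<dots> = th ^ 4 * N k ^ 4" by (simp add: power2_eq_square power4_eq_xxxx)
      finally have mq: "(m k) ^ 4 * (q k)\<^sup>2 \<le> th ^ 4 * N k ^ 4" .
      have "0 \<le> N k ^ 4" "0 \<le> th ^ 4" "0 \<le> th ^ 4 * N k ^ 4" by simp_all
      then show "2 + (384 * (m k) ^ 4 * (q k)\<^sup>2 + 480 * (q k) ^ 4) + 3 * (v k)\<^sup>2 \<le> 504 * (1 + th ^ 4) * (1 + N k ^ 4)"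
      proof -
        have "2 + (384 * P + 480 * Q) + 3 * W \<le> 504 * (1 + a) * (1 + b)"
          if "P \<le> a * b" "Q \<le> a" "W \<le> 32 * (a * b) + 8 * a" "0 \<le> a" "0 \<le> b" "0 \<le> a * b" for P Q W a b :: real
        proof -
          have "504 * (1 + a) * (1 + b) = 504 + 504 * a + 504 * b + 504 * (a * b)" by (simp add: algebra_simps)
          then show ?thesis using that by linarith
        qed
        from this[OF mq q4 _ \<open>0 \<le> th ^ 4\<close> \<open>0 \<le> N k ^ 4\<close> \<open>0 \<le> th ^ 4 * N k ^ 4\<close>, of "(v k)\<^sup>2"]
        show ?thesis using vb(2)[OF k] by (simp add: mult.assoc)
      qed
    qed
    also have "\<dots> = 504 * (1 + th ^ 4) * (\<Sum>k\<in>J. 1 + N k ^ 4)" by (simp only: sum_distrib_left)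
    also have "\<dots> \<le> 504 * (1 + th ^ 4) * T" using TJ by (intro mult_left_mono) auto
    finally have "72 / \<delta> ^ 3 * (\<Sum>k\<in>J. 2 + (384 * (m k) ^ 4 * (q k)\<^sup>2 + 480 * (q k) ^ 4) + 3 * (v k)\<^sup>2) \<le> 72 / \<delta> ^ 3 * (504 * (1 + th ^ 4) * T)"
      using \<delta> by (intro mult_left_mono) auto
    moreover have "72 / c * (504 * X * Z) = 36288 * X * Z / c" for c X Z :: real by simp
    ultimately show ?thesis by (simp only:)
  qed
  \<comment> \<open>Each component has mean distance \<open>min th (s k)\<close> plus a fluctuation
    in \<open>(N k)\<^sup>2 - 1\<close>: above the water level \<open>(m k)\<^sup>2 + q k = th +
    th\<^sup>2 / s k * ((N k)\<^sup>2 - 1)\<close>, and below it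
    \<open>s k * (N k)\<^sup>2\<close>.\<close>
  have mean: "Sin + (\<Sum>k\<in>J. (m k)\<^sup>2 + q k) = (\<Sum>k\<in>K. min th (s k)) + (\<Sum>k\<in>K. (if s k > th then th\<^sup>2 / s k else s k) * ((N k)\<^sup>2 - 1))"
  proof -
    have "(\<Sum>k\<in>J. (m k)\<^sup>2 + q k) = (\<Sum>k\<in>J. min th (s k) + (if s k > th then th\<^sup>2 / s k else s k) * ((N k)\<^sup>2 - 1))"
    proof (rule sum.cong[OF refl])
      fix k assume k: "k \<in> J"
      show "(m k)\<^sup>2 + q k = min th (s k) + (if s k > th then th\<^sup>2 / s k else s k) * ((N k)\<^sup>2 - 1)"
        unfolding m2[OF k] using sJ[OF k] by (simp add: q_def power2_eq_square[of th] right_diff_distrib)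
    qed
    moreover have "Sin = (\<Sum>k\<in>K - J. min th (s k) + (if s k > th then th\<^sup>2 / s k else s k) * ((N k)\<^sup>2 - 1))"
      unfolding Sin_def
    proof (rule sum.cong[OF refl])
      fix k assume k: "k \<in> K - J"
      show "s k * (N k)\<^sup>2 = min th (s k) + (if s k > th then th\<^sup>2 / s k else s k) * ((N k)\<^sup>2 - 1)"
        using notJ[OF k] by (simp add: right_diff_distrib)
    qed
    ultimately show ?thesis
      using split[of "\<lambda>k. min th (s k) + (if s k > th then th\<^sup>2 / s k else s k) * ((N k)\<^sup>2 - 1)"] by (simp add: sum.distrib)
  qed
  have r: "\<bar>(D - Sin) - 3 * \<delta> - (\<Sum>k\<in>J. (m k)\<^sup>2 + q k)\<bar> + 3 * \<delta> \<le> R + C + 6 * \<delta>"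
    using mean R C \<delta> by linarith
  let ?N' = "\<lambda>k. normalM (if k \<in> J then (1 - th / s k) * y k else 0) (if k \<in> J then sqrt (th * (1 - th / s k)) else 1)"
  let ?win = "measure (PiM J ?N') {x \<in> space (PiM J ?N'). (D - Sin) - 3 * \<delta> \<le> (\<Sum>k\<in>J. (y k - x k)\<^sup>2) \<and> (\<Sum>k\<in>J. (y k - x k)\<^sup>2) \<le> (D - Sin)}"
  have win: "B \<le> ?win"
  proof -
    have "\<delta> / (sqrt (6 * th\<^sup>2 * T) * sqrt (2 * pi)) * exp (- (R + C + 6 * \<delta>)\<^sup>2 / (2 * V0))
      - 72 / \<delta> ^ 3 * (\<Sum>k\<in>J. 2 + (384 * (m k) ^ 4 * (q k)\<^sup>2 + 480 * (q k) ^ 4) + 3 * (v k)\<^sup>2) \<le> ?win"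
      unfolding m_def q_def v_def
      by (rule codeword_window_prob[OF J(1) Jne th sJ \<delta> V0(1) V0'[unfolded v_def m_def q_def] V1[unfolded v_def m_def q_def] r[unfolded m_def q_def]])
    then show ?thesis using err unfolding B_def by linarith
  qed
  define Q where "Q = (\<Prod>k\<in>J. sqrt (th / s k) * exp (- (y k)\<^sup>2 / (2 * s k)))"
  have Qeq: "Q = exp (- (\<Sum>k\<in>J. 1/2 * ln (s k / th) + 1/2 * (N k)\<^sup>2))"
  proof -
    have "Q = (\<Prod>k\<in>J. exp (- (1/2 * ln (s k / th) + 1/2 * (N k)\<^sup>2)))"
      unfolding Q_def
    proof (rule prod.cong[OF refl])
      fix k assume k: "k \<in> J"
      have sk: "s k > 0" using sJ[OF k] th by linarith
      have "sqrt (th / s k) = exp (- (1/2 * ln (s k / th)))"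
      proof -
        have "exp (- (1/2 * ln (s k / th))) = exp (ln (th / s k) / 2)"
        proof -
          have "ln (th / s k) = - ln (s k / th)" using sk th by (simp add: ln_div)
          then show ?thesis by simp
        qed
        also have "\<dots> = sqrt (th / s k)"
          using sk th by (simp flip: ln_sqrt)
        finally show ?thesis by simp
      qed
      moreover have "- (y k)\<^sup>2 / (2 * s k) = - (1/2 * (N k)\<^sup>2)" using sk by (simp add: y_def power_mult_distrib)
      ultimately show "sqrt (th / s k) * exp (- (y k)\<^sup>2 / (2 * s k)) = exp (- (1/2 * ln (s k / th) + 1/2 * (N k)\<^sup>2))"
        by (simp only: exp_add[symmetric] minus_add_distrib)
    qed
    also have "\<dots> = exp (\<Sum>k\<in>J. - (1/2 * ln (s k / th) + 1/2 * (N k)\<^sup>2))" using J(1) by (rule exp_sum[symmetric])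
    finally show ?thesis by (simp only: sum_negf)
  qed
  \<comment> \<open>The exponent collects the rate, the terms \<open>(N k)\<^sup>2 / 2\<close> from
    \<open>Q\<close> and the distances of the inactive components. Since \<open>D\<close> is within
    \<open>C\<close> of the sum of \<open>min th (s k)\<close>, the last two combine with
    \<open>D\<close> into the centred tilted information.\<close>
  have expo: "exp (- ((\<Sum>k\<in>K. 1/2 * ln (max 1 (s k / th))) + t + (C + 3 * \<delta>) / (2 * th))) \<le> Q * exp ((D - Sin - 3 * \<delta>) / (2 * th))"
  proof -
    have L: "(\<Sum>k\<in>K. 1/2 * ln (max 1 (s k / th))) = (\<Sum>k\<in>J. 1/2 * ln (s k / th))"
    proof -
      have "(\<Sum>k\<in>K - J. 1/2 * ln (max 1 (s k / th))) = 0"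
        using notJ th by (intro sum.neutral ballI) (simp add: max_absorb1)
      moreover have "(\<Sum>k\<in>J. 1/2 * ln (max 1 (s k / th))) = (\<Sum>k\<in>J. 1/2 * ln (s k / th))"
      proof (rule sum.cong[OF refl])
        fix k assume "k \<in> J"
        then have "1 \<le> s k / th" using sJ[of k] th by simp
        then show "1/2 * ln (max 1 (s k / th)) = 1/2 * ln (s k / th)" by (simp add: max_absorb2)
      qed
      ultimately show ?thesis using split[of "\<lambda>k. 1/2 * ln (max 1 (s k / th))"] by simp
    qed
    have A: "(\<Sum>k\<in>K. 1/2 * min 1 (s k / th) * ((N k)\<^sup>2 - 1)) = (\<Sum>k\<in>J. 1/2 * (N k)\<^sup>2) + Sin / (2 * th) - (\<Sum>k\<in>K. min th (s k)) / (2 * th)"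
    proof -
      have "(\<Sum>k\<in>J. 1/2 * min 1 (s k / th) * ((N k)\<^sup>2 - 1)) = (\<Sum>k\<in>J. 1/2 * (N k)\<^sup>2 - min th (s k) / (2 * th))"
      proof (rule sum.cong[OF refl])
        fix k assume "k \<in> J"
        then have "min 1 (s k / th) = 1" "min th (s k) = th" using sJ[of k] th by (auto simp: min_def)
        then show "1/2 * min 1 (s k / th) * ((N k)\<^sup>2 - 1) = 1/2 * (N k)\<^sup>2 - min th (s k) / (2 * th)"
          using th by (simp add: field_simps)
      qed
      moreover have "(\<Sum>k\<in>K - J. 1/2 * min 1 (s k / th) * ((N k)\<^sup>2 - 1)) = (\<Sum>k\<in>K - J. s k * (N k)\<^sup>2 / (2 * th) - min th (s k) / (2 * th))"
      proof (rule sum.cong[OF refl])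
        fix k assume k: "k \<in> K - J"
        then have "min 1 (s k / th) = s k / th" "min th (s k) = s k" using notJ[OF k] th by (auto simp: min_def)
        then show "1/2 * min 1 (s k / th) * ((N k)\<^sup>2 - 1) = s k * (N k)\<^sup>2 / (2 * th) - min th (s k) / (2 * th)"
          using th by (simp add: field_simps)
      qed
      ultimately show ?thesis
        using split[of "\<lambda>k. 1/2 * min 1 (s k / th) * ((N k)\<^sup>2 - 1)"] split[of "\<lambda>k. min th (s k) / (2 * th)"]
        by (simp only: sum_subtractf Sin_def sum_divide_distrib)
    qed
    have "(\<Sum>k\<in>K. min th (s k)) / (2 * th) - D / (2 * th) \<le> C / (2 * th)"
      using C th by (simp only: diff_divide_distrib[symmetric]) (intro divide_right_mono; linarith)
    then have "- ((\<Sum>k\<in>K. 1/2 * ln (max 1 (s k / th))) + t + (C + 3 * \<delta>) / (2 * th))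
       \<le> - (\<Sum>k\<in>J. 1/2 * ln (s k / th) + 1/2 * (N k)\<^sup>2) + (D - Sin - 3 * \<delta>) / (2 * th)"
      using Y unfolding L A sum.distrib add_divide_distrib diff_divide_distrib by linarith
    then show ?thesis unfolding Qeq exp_add[symmetric] by simp
  qed
  have set: "(\<Sum>k\<in>K. (sqrt (s k) * N k - (if k \<in> J then x k else 0))\<^sup>2) \<le> D \<longleftrightarrow> (\<Sum>k\<in>J. (y k - x k)\<^sup>2) \<le> D - Sin" for x
  proof -
    have "(\<Sum>k\<in>J. (sqrt (s k) * N k - (if k \<in> J then x k else 0))\<^sup>2) = (\<Sum>k\<in>J. (y k - x k)\<^sup>2)"
      by (rule sum.cong) (auto simp: y_def)
    moreover have "(\<Sum>k\<in>K - J. (sqrt (s k) * N k - (if k \<in> J then x k else 0))\<^sup>2) = Sin"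
      unfolding Sin_def
    proof (rule sum.cong[OF refl])
      fix k assume k: "k \<in> K - J"
      then have "s k > 0" using s by simp
      then show "(sqrt (s k) * N k - (if k \<in> J then x k else 0))\<^sup>2 = s k * (N k)\<^sup>2"
        using k by (simp add: power_mult_distrib)
    qed
    ultimately show ?thesis using split[of "\<lambda>k. (sqrt (s k) * N k - (if k \<in> J then x k else 0))\<^sup>2"] by linarith
  qed
  have B0: "0 \<le> B" using pos by (simp add: B_def)
  have Q0: "0 \<le> Q" by (simp add: Qeq)
  have "exp (- ((\<Sum>k\<in>K. 1/2 * ln (max 1 (s k / th))) + t + (C + 3 * \<delta>) / (2 * th))) * B
     \<le> Q * exp ((D - Sin - 3 * \<delta>) / (2 * th)) * ?win"
    by (rule mult_mono[OF expo win]) (use Q0 B0 in auto)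
  also have "\<dots> \<le> measure (codeword_measure J th s) {x \<in> space (codeword_measure J th s). (\<Sum>k\<in>J. (y k - x k)\<^sup>2) \<le> D - Sin}"
    unfolding Q_def by (rule codeword_ball_tilted[OF J(1) th sJ])
  finally show ?thesis unfolding set B_def .
qed

section \<open>Decomposition of the source\<close>

text \<open>A normalised linear form in the innovations: the sine vector after the recursion
  operator, divided by its length \<open>sqrt (gspec a (freq n k))\<close>.\<close>

definition white :: "real \<Rightarrow> real \<Rightarrow> (nat \<Rightarrow> 'w \<Rightarrow> real) \<Rightarrow> nat \<Rightarrow> nat \<Rightarrow> 'w \<Rightarrow> real" where
  "white a \<sigma> Z n k \<omega> = (\<Sum>i\<in>{1..n}. (sine_basis n k i - a * sine_basis n k (i - 1)) / sqrt (gspec a (freq n k)) * Z i \<omega>) / \<sigma>"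

text \<open>The Gram matrix of the coefficient rows comes from \<open>sine_basis_innovations\<close>
  with a sine vector in place of \<open>U\<close>: the end term vanishes and the eigenvalue cancels
  the normalisation.\<close>

lemma white_indep:
  assumes "prob_space M" "a > 1" "\<sigma> > 0" and Z: "prob_space.indep_vars M (\<lambda>_. borel) Z {1..}"
    "\<And>i. i \<ge> 1 \<Longrightarrow> distributed M lborel (Z i) (normal_density 0 \<sigma>)" and n: "n \<ge> 2"
  shows "prob_space.indep_vars M (\<lambda>_. borel) (white a \<sigma> Z n) {1..<n}"
    "\<And>k. k \<in> {1..<n} \<Longrightarrow> distr M borel (white a \<sigma> Z n k) = stdN"
proof -
  interpret prob_space M by fact
  let ?q = "\<lambda>k i. (sine_basis n k i - a * sine_basis n k (i - 1)) / sqrt (gspec a (freq n k))"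
  have g: "gspec a w > 0" for w by (rule gspec_bounds(3)) fact
  have orth: "(\<Sum>i\<in>{1..n}. ?q j i * ?q k i) = (if j = k then 1 else 0)" if "j \<in> {1..<n}" "k \<in> {1..<n}" for j k
  proof -
    have "(\<Sum>i\<in>{1..n}. ?q j i * ?q k i) = (\<Sum>i\<in>{1..n}. (sine_basis n j i - a * sine_basis n j (i - 1)) * (sine_basis n k i - a * sine_basis n k (i - 1)))
       / (sqrt (gspec a (freq n j)) * sqrt (gspec a (freq n k)))"
      by (simp add: sum_divide_distrib)
    also have "(\<Sum>i\<in>{1..n}. (sine_basis n j i - a * sine_basis n j (i - 1)) * (sine_basis n k i - a * sine_basis n k (i - 1)))
      = gspec a (freq n j) * (if j = k then 1 else 0)"
      using sine_basis_innovations[of n "sine_basis n k" j a] sine_basis_orthonormal[OF that] n by simp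
    finally show ?thesis using g[of "freq n k"] by (cases "j = k") (simp_all add: power2_eq_square[symmetric])
  qed
  have ind: "indep_vars (\<lambda>_. borel) Z {1..n}" by (rule indep_vars_subset[OF Z(1)]) auto
  have J: "finite {1..<n}" "{1..<n} \<noteq> {}" using n by auto
  note * = indep_orthonormal_combinations[OF _ ind \<open>\<sigma> > 0\<close> _ J orth]
  show "indep_vars (\<lambda>_. borel) (white a \<sigma> Z n) {1..<n}"
    unfolding white_def[abs_def] by (rule *(1)) (use Z in auto)
  show "\<And>k. k \<in> {1..<n} \<Longrightarrow> distr M borel (white a \<sigma> Z n k) = stdN"
    unfolding white_def[abs_def] by (rule *(2)) (use Z in auto)
qed

text \<open>The response of the \<open>k\<close>-th sine coefficient to the final state, i.e. the
  boundary term divided by the eigenvalue.\<close>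

definition end_coeff :: "real \<Rightarrow> nat \<Rightarrow> nat \<Rightarrow> real" where
  "end_coeff a n k = a * sine_basis n k (n - 1) / gspec a (freq n k)"

text \<open>A pathwise identity: with \<open>Z i = U i - a * U (i - 1)\<close>,
  \<open>sine_basis_innovations\<close> is solved for the sine coefficient.\<close>

lemma source_coefficient:
  assumes a: "a > 1" and \<sigma>: "\<sigma> > 0" and n: "n \<ge> 2"
  shows "(\<Sum>i\<in>{1..<n}. sine_basis n k i * GM a Z i \<omega>)
    = sqrt (svar a (\<sigma>\<^sup>2) (freq n k)) * white a \<sigma> Z n k \<omega> + end_coeff a n k * GM a Z n \<omega>"
proof -
  let ?g = "gspec a (freq n k)"
  have g: "?g > 0" by (rule gspec_bounds(3)[OF a])
  have sg: "sqrt ?g * sqrt ?g = ?g" using g by simp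
  have w: "white a \<sigma> Z n k \<omega> * (\<sigma> * sqrt ?g) = (\<Sum>i=1..n. (sine_basis n k i - a * sine_basis n k (i-1)) * Z i \<omega>)"
  proof -
    have "white a \<sigma> Z n k \<omega> = (\<Sum>i=1..n. (sine_basis n k i - a * sine_basis n k (i-1)) * Z i \<omega>) / sqrt ?g / \<sigma>"
      unfolding white_def by (simp add: sum_divide_distrib)
    then show ?thesis using \<sigma> g by simp
  qed
  have "(\<Sum>i=1..n. (sine_basis n k i - a * sine_basis n k (i-1)) * Z i \<omega>)
    = (\<Sum>i=1..n. (sine_basis n k i - a * sine_basis n k (i-1)) * (GM a Z i \<omega> - a * GM a Z (i-1) \<omega>))"
  proof (rule sum.cong[OF refl])
    fix i assume "i \<in> {1..n}"
    then obtain j where "i = Suc j" by (cases i) auto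
    then show "(sine_basis n k i - a * sine_basis n k (i-1)) * Z i \<omega>
      = (sine_basis n k i - a * sine_basis n k (i-1)) * (GM a Z i \<omega> - a * GM a Z (i-1) \<omega>)" by simp
  qed
  also have "\<dots> = ?g * (\<Sum>i\<in>{1..<n}. sine_basis n k i * GM a Z i \<omega>) - a * sine_basis n k (n-1) * GM a Z n \<omega>"
    by (rule sine_basis_innovations) (use n in auto)
  finally have e: "white a \<sigma> Z n k \<omega> * (\<sigma> * sqrt ?g) = ?g * (\<Sum>i\<in>{1..<n}. sine_basis n k i * GM a Z i \<omega>) - a * sine_basis n k (n-1) * GM a Z n \<omega>"
    using w by simp
  have "sqrt (svar a (\<sigma>\<^sup>2) (freq n k)) = \<sigma> / sqrt ?g" using \<sigma> by (simp add: svar_def real_sqrt_divide)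
  also have "\<dots> = \<sigma> * sqrt ?g / ?g" using g by (simp add: field_simps)
  finally have "sqrt (svar a (\<sigma>\<^sup>2) (freq n k)) * white a \<sigma> Z n k \<omega> + end_coeff a n k * GM a Z n \<omega>
    = (white a \<sigma> Z n k \<omega> * (\<sigma> * sqrt ?g) + a * sine_basis n k (n-1) * GM a Z n \<omega>) / ?g"
    by (simp add: end_coeff_def add_divide_distrib)
  also have "\<dots> = (\<Sum>i\<in>{1..<n}. sine_basis n k i * GM a Z i \<omega>)" unfolding e using g by simp
  finally show ?thesis by simp
qed

text \<open>The last row of the orthonormal sine matrix has unit length and the eigenvalues are at
  least \<open>(a - 1)\<^sup>2\<close>. The bound is uniform in \<open>n\<close>, so an error in the
  final state is not amplified.\<close>

lemma end_coeff_bound: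
  assumes a: "a > 1" and n: "n \<ge> 2"
  shows "(\<Sum>k\<in>{1..<n}. (end_coeff a n k)\<^sup>2) \<le> a\<^sup>2 / (a - 1) ^ 4"
proof -
  have "(\<Sum>k\<in>{1..<n}. (end_coeff a n k)\<^sup>2) \<le> (\<Sum>k\<in>{1..<n}. a\<^sup>2 / (a - 1) ^ 4 * (sine_basis n (n-1) k * sine_basis n (n-1) k))"
  proof (rule sum_mono)
    fix k
    have g: "(a - 1)\<^sup>2 \<le> gspec a (freq n k)" "gspec a (freq n k) > 0" using gspec_bounds[OF a] by auto
    have "((a - 1)\<^sup>2)\<^sup>2 \<le> (gspec a (freq n k))\<^sup>2" using g by (intro power_mono) auto
    then have g4: "(a - 1) ^ 4 \<le> (gspec a (freq n k))\<^sup>2" by (simp flip: power_mult)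
    have "(end_coeff a n k)\<^sup>2 = a\<^sup>2 * (sine_basis n k (n-1))\<^sup>2 / (gspec a (freq n k))\<^sup>2"
      by (simp add: end_coeff_def power_mult_distrib power_divide)
    also have "\<dots> \<le> a\<^sup>2 * (sine_basis n k (n-1))\<^sup>2 / (a - 1) ^ 4"
      using g4 g a by (intro divide_left_mono) auto
    finally show "(end_coeff a n k)\<^sup>2 \<le> a\<^sup>2 / (a - 1) ^ 4 * (sine_basis n (n-1) k * sine_basis n (n-1) k)"
      unfolding sine_basis_commute[of n "n-1" k] by (simp add: power2_eq_square)
  qed
  also have "\<dots> = a\<^sup>2 / (a - 1) ^ 4 * (\<Sum>k\<in>{1..<n}. sine_basis n (n-1) k * sine_basis n (n-1) k)" by (simp only: sum_distrib_left)
  also have "\<dots> = a\<^sup>2 / (a - 1) ^ 4" using n by (subst sine_basis_orthonormal) auto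
  finally show ?thesis .
qed

text \<open>The guess \<open>u\<close> serves twice: as the reproduction at time \<open>n\<close>
  and, through \<open>end_coeff\<close>, as the correction of every sine coefficient of the
  past.\<close>

definition decode :: "real \<Rightarrow> nat \<Rightarrow> real \<Rightarrow> (nat \<Rightarrow> real) \<Rightarrow> nat \<Rightarrow> real" where
  "decode a n u yh i = (if i = n then u else \<Sum>k\<in>{1..<n}. (yh k + end_coeff a n k * u) * sine_basis n k i)"

text \<open>Parseval reduces the error to the coefficient errors \<open>A k\<close> plus
  \<open>e k * \<eta>\<close>. The slack \<open>d + 2 * c + 1\<close> in the hypothesis pays for the
  factor \<open>1 + 1 / n\<close> on the first (at most \<open>d\<close>), for the end-point effect
  (at most \<open>2 * c\<close>), and for the error at time \<open>n\<close> (at most 1).\<close>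

lemma decode_distortion:
  fixes yh :: "nat \<Rightarrow> real"
  assumes a: "a > 1" and \<sigma>: "\<sigma> > 0" and n: "n \<ge> 2" and d: "d > 0"
    and u: "\<bar>GM a Z n \<omega> - u\<bar> \<le> 1 / real n"
    and A: "(\<Sum>k\<in>{1..<n}. (sqrt (svar a (\<sigma>\<^sup>2) (freq n k)) * white a \<sigma> Z n k \<omega> - yh k)\<^sup>2) \<le> real n * d - (d + 2 * (a\<^sup>2 / (a - 1) ^ 4) + 1)"
  shows "distortion n (\<lambda>i. GM a Z i \<omega>) (decode a n u yh) \<le> d"
proof -
  define A where "A k = sqrt (svar a (\<sigma>\<^sup>2) (freq n k)) * white a \<sigma> Z n k \<omega> - yh k" for k
  define e where "e k = end_coeff a n k" for k
  define \<eta> where "\<eta> = GM a Z n \<omega> - u"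
  define c where "c = a\<^sup>2 / (a - 1) ^ 4"
  have c: "0 \<le> c" by (simp add: c_def)
  let ?U = "\<lambda>i. GM a Z i \<omega>"
  have diff: "?U i - decode a n u yh i = (\<Sum>k\<in>{1..<n}. (A k + e k * \<eta>) * sine_basis n k i)" if i: "i \<in> {1..<n}" for i
  proof -
    have "?U i = (\<Sum>k\<in>{1..<n}. sine_basis n k i * (\<Sum>j\<in>{1..<n}. sine_basis n k j * ?U j))"
      by (rule sine_basis_expand[OF i, symmetric])
    also have "\<dots> = (\<Sum>k\<in>{1..<n}. sine_basis n k i * (sqrt (svar a (\<sigma>\<^sup>2) (freq n k)) * white a \<sigma> Z n k \<omega> + e k * ?U n))"
      unfolding source_coefficient[OF a \<sigma> n] e_def ..
    finally have "?U i - decode a n u yh i = (\<Sum>k\<in>{1..<n}. sine_basis n k i * (sqrt (svar a (\<sigma>\<^sup>2) (freq n k)) * white a \<sigma> Z n k \<omega> + e k * ?U n)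
      - (yh k + e k * u) * sine_basis n k i)"
      using i by (simp add: decode_def e_def sum_subtractf)
    also have "\<dots> = (\<Sum>k\<in>{1..<n}. (A k + e k * \<eta>) * sine_basis n k i)"
      by (intro sum.cong refl) (simp add: A_def \<eta>_def algebra_simps)
    finally show ?thesis .
  qed
  have "{1..n} = insert n {1..<n}" using n by auto
  then have "(\<Sum>i=1..n. (?U i - decode a n u yh i)\<^sup>2) = \<eta>\<^sup>2 + (\<Sum>i\<in>{1..<n}. (?U i - decode a n u yh i)\<^sup>2)"
    by (simp add: decode_def \<eta>_def)
  also have "(\<Sum>i\<in>{1..<n}. (?U i - decode a n u yh i)\<^sup>2) = (\<Sum>i\<in>{1..<n}. (\<Sum>k\<in>{1..<n}. (A k + e k * \<eta>) * sine_basis n k i)\<^sup>2)"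
    by (intro sum.cong refl) (simp only: diff)
  also have "\<dots> = (\<Sum>k\<in>{1..<n}. (A k + e k * \<eta>)\<^sup>2)" by (rule sine_basis_Parseval)
  \<comment> \<open>Young's inequality with weight \<open>1 / n\<close>: since
    \<open>\<eta>\<^sup>2 \<le> 1 / n\<^sup>2\<close>, both extra terms stay bounded after
    summation.\<close>
  also have "\<dots> \<le> (\<Sum>k\<in>{1..<n}. (1 + 1 / real n) * (A k)\<^sup>2 + (1 + real n) * \<eta>\<^sup>2 * (e k)\<^sup>2)"
  proof (rule sum_mono)
    fix k
    have "0 \<le> (A k / sqrt (real n) - sqrt (real n) * (e k * \<eta>))\<^sup>2" by simp
    also have "\<dots> = (A k)\<^sup>2 / real n - 2 * A k * (e k * \<eta>) + real n * (e k * \<eta>)\<^sup>2"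
      using n by (simp add: power2_diff power_divide power_mult_distrib)
    finally show "(A k + e k * \<eta>)\<^sup>2 \<le> (1 + 1 / real n) * (A k)\<^sup>2 + (1 + real n) * \<eta>\<^sup>2 * (e k)\<^sup>2"
      by (simp add: power2_sum power_mult_distrib algebra_simps)
  qed
  also have "\<dots> = (1 + 1 / real n) * (\<Sum>k\<in>{1..<n}. (A k)\<^sup>2) + (1 + real n) * \<eta>\<^sup>2 * (\<Sum>k\<in>{1..<n}. (e k)\<^sup>2)"
    by (simp only: sum.distrib sum_distrib_left)
  finally have 1: "(\<Sum>i=1..n. (?U i - decode a n u yh i)\<^sup>2) \<le> \<eta>\<^sup>2 + ((1 + 1 / real n) * (\<Sum>k\<in>{1..<n}. (A k)\<^sup>2) + (1 + real n) * \<eta>\<^sup>2 * (\<Sum>k\<in>{1..<n}. (e k)\<^sup>2))"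
    by simp
  have A': "(\<Sum>k\<in>{1..<n}. (A k)\<^sup>2) \<le> real n * d - (d + 2 * c + 1)" using A by (simp add: A_def c_def)
  have A2: "(1 / real n) * (\<Sum>k\<in>{1..<n}. (A k)\<^sup>2) \<le> d"
  proof -
    have "(\<Sum>k\<in>{1..<n}. (A k)\<^sup>2) \<le> real n * d" using A' d c by linarith
    then show ?thesis using n by (simp add: field_simps)
  qed
  have \<eta>: "\<eta>\<^sup>2 \<le> 1 / (real n)\<^sup>2"
    using u power_mono[of "\<bar>\<eta>\<bar>" "1 / real n" 2] by (simp add: \<eta>_def power_divide)
  have \<eta>1: "\<eta>\<^sup>2 \<le> 1" "(1 + real n) * \<eta>\<^sup>2 \<le> 2"
  proof -
    have nn: "real n \<ge> 2" using n by simp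
    then have n2: "(real n)\<^sup>2 \<ge> 1 + real n" using mult_left_mono[of 2 "real n" "real n"] unfolding power2_eq_square by linarith
    have "1 / (real n)\<^sup>2 \<le> 1" using n2 nn by simp
    then show "\<eta>\<^sup>2 \<le> 1" using \<eta> by linarith
    have "(1 + real n) * \<eta>\<^sup>2 \<le> (1 + real n) * (1 / (real n)\<^sup>2)" using \<eta> by (intro mult_left_mono) auto
    also have "\<dots> \<le> 1" using n2 nn by simp
    finally show "(1 + real n) * \<eta>\<^sup>2 \<le> 2" by simp
  qed
  have ec: "(\<Sum>k\<in>{1..<n}. (e k)\<^sup>2) \<le> c" unfolding e_def c_def by (rule end_coeff_bound[OF a n])
  have e0: "0 \<le> (\<Sum>k\<in>{1..<n}. (e k)\<^sup>2)" by (rule sum_nonneg) simp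
  have "(1 + real n) * \<eta>\<^sup>2 * (\<Sum>k\<in>{1..<n}. (e k)\<^sup>2) \<le> 2 * c" by (rule mult_mono[OF \<eta>1(2) ec _ e0]) simp
  then have "(\<Sum>i=1..n. (?U i - decode a n u yh i)\<^sup>2) \<le> real n * d"
    using 1 A' A2 \<eta>1(1) by (simp add: distrib_right)
  then show ?thesis using n unfolding distortion_def by (simp add: field_simps)
qed

lemma GM_measurable:
  assumes "\<And>i. i \<ge> 1 \<Longrightarrow> Z i \<in> borel_measurable M"
  shows "GM a Z n \<in> borel_measurable M"
proof (induction n)
  case 0
  have "GM a Z 0 = (\<lambda>_. 0)" by auto
  then show ?case by simp
next
  case (Suc n)
  have "GM a Z (Suc n) = (\<lambda>\<omega>. a * GM a Z n \<omega> + Z (Suc n) \<omega>)" by auto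
  then show ?case using Suc assms[of "Suc n"] by simp
qed

text \<open>The recursion gives a first moment of at most
  \<open>\<sigma> * (a ^ n - 1) / (a - 1)\<close>, and Markov does the rest. The extra factor
  \<open>n\<close> in the threshold makes the probability \<open>O(1 / n)\<close> and costs only
  \<open>ln n\<close> nats in the range to be guessed.\<close>

lemma (in prob_space) GM_tail:
  assumes a: "a > 1" and \<sigma>: "\<sigma> > 0"
    and Z: "\<And>i. i \<ge> 1 \<Longrightarrow> distributed M lborel (Z i) (normal_density 0 \<sigma>)" and n: "n > 0"
  shows "prob {\<omega> \<in> space M. \<bar>GM a Z n \<omega>\<bar> > real n * a ^ n} \<le> \<sigma> / (a - 1) / real n"
proof -
  have Zm: "Z i \<in> borel_measurable M" if "i \<ge> 1" for i using Z[OF that, THEN distributed_measurable] by simp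
  have Um [measurable]: "GM a Z m \<in> borel_measurable M" for m by (rule GM_measurable) (rule Zm)
  have Z2: "integrable M (\<lambda>\<omega>. (Z i \<omega>)\<^sup>2)" "expectation (\<lambda>\<omega>. (Z i \<omega>)\<^sup>2) = \<sigma>\<^sup>2" if "i \<ge> 1" for i
  proof -
    have "expectation (Z i) = 0" by (rule normal_distributed_expectation[OF \<sigma> Z[OF that]])
    then show "expectation (\<lambda>\<omega>. (Z i \<omega>)\<^sup>2) = \<sigma>\<^sup>2" using normal_distributed_variance[OF \<sigma> Z[OF that]] by simp
    show "integrable M (\<lambda>\<omega>. (Z i \<omega>)\<^sup>2)"
      using distributed_integrable[OF Z[OF that], of "\<lambda>x. x\<^sup>2"] integrable_normal_moment[OF \<sigma>, of 0 2] by simp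
  qed
  have Zi: "integrable M (\<lambda>\<omega>. \<bar>Z i \<omega>\<bar>)" "expectation (\<lambda>\<omega>. \<bar>Z i \<omega>\<bar>) \<le> \<sigma>" if "i \<ge> 1" for i
  proof -
    \<comment> \<open>The arithmetic-geometric mean inequality bounds the mean of
      \<open>\<bar>Z i\<bar>\<close> by \<open>\<sigma>\<close> through the variance alone.\<close>
    have le: "\<bar>z\<bar> \<le> \<sigma> / 2 + z\<^sup>2 / (2 * \<sigma>)" for z :: real
    proof -
      have "0 \<le> (\<bar>z\<bar> - \<sigma>)\<^sup>2" by simp
      then have "2 * \<sigma> * \<bar>z\<bar> \<le> \<sigma>\<^sup>2 + z\<^sup>2" by (simp add: power2_diff mult_ac)
      then show ?thesis using \<sigma> by (simp add: field_simps power2_eq_square)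
    qed
    have i: "integrable M (\<lambda>\<omega>. \<sigma> / 2 + (Z i \<omega>)\<^sup>2 / (2 * \<sigma>))" using Z2[OF that] by simp
    show j: "integrable M (\<lambda>\<omega>. \<bar>Z i \<omega>\<bar>)"
      by (rule Bochner_Integration.integrable_bound[OF i])
         (use le Zm[OF that] in \<open>auto intro!: AE_I2 order_trans[OF _ abs_ge_self]\<close>)
    have "expectation (\<lambda>\<omega>. \<bar>Z i \<omega>\<bar>) \<le> expectation (\<lambda>\<omega>. \<sigma> / 2 + (Z i \<omega>)\<^sup>2 / (2 * \<sigma>))"
      by (rule integral_mono[OF j i le])
    also have "\<dots> = \<sigma>" using Z2[OF that] \<sigma> by (simp add: prob_space power2_eq_square)
    finally show "expectation (\<lambda>\<omega>. \<bar>Z i \<omega>\<bar>) \<le> \<sigma>" .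
  qed
  have U: "integrable M (\<lambda>\<omega>. \<bar>GM a Z m \<omega>\<bar>) \<and> expectation (\<lambda>\<omega>. \<bar>GM a Z m \<omega>\<bar>) \<le> \<sigma> / (a - 1) * (a ^ m - 1)" for m
  proof (induction m)
    case (Suc m)
    have i: "integrable M (\<lambda>\<omega>. a * \<bar>GM a Z m \<omega>\<bar> + \<bar>Z (Suc m) \<omega>\<bar>)" using Suc Zi[of "Suc m"] by simp
    have le: "\<bar>GM a Z (Suc m) \<omega>\<bar> \<le> a * \<bar>GM a Z m \<omega>\<bar> + \<bar>Z (Suc m) \<omega>\<bar>" for \<omega>
      using a abs_triangle_ineq[of "a * GM a Z m \<omega>" "Z (Suc m) \<omega>"] by (simp add: abs_mult)
    have j: "integrable M (\<lambda>\<omega>. \<bar>GM a Z (Suc m) \<omega>\<bar>)"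
      by (rule Bochner_Integration.integrable_bound[OF i])
         (use le Um[of "Suc m"] in \<open>auto intro!: AE_I2 order_trans[OF _ abs_ge_self] simp del: GM.simps\<close>)
    have "expectation (\<lambda>\<omega>. \<bar>GM a Z (Suc m) \<omega>\<bar>) \<le> expectation (\<lambda>\<omega>. a * \<bar>GM a Z m \<omega>\<bar> + \<bar>Z (Suc m) \<omega>\<bar>)"
      by (rule integral_mono[OF j i le])
    also have "\<dots> = a * expectation (\<lambda>\<omega>. \<bar>GM a Z m \<omega>\<bar>) + expectation (\<lambda>\<omega>. \<bar>Z (Suc m) \<omega>\<bar>)"
      using Suc Zi[of "Suc m"] by simp
    also have "\<dots> \<le> a * (\<sigma> / (a - 1) * (a ^ m - 1)) + \<sigma>"
      using Suc Zi[of "Suc m"] a by (intro add_mono mult_left_mono) auto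
    also have "\<dots> = \<sigma> / (a - 1) * (a ^ Suc m - 1)" using a by (simp add: field_simps)
    finally show ?case using j by simp
  qed simp
  have pos: "0 < real n * a ^ n" using n a by simp
  have "emeasure M {\<omega> \<in> space M. \<bar>GM a Z n \<omega>\<bar> \<ge> real n * a ^ n} \<le> ennreal (1 / (real n * a ^ n) * expectation (\<lambda>\<omega>. \<bar>GM a Z n \<omega>\<bar>))"
    using integral_Markov_inequality[of M "\<lambda>\<omega>. \<bar>GM a Z n \<omega>\<bar>" "real n * a ^ n"] U[of n] pos by simp
  then have "prob {\<omega> \<in> space M. \<bar>GM a Z n \<omega>\<bar> \<ge> real n * a ^ n} \<le> 1 / (real n * a ^ n) * expectation (\<lambda>\<omega>. \<bar>GM a Z n \<omega>\<bar>)"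
    using pos by (simp add: emeasure_eq_measure ennreal_le_iff)
  moreover have "prob {\<omega> \<in> space M. \<bar>GM a Z n \<omega>\<bar> > real n * a ^ n} \<le> prob {\<omega> \<in> space M. \<bar>GM a Z n \<omega>\<bar> \<ge> real n * a ^ n}"
    by (rule finite_measure_mono) auto
  moreover have "1 / (real n * a ^ n) * expectation (\<lambda>\<omega>. \<bar>GM a Z n \<omega>\<bar>) \<le> 1 / (real n * a ^ n) * (\<sigma> / (a - 1) * a ^ n)"
  proof (rule mult_left_mono)
    have "\<sigma> / (a - 1) * (a ^ n - 1) \<le> \<sigma> / (a - 1) * a ^ n" using a \<sigma> by (intro mult_left_mono) auto
    then show "expectation (\<lambda>\<omega>. \<bar>GM a Z n \<omega>\<bar>) \<le> \<sigma> / (a - 1) * a ^ n" using U[of n] by linarith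
  qed (use pos in simp)
  moreover have "1 / (real n * a ^ n) * (\<sigma> / (a - 1) * a ^ n) = \<sigma> / (a - 1) / real n" using a n by simp
  ultimately show ?thesis by linarith
qed

section \<open>Typical sources\<close>

lemma sum_zero_mean_second_moment:
  fixes X :: "'i \<Rightarrow> 'a \<Rightarrow> real"
  assumes "finite F" "prob_space M"
  shows "\<lbrakk>prob_space.indep_vars M (\<lambda>_. borel) X F; \<And>i. i \<in> F \<Longrightarrow> integrable M (\<lambda>\<omega>. (X i \<omega>)\<^sup>2); \<And>i. i \<in> F \<Longrightarrow> integrable M (X i);
    \<And>i. i \<in> F \<Longrightarrow> (LINT \<omega>|M. X i \<omega>) = 0\<rbrakk>
   \<Longrightarrow> integrable M (\<lambda>\<omega>. \<Sum>i\<in>F. X i \<omega>) \<and> (LINT \<omega>|M. (\<Sum>i\<in>F. X i \<omega>)) = 0 \<and> integrable M (\<lambda>\<omega>. (\<Sum>i\<in>F. X i \<omega>)\<^sup>2) \<and>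
     (LINT \<omega>|M. (\<Sum>i\<in>F. X i \<omega>)\<^sup>2) = (\<Sum>i\<in>F. (LINT \<omega>|M. (X i \<omega>)\<^sup>2))"
  using assms(1)
proof (induction F rule: finite_induct)
  case (insert j F)
  interpret prob_space M by fact
  have ind: "indep_vars (\<lambda>_. borel) X F" by (rule indep_vars_subset[OF insert.prems(1)]) auto
  note IH = insert.IH[OF ind insert.prems(2-4)]
  define S where "S \<omega> = (\<Sum>i\<in>F. X i \<omega>)" for \<omega>
  have S: "integrable M S" "(LINT \<omega>|M. S \<omega>) = 0" "integrable M (\<lambda>\<omega>. (S \<omega>)\<^sup>2)" "(LINT \<omega>|M. (S \<omega>)\<^sup>2) = (\<Sum>i\<in>F. (LINT \<omega>|M. (X i \<omega>)\<^sup>2))"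
    using IH by (auto simp: S_def[abs_def])
  have iv: "indep_var borel (X j) borel S"
    unfolding S_def by (rule indep_vars_sum) (use insert in auto)
  have Xj: "integrable M (X j)" "integrable M (\<lambda>\<omega>. (X j \<omega>)\<^sup>2)" "(LINT \<omega>|M. X j \<omega>) = 0" using insert.prems by auto
  have prod: "integrable M (\<lambda>\<omega>. X j \<omega> * S \<omega>)" "(LINT \<omega>|M. X j \<omega> * S \<omega>) = 0"
    using indep_var_integrable[OF iv Xj(1) S(1)] indep_var_lebesgue_integral[OF iv Xj(1) S(1)] S Xj by auto
  have e: "(\<Sum>i\<in>insert j F. X i \<omega>) = X j \<omega> + S \<omega>" for \<omega> using insert.hyps by (simp add: S_def)
  have e2: "(X j \<omega> + S \<omega>)\<^sup>2 = (X j \<omega>)\<^sup>2 + (S \<omega>)\<^sup>2 + 2 * (X j \<omega> * S \<omega>)" for \<omega> by (simp add: power2_sum)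
  show ?case unfolding e e2 using S Xj prod insert.hyps by simp
qed simp

lemma (in prob_space) std_normal_transfer:
  assumes N: "distr M borel N = stdN" "N \<in> borel_measurable M" and [measurable]: "\<phi> \<in> borel_measurable borel"
  shows "expectation (\<lambda>\<omega>. \<phi> (N \<omega>)) = (LINT g|stdN. (\<phi> g :: real))"
    "integrable M (\<lambda>\<omega>. \<phi> (N \<omega>)) \<longleftrightarrow> integrable stdN \<phi>"
proof -
  show "expectation (\<lambda>\<omega>. \<phi> (N \<omega>)) = (LINT g|stdN. \<phi> g)"
    using integral_distr[OF N(2), of \<phi>] unfolding N(1) by simp
  show "integrable M (\<lambda>\<omega>. \<phi> (N \<omega>)) \<longleftrightarrow> integrable stdN \<phi>"
    using integrable_distr_eq[OF N(2), of \<phi>] unfolding N(1) by simp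
qed

lemma chi_integrable: "integrable stdN (\<lambda>g. g\<^sup>2 - 1)" "integrable stdN (\<lambda>g. (g\<^sup>2 - 1)\<^sup>2)"
proof -
  interpret N: real_distribution stdN by (rule real_dist_normal_dist)
  note I = integrable_std_normal_distribution_moment
  show "integrable stdN (\<lambda>g. g\<^sup>2 - 1)" using I[of 2] by simp
  have e2: "(g\<^sup>2 - 1)\<^sup>2 = g ^ 4 - 2 * g\<^sup>2 + 1" for g :: real
    by (simp add: eval_nat_numeral algebra_simps)
  show "integrable stdN (\<lambda>g. (g\<^sup>2 - 1)\<^sup>2)" unfolding e2 using I[of 2] I[of 4] by simp
qed

context prob_space
begin

context
  fixes N :: "nat \<Rightarrow> 'a \<Rightarrow> real" and K :: "nat set"
  assumes K: "finite K" and ind: "indep_vars (\<lambda>_. borel) N K" and std: "\<And>k. k \<in> K \<Longrightarrow> distr M borel (N k) = stdN"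
begin

lemma chi_measurable: "k \<in> K \<Longrightarrow> N k \<in> borel_measurable M"
  using ind unfolding indep_vars_def by auto

text \<open>For the tilted information. The variance per term is
  \<open>(c k)\<^sup>2 / 4 * 2\<close>, the fourth moment at most \<open>60 / 16 \<le> 4\<close>,
  and the Lindeberg summand at most \<open>2 + 4 + 3 / 4 \<le> 7\<close>.\<close>

lemma chi_sum_tail:
  assumes c: "\<And>k. k \<in> K \<Longrightarrow> 0 \<le> c k \<and> c k \<le> 1" and \<delta>: "\<delta> > 0"
  shows "prob {\<omega> \<in> space M. (\<Sum>k\<in>K. 1/2 * c k * ((N k \<omega>)\<^sup>2 - 1)) \<ge> t}
    \<le> measure stdN {g. sqrt (\<Sum>k\<in>K. 1/2 * (c k)\<^sup>2) * g > t - \<delta>} + 36 / \<delta> ^ 3 * (7 * real (card K))"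
proof -
  define X where "X k \<omega> = 1/2 * c k * ((N k \<omega>)\<^sup>2 - 1)" for k \<omega>
  have iX: "indep_vars (\<lambda>_. borel) X K"
    unfolding X_def[abs_def] by (rule indep_vars_compose2[OF ind]) measurable
  note tr = std_normal_transfer[OF std chi_measurable]
  have "prob {\<omega> \<in> space M. (\<Sum>k\<in>K. X k \<omega>) \<ge> t}
    \<le> measure stdN {g. sqrt (\<Sum>k\<in>K. 1/2 * (c k)\<^sup>2) * g > t - \<delta>} + 36 / \<delta> ^ 3 * (\<Sum>k\<in>K. 2 + 4 + 3 * (1/2 * (c k)\<^sup>2)\<^sup>2)"
  proof (rule Lindeberg_tail[OF K iX _ _ _ _ \<delta>])
    fix k assume k: "k \<in> K"
    have p4: "(X k \<omega>) ^ 4 = (c k ^ 4 / 16) * ((N k \<omega>)\<^sup>2 - 1) ^ 4" for \<omega>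
      by (simp add: X_def power_mult_distrib power_divide)
    have p2: "(X k \<omega>)\<^sup>2 = ((c k)\<^sup>2 / 4) * ((N k \<omega>)\<^sup>2 - 1)\<^sup>2" for \<omega>
      by (simp add: X_def power_mult_distrib power_divide)
    show "integrable M (\<lambda>\<omega>. X k \<omega> ^ 4)"
      unfolding p4 using tr(2)[OF k k, of "\<lambda>g. (g\<^sup>2 - 1) ^ 4"] chi_moments(1) by (intro integrable_mult_right) simp
    show "expectation (X k) = 0"
      using tr(1)[OF k k, of "\<lambda>g. g\<^sup>2 - 1"] chi_moments(2) by (simp add: X_def[abs_def])
    show "expectation (\<lambda>\<omega>. (X k \<omega>)\<^sup>2) = 1/2 * (c k)\<^sup>2"
      unfolding p2 using tr(1)[OF k k, of "\<lambda>g. (g\<^sup>2 - 1)\<^sup>2"] chi_moments(3) by simp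
    have "c k ^ 4 \<le> 1" using c[OF k] by (simp add: power_le_one)
    then show "expectation (\<lambda>\<omega>. X k \<omega> ^ 4) \<le> 4"
      unfolding p4 using tr(1)[OF k k, of "\<lambda>g. (g\<^sup>2 - 1) ^ 4"] chi_moments(4) by simp
  qed
  also have "(\<Sum>k\<in>K. 2 + 4 + 3 * (1/2 * (c k)\<^sup>2)\<^sup>2) \<le> (\<Sum>k\<in>K. 7)"
  proof (rule sum_mono)
    fix k assume k: "k \<in> K"
    have "c k ^ 4 \<le> 1" using c[OF k] by (simp add: power_le_one)
    moreover have "(1/2 * (c k)\<^sup>2)\<^sup>2 = c k ^ 4 / 4" by (simp add: power_mult_distrib power_divide flip: power_mult)
    ultimately show "2 + 4 + 3 * (1/2 * (c k)\<^sup>2)\<^sup>2 \<le> 7" by simp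
  qed
  finally show ?thesis using \<delta> by (simp add: X_def mult_left_mono divide_right_mono mult.commute)
qed

text \<open>For the fluctuation of the conditional mean distance, whose coefficients are
  \<open>th\<^sup>2 / s k\<close> above and \<open>s k\<close> below the water level, hence at most
  \<open>th\<close>.\<close>

lemma chi_sum_Chebyshev:
  assumes b: "\<And>k. k \<in> K \<Longrightarrow> 0 \<le> b k \<and> b k \<le> th" and R: "R > 0"
  shows "prob {\<omega> \<in> space M. \<bar>\<Sum>k\<in>K. b k * ((N k \<omega>)\<^sup>2 - 1)\<bar> > R} \<le> 2 * th\<^sup>2 * real (card K) / R\<^sup>2"
proof -
  define X where "X k \<omega> = b k * ((N k \<omega>)\<^sup>2 - 1)" for k \<omega>
  have iX: "indep_vars (\<lambda>_. borel) X K"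
    unfolding X_def[abs_def] by (rule indep_vars_compose2[OF ind]) measurable
  note tr = std_normal_transfer[OF std chi_measurable]
  have p2: "(X k \<omega>)\<^sup>2 = (b k)\<^sup>2 * ((N k \<omega>)\<^sup>2 - 1)\<^sup>2" for k \<omega>
    by (simp add: X_def power_mult_distrib)
  have E2: "expectation (\<lambda>\<omega>. (X k \<omega>)\<^sup>2) = (b k)\<^sup>2 * 2" if k: "k \<in> K" for k
    unfolding p2 using tr(1)[OF k k, of "\<lambda>g. (g\<^sup>2 - 1)\<^sup>2"] chi_moments(3) by simp
  have "integrable M (\<lambda>\<omega>. \<Sum>i\<in>K. X i \<omega>) \<and> (LINT \<omega>|M. (\<Sum>i\<in>K. X i \<omega>)) = 0 \<and> integrable M (\<lambda>\<omega>. (\<Sum>i\<in>K. X i \<omega>)\<^sup>2) \<and>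
     (LINT \<omega>|M. (\<Sum>i\<in>K. X i \<omega>)\<^sup>2) = (\<Sum>i\<in>K. (LINT \<omega>|M. (X i \<omega>)\<^sup>2))"
  proof (rule sum_zero_mean_second_moment[OF K prob_space_axioms iX])
    fix k assume k: "k \<in> K"
    show "integrable M (\<lambda>\<omega>. (X k \<omega>)\<^sup>2)" unfolding p2 
      using tr(2)[OF k k, of "\<lambda>g. (g\<^sup>2 - 1)\<^sup>2"] chi_integrable by (intro integrable_mult_right) simp
    show "integrable M (X k)" unfolding X_def[abs_def]
      using tr(2)[OF k k, of "\<lambda>g. g\<^sup>2 - 1"] chi_integrable by (intro integrable_mult_right) simp
    show "expectation (X k) = 0"
      using tr(1)[OF k k, of "\<lambda>g. g\<^sup>2 - 1"] chi_moments(2) by (simp add: X_def[abs_def])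
  qed
  then have m: "expectation (\<lambda>\<omega>. \<Sum>i\<in>K. X i \<omega>) = 0" "integrable M (\<lambda>\<omega>. (\<Sum>i\<in>K. X i \<omega>)\<^sup>2)" "integrable M (\<lambda>\<omega>. \<Sum>i\<in>K. X i \<omega>)"
    and v: "expectation (\<lambda>\<omega>. (\<Sum>i\<in>K. X i \<omega>)\<^sup>2) = (\<Sum>k\<in>K. (b k)\<^sup>2 * 2)" using E2 by auto
  have v': "(\<Sum>k\<in>K. (b k)\<^sup>2 * 2) \<le> 2 * th\<^sup>2 * real (card K)"
  proof -
    have "(\<Sum>k\<in>K. (b k)\<^sup>2 * 2) \<le> (\<Sum>k\<in>K. 2 * th\<^sup>2)" using b by (intro sum_mono) (simp add: power_mono)
    then show ?thesis by (simp add: mult.commute)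
  qed
  have Sm [measurable]: "(\<lambda>\<omega>. \<Sum>i\<in>K. X i \<omega>) \<in> borel_measurable M" using m(3) by simp
  have "prob {\<omega> \<in> space M. \<bar>\<Sum>i\<in>K. X i \<omega>\<bar> > R} \<le> prob {\<omega> \<in> space M. \<bar>(\<Sum>i\<in>K. X i \<omega>) - expectation (\<lambda>\<omega>. \<Sum>i\<in>K. X i \<omega>)\<bar> \<ge> R}"
    by (rule finite_measure_mono) (auto simp: m(1))
  also have "\<dots> \<le> variance (\<lambda>\<omega>. \<Sum>i\<in>K. X i \<omega>) / R\<^sup>2" by (rule Chebyshev_inequality[OF Sm m(2) R])
  also have "\<dots> = (\<Sum>k\<in>K. (b k)\<^sup>2 * 2) / R\<^sup>2" by (simp add: m(1) v)
  also have "\<dots> \<le> 2 * th\<^sup>2 * real (card K) / R\<^sup>2" by (rule divide_right_mono[OF v']) simp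
  finally show ?thesis by (simp add: X_def)
qed

lemma fourth_moment_sum_Markov:
  assumes T: "T > 0"
  shows "prob {\<omega> \<in> space M. (\<Sum>k\<in>K. 1 + N k \<omega> ^ 4) > T} \<le> 4 * real (card K) / T"
proof -
  note tr = std_normal_transfer[OF std chi_measurable]
  have i: "integrable M (\<lambda>\<omega>. N k \<omega> ^ 4)" and e: "expectation (\<lambda>\<omega>. N k \<omega> ^ 4) = 3" if k: "k \<in> K" for k
    using tr[OF k k, of "\<lambda>g. g ^ 4"] stdN_moments by auto
  have I: "integrable M (\<lambda>\<omega>. \<Sum>k\<in>K. 1 + N k \<omega> ^ 4)" using i by simp
  have E: "expectation (\<lambda>\<omega>. \<Sum>k\<in>K. 1 + N k \<omega> ^ 4) = 4 * real (card K)"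
    using i e by (subst Bochner_Integration.integral_sum) (auto simp: prob_space)
  have "emeasure M {\<omega> \<in> space M. (\<Sum>k\<in>K. 1 + N k \<omega> ^ 4) \<ge> T} \<le> ennreal (1 / T * expectation (\<lambda>\<omega>. \<Sum>k\<in>K. 1 + N k \<omega> ^ 4))"
    using integral_Markov_inequality[OF I _ T] T by (simp add: sum_nonneg ennreal_mult')
  then have "prob {\<omega> \<in> space M. (\<Sum>k\<in>K. 1 + N k \<omega> ^ 4) \<ge> T} \<le> 1 / T * (4 * real (card K))"
    unfolding E using T by (simp add: emeasure_eq_measure ennreal_le_iff)
  moreover have "prob {\<omega> \<in> space M. (\<Sum>k\<in>K. 1 + N k \<omega> ^ 4) > T} \<le> prob {\<omega> \<in> space M. (\<Sum>k\<in>K. 1 + N k \<omega> ^ 4) \<ge> T}"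
    by (rule finite_measure_mono) (use I in auto)
  ultimately show ?thesis by simp
qed

end

end

section \<open>Guessing the final state\<close>

definition endpoint_measure :: "real \<Rightarrow> real measure" where
  "endpoint_measure R = uniform_measure lborel {-R..R}"

lemma prob_space_endpoint: "R > 0 \<Longrightarrow> prob_space (endpoint_measure R)"
  unfolding endpoint_measure_def by (rule prob_space_uniform_measure) auto

text \<open>Of the two one-sided intervals of length \<open>h\<close> at \<open>x\<close>, the one
  pointing towards 0 lies inside \<open>{-R..R}\<close>.\<close>

lemma endpoint_prob:
  assumes R: "R > 0" and x: "\<bar>x\<bar> \<le> R" and h: "0 \<le> h" "h \<le> R"
  shows "h / (2 * R) \<le> measure (endpoint_measure R) {u. \<bar>x - u\<bar> \<le> h}"
proof -
  have set: "{u. \<bar>x - u\<bar> \<le> h} = {x - h..x + h}" by auto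
  have eR: "emeasure lborel {-R..R} = ennreal (2 * R)" using R by simp
  have mm: "measure (endpoint_measure R) A = measure lborel ({-R..R} \<inter> A) / (2 * R)" if "A \<in> sets borel" for A
    unfolding endpoint_measure_def using R that by (subst measure_uniform_measure) (auto simp: eR)
  have "h \<le> measure lborel ({-R..R} \<inter> {x - h..x + h})"
  proof (cases "x \<ge> 0")
    case True
    have "measure lborel {x - h..x} \<le> measure lborel ({-R..R} \<inter> {x - h..x + h})"
      by (rule measure_mono_fmeasurable) (use True x h R in \<open>auto intro!: fmeasurableI simp: emeasure_lborel_Icc_eq\<close>)
    then show ?thesis using h by simp
  next
    case False
    have "measure lborel {x..x + h} \<le> measure lborel ({-R..R} \<inter> {x - h..x + h})"
      by (rule measure_mono_fmeasurable) (use False x h R in \<open>auto intro!: fmeasurableI simp: emeasure_lborel_Icc_eq\<close>)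
    then show ?thesis using h by simp
  qed
  then show ?thesis unfolding set using R by (subst mm) (auto simp: divide_right_mono)
qed

section \<open>The finite blocklength bound\<close>

text \<open>Everything at fixed \<open>n\<close> with free parameters: \<open>window\<close> says
  that a typical source is hit under the conditional law with probability at least
  \<open>1 / n\<close>, and \<open>error\<close> adds up the four atypicality probabilities and
  \<open>1 / n\<close> for typical sources left uncovered.\<close>

lemma finite_blocklength_bound:
  fixes M :: "'w measure" and Z :: "nat \<Rightarrow> 'w \<Rightarrow> real"
  assumes M: "prob_space M" and a: "a > 1" and \<sigma>: "\<sigma> > 0"
    and Z: "prob_space.indep_vars M (\<lambda>_. borel) Z {1..}" "\<And>i. i \<ge> 1 \<Longrightarrow> distributed M lborel (Z i) (normal_density 0 \<sigma>)"
    and eps: "eps < 1" and d: "d > 0" and th: "th > 0" and n: "n \<ge> 3"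
  defines "s \<equiv> \<lambda>k. svar a (\<sigma>\<^sup>2) (freq n k)"
    and "D \<equiv> real n * d - (d + 2 * (a\<^sup>2 / (a - 1) ^ 4) + 1)"
    and "L \<equiv> (\<Sum>k\<in>{1..<n}. 1/2 * ln (max 1 (svar a (\<sigma>\<^sup>2) (freq n k) / th)))"
  assumes C: "\<bar>D - (\<Sum>k\<in>{1..<n}. min th (s k))\<bar> \<le> C"
    and Vmin: "Vmin > 0" "Vmin \<le> 2 * th\<^sup>2 * (\<Sum>k\<in>{1..<n}. (max 0 (1 - th / s k))\<^sup>2)"
    and pos: "\<delta> > 0" "R > 0" "T > 0"
    and window: "1 / real n \<le> \<delta> / (sqrt (6 * th\<^sup>2 * T) * sqrt (2 * pi)) * exp (- (R + C + 6 * \<delta>)\<^sup>2 / (2 * Vmin)) - 36288 * (1 + th ^ 4) * T / \<delta> ^ 3"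
    and error: "measure stdN {g. sqrt (\<Sum>k\<in>{1..<n}. 1/2 * (min 1 (s k / th))\<^sup>2) * g > t - \<delta>} + 252 * real n / \<delta> ^ 3
       + 2 * th\<^sup>2 * real n / R\<^sup>2 + 4 * real n / T + \<sigma> / (a - 1) / real n + 1 / real n \<le> eps"
  shows "Rop M (GM a Z) n d eps \<le> (ln (2 * (real n)\<^sup>2 * a ^ n) + L + t + (C + 3 * \<delta>) / (2 * th) + ln (real n) + ln (2 * ln (real n))) / real n"
proof -
  interpret prob_space M by fact
  let ?K = "{1..<n}"
  have n2: "n \<ge> 2" using n by simp
  have Ls: "L = (\<Sum>k\<in>?K. 1/2 * ln (max 1 (s k / th)))" by (simp add: L_def s_def)
  define N where "N = white a \<sigma> Z n"
  define U where "U = GM a Z"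
  have Nind: "indep_vars (\<lambda>_. borel) N ?K" and Nstd: "\<And>k. k \<in> ?K \<Longrightarrow> distr M borel (N k) = stdN"
    unfolding N_def by (rule white_indep[OF M a \<sigma> Z n2]; assumption)+
  have Nm [measurable]: "\<And>k. k \<in> ?K \<Longrightarrow> N k \<in> borel_measurable M"
    using chi_measurable[OF _ Nind Nstd] by simp
  have Um [measurable]: "U i \<in> borel_measurable M" for i
    unfolding U_def by (rule GM_measurable) (use Z(2)[THEN distributed_measurable] in simp)
  have s0: "s k > 0" for k unfolding s_def by (rule svar_bounds(3)) (use a \<sigma> in auto)
  define J where "J = {k \<in> ?K. s k > th}"
  have sJ: "s k > th" if "k \<in> J" for k using that by (simp add: J_def)
  define b where "b k = (if s k > th then th\<^sup>2 / s k else s k)" for k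
  have b: "0 \<le> b k \<and> b k \<le> th" for k
  proof (cases "s k > th")
    case True
    then have "th * th \<le> th * s k" using th by (intro mult_left_mono) auto
    then have "th\<^sup>2 / s k \<le> th" using s0[of k] by (simp add: divide_le_eq power2_eq_square)
    then show ?thesis using True s0[of k] by (simp add: b_def)
  next
    case False
    then show ?thesis using s0[of k] by (simp add: b_def)
  qed
  define c where "c k = min 1 (s k / th)" for k
  have c: "0 \<le> c k \<and> c k \<le> 1" for k using s0[of k] th by (simp add: c_def)
  \<comment> \<open>Inside this proof \<open>RU\<close> is the half-width of the range of the final
    state, not the rate function.\<close>
  define RU where "RU = real n * a ^ n"
  have RU: "RU > 0" using n a by (simp add: RU_def)
  \<comment> \<open>The four ways of being atypical: too much tilted information, mean distance off
    target, large fourth moments, final state out of range.\<close>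
  define A1 where "A1 = {\<omega> \<in> space M. (\<Sum>k\<in>?K. 1/2 * c k * ((N k \<omega>)\<^sup>2 - 1)) \<ge> t}"
  define A2 where "A2 = {\<omega> \<in> space M. \<bar>\<Sum>k\<in>?K. b k * ((N k \<omega>)\<^sup>2 - 1)\<bar> > R}"
  define A3 where "A3 = {\<omega> \<in> space M. (\<Sum>k\<in>?K. 1 + N k \<omega> ^ 4) > T}"
  define A4 where "A4 = {\<omega> \<in> space M. \<bar>U n \<omega>\<bar> > RU}"
  have Am [measurable]: "A1 \<in> sets M" "A2 \<in> sets M" "A3 \<in> sets M" "A4 \<in> sets M"
    unfolding A1_def A2_def A3_def A4_def by measurable
  have cardK: "real (card ?K) \<le> real n" by simp
  have p1: "prob A1 \<le> measure stdN {g. sqrt (\<Sum>k\<in>?K. 1/2 * (min 1 (s k / th))\<^sup>2) * g > t - \<delta>} + 252 * real n / \<delta> ^ 3"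
  proof -
    have "36 / \<delta> ^ 3 * (7 * real (card ?K)) \<le> 36 / \<delta> ^ 3 * (7 * real n)" using pos cardK by (intro mult_left_mono) auto
    then show ?thesis
      using chi_sum_tail[OF _ Nind Nstd, of c \<delta> t] c pos(1) unfolding A1_def c_def by simp
  qed
  have p2: "prob A2 \<le> 2 * th\<^sup>2 * real n / R\<^sup>2"
  proof -
    have "prob A2 \<le> 2 * th\<^sup>2 * real (card ?K) / R\<^sup>2"
      unfolding A2_def by (rule chi_sum_Chebyshev[OF _ Nind Nstd]) (use b pos in auto)
    also have "\<dots> \<le> 2 * th\<^sup>2 * real n / R\<^sup>2" using cardK by (intro divide_right_mono mult_left_mono) auto
    finally show ?thesis .
  qed
  have p3: "prob A3 \<le> 4 * real n / T"
  proof -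
    have "prob A3 \<le> 4 * real (card ?K) / T"
      unfolding A3_def by (rule fourth_moment_sum_Markov[OF _ Nind Nstd]) (use pos in auto)
    also have "\<dots> \<le> 4 * real n / T" using cardK pos by (intro divide_right_mono mult_left_mono) auto
    finally show ?thesis .
  qed
  have p4: "prob A4 \<le> \<sigma> / (a - 1) / real n"
    unfolding A4_def RU_def U_def by (rule GM_tail[OF a \<sigma> Z(2)]) (use n in auto)
  define Bad where "Bad = A1 \<union> A2 \<union> A3 \<union> A4"
  have Badm [measurable]: "Bad \<in> sets M" unfolding Bad_def by measurable
  have pBad: "prob Bad \<le> prob A1 + prob A2 + prob A3 + prob A4"
    unfolding Bad_def
    by (intro order_trans[OF measure_Un_le] add_right_mono; simp)
  have Bad1: "prob Bad + 1 / real n \<le> eps" using pBad p1 p2 p3 p4 error by linarith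
  define A where "A = space M - Bad"
  have Ameas [measurable]: "A \<in> sets M" unfolding A_def by measurable
  have n0: "real n > 0" using n by simp
  have n0': "1 / real n > 0" using n0 by simp
  then have "prob Bad < 1" using Bad1 eps by linarith
  \<comment> \<open>Since \<open>eps < 1\<close>, some source is typical; its covering probability
    later certifies \<open>p \<le> 1\<close>.\<close>
  then have "Bad \<noteq> space M" using prob_space by auto
  then have Ane: "A \<noteq> {}" using sets.sets_into_space[OF Badm] by (auto simp: A_def)
  define cw where "cw = codeword_measure J th s"
  interpret cw: prob_space cw unfolding cw_def by (rule prob_space_codeword_measure) (rule sJ)
  define ep where "ep = endpoint_measure RU"
  interpret ep: prob_space ep unfolding ep_def by (rule prob_space_endpoint[OF RU])
  interpret \<nu>: pair_prob_space ep cw ..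
  \<comment> \<open>A random codeword is a pair of a guess for the final state and Gaussian
    coefficients for the components in \<open>J\<close>; the other components are set to 0.\<close>
  define dec where "dec z = decode a n (fst z) (\<lambda>k. if k \<in> J then snd z k else 0)" for z :: "real \<times> (nat \<Rightarrow> real)"
  define E where "E = {p \<in> space (M \<Otimes>\<^sub>M (ep \<Otimes>\<^sub>M cw)). distortion n (\<lambda>i. U i (fst p)) (dec (snd p)) \<le> d}"
  have sep: "sets ep = sets borel" by (simp add: ep_def endpoint_measure_def)
  have scw: "sets cw = sets (PiM J (\<lambda>_. borel))" unfolding cw_def by (rule sets_codeword_measure)
  have sp_ep: "space ep = UNIV" using sets_eq_imp_space_eq[OF sep] by simp
  have m1: "(\<lambda>p. U i (fst p)) \<in> borel_measurable (M \<Otimes>\<^sub>M (ep \<Otimes>\<^sub>M cw))" for i by measurable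
  have m_fst: "(\<lambda>z. fst z) \<in> borel_measurable (ep \<Otimes>\<^sub>M cw)"
    using measurable_fst[of ep cw] measurable_cong_sets[OF refl sep] by blast
  have m_snd: "(\<lambda>z. if k \<in> J then snd z k else 0) \<in> borel_measurable (ep \<Otimes>\<^sub>M cw)" for k
  proof (cases "k \<in> J")
    case True
    have "(\<lambda>x. x k) \<in> borel_measurable cw"
      using measurable_component_singleton[OF True, of "\<lambda>_. borel"] measurable_cong_sets[OF scw refl] by blast
    from measurable_compose[OF measurable_snd this] show ?thesis using True by simp
  qed simp
  have m_dec: "(\<lambda>z. dec z i) \<in> borel_measurable (ep \<Otimes>\<^sub>M cw)" for i
  proof (cases "i = n")
    case True then show ?thesis using m_fst by (simp add: dec_def decode_def)
  next
    case False
    have "(\<lambda>z. \<Sum>k\<in>{1..<n}. ((if k \<in> J then snd z k else 0) + end_coeff a n k * fst z) * sine_basis n k i) \<in> borel_measurable (ep \<Otimes>\<^sub>M cw)"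
      by (intro borel_measurable_sum borel_measurable_times borel_measurable_add m_snd m_fst borel_measurable_const)
    then show ?thesis using False by (simp add: dec_def decode_def)
  qed
  have Em: "E \<in> sets (M \<Otimes>\<^sub>M (ep \<Otimes>\<^sub>M cw))"
  proof -
    have [measurable]: "(\<lambda>p. dec (snd p) i) \<in> borel_measurable (M \<Otimes>\<^sub>M (ep \<Otimes>\<^sub>M cw))" for i
      by (rule measurable_compose[OF measurable_snd m_dec])
    have [measurable]: "(\<lambda>p. distortion n (\<lambda>i. U i (fst p)) (dec (snd p))) \<in> borel_measurable (M \<Otimes>\<^sub>M (ep \<Otimes>\<^sub>M cw))"
      unfolding distortion_def using m1
      by (intro borel_measurable_times borel_measurable_const borel_measurable_sum borel_measurable_power borel_measurable_diff) auto
    show ?thesis unfolding E_def by measurable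
  qed
  define X where "X = L + t + (C + 3 * \<delta>) / (2 * th)"
  \<comment> \<open>The probability of guessing the final state to within \<open>1 / n\<close>,
    times the lower bound for hitting the ball.\<close>
  define p where "p = 1 / (2 * (real n)\<^sup>2 * a ^ n) * (exp (- X) * (1 / real n))"
  have p0: "p > 0" using n a by (simp add: p_def)
  have ball: "p \<le> measure (ep \<Otimes>\<^sub>M cw) {z \<in> space (ep \<Otimes>\<^sub>M cw). (\<omega>, z) \<in> E}" if \<omega>: "\<omega> \<in> A" for \<omega>
  proof -
    have \<omega>s: "\<omega> \<in> space M" and nb: "\<omega> \<notin> A1" "\<omega> \<notin> A2" "\<omega> \<notin> A3" "\<omega> \<notin> A4" using \<omega> by (auto simp: A_def Bad_def)
    have h4: "\<bar>U n \<omega>\<bar> \<le> RU" using nb(4) \<omega>s by (simp add: A4_def not_less)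
    have hn: "1 / real n \<le> RU"
    proof -
      have "1 / real n \<le> 1" using n by simp
      also have "1 \<le> real n * a ^ n" using n a by (intro mult_ge1_I) (auto simp: one_le_power)
      finally show ?thesis by (simp add: RU_def)
    qed
    have e1: "1 / (2 * (real n)\<^sup>2 * a ^ n) \<le> measure ep {u. \<bar>U n \<omega> - u\<bar> \<le> 1 / real n}"
    proof -
      have "1 / real n / (2 * RU) \<le> measure ep {u. \<bar>U n \<omega> - u\<bar> \<le> 1 / real n}"
        unfolding ep_def by (rule endpoint_prob[OF RU h4 _ hn]) simp
      moreover have "1 / real n / (2 * RU) = 1 / (2 * (real n)\<^sup>2 * a ^ n)"
        by (simp add: RU_def power2_eq_square)
      ultimately show ?thesis by (simp only:)
    qed
    let ?S = "{x \<in> space cw. (\<Sum>k\<in>?K. (sqrt (s k) * N k \<omega> - (if k \<in> J then x k else 0))\<^sup>2) \<le> D}"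
    have e2: "exp (- X) * (1 / real n) \<le> measure cw ?S"
    proof -
      let ?B = "\<delta> / (sqrt (6 * th\<^sup>2 * T) * sqrt (2 * pi)) * exp (- (R + C + 6 * \<delta>)\<^sup>2 / (2 * Vmin)) - 36288 * (1 + th ^ 4) * T / \<delta> ^ 3"
      have "exp (- X) * (1 / real n) \<le> exp (- X) * ?B" by (rule mult_left_mono[OF window]) simp
      also have "\<dots> \<le> measure cw ?S"
        unfolding X_def Ls cw_def J_def
      proof (rule codeword_prob_bound[where R=R and T=T and C=C and N="\<lambda>k. N k \<omega>"])
        show "(\<Sum>k\<in>?K. 1/2 * min 1 (s k / th) * ((N k \<omega>)\<^sup>2 - 1)) \<le> t" using nb(1) \<omega>s by (simp add: A1_def c_def)
        show "\<bar>\<Sum>k\<in>?K. (if s k > th then th\<^sup>2 / s k else s k) * ((N k \<omega>)\<^sup>2 - 1)\<bar> \<le> R" using nb(2) \<omega>s by (simp add: A2_def b_def not_less)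
        show "(\<Sum>k\<in>?K. 1 + N k \<omega> ^ 4) \<le> T" using nb(3) \<omega>s by (simp add: A3_def not_less)
        show "0 \<le> ?B" using window n0' by linarith
      qed (rule finite_atLeastLessThan th s0 pos(1) Vmin C)+
      finally show ?thesis .
    qed
    have Smeas: "?S \<in> sets cw"
    proof -
      have "(\<lambda>x. if k \<in> J then x k else 0) \<in> borel_measurable cw" for k
      proof (cases "k \<in> J")
        case True
        have "(\<lambda>x. x k) \<in> borel_measurable cw"
          using measurable_component_singleton[OF True, of "\<lambda>_. borel"] measurable_cong_sets[OF scw refl] by blast
        then show ?thesis using True by simp
      qed simp
      then have "(\<lambda>x. \<Sum>k\<in>?K. (sqrt (s k) * N k \<omega> - (if k \<in> J then x k else 0))\<^sup>2) \<in> borel_measurable cw"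
        by (intro borel_measurable_sum borel_measurable_power borel_measurable_diff borel_measurable_const) auto
      then show ?thesis by measurable
    qed
    have Imeas: "{u. \<bar>U n \<omega> - u\<bar> \<le> 1 / real n} \<in> sets ep" unfolding sep by measurable
    have "p \<le> measure ep {u. \<bar>U n \<omega> - u\<bar> \<le> 1 / real n} * measure cw ?S"
      unfolding p_def by (rule mult_mono[OF e1 e2]) auto
    also have "\<dots> = measure (ep \<Otimes>\<^sub>M cw) ({u. \<bar>U n \<omega> - u\<bar> \<le> 1 / real n} \<times> ?S)"
      using cw.emeasure_pair_measure_Times[OF Imeas Smeas] by (simp add: measure_def enn2real_mult)
    also have "\<dots> \<le> measure (ep \<Otimes>\<^sub>M cw) {z \<in> space (ep \<Otimes>\<^sub>M cw). (\<omega>, z) \<in> E}"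
    proof (rule \<nu>.finite_measure_mono)
      show "{u. \<bar>U n \<omega> - u\<bar> \<le> 1 / real n} \<times> ?S \<subseteq> {z \<in> space (ep \<Otimes>\<^sub>M cw). (\<omega>, z) \<in> E}"
      proof
        fix z assume z: "z \<in> {u. \<bar>U n \<omega> - u\<bar> \<le> 1 / real n} \<times> ?S"
        then have z1: "\<bar>U n \<omega> - fst z\<bar> \<le> 1 / real n" and z2: "snd z \<in> ?S" by (simp_all add: mem_Times_iff)
        then have zs: "z \<in> space (ep \<Otimes>\<^sub>M cw)" by (simp add: space_pair_measure sp_ep mem_Times_iff)
        have "distortion n (\<lambda>i. U i \<omega>) (dec z) \<le> d"
          unfolding U_def dec_def by (rule decode_distortion[OF a \<sigma> n2 d]) (use z1 z2 in \<open>simp_all add: U_def N_def s_def D_def\<close>)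
        then show "z \<in> {z \<in> space (ep \<Otimes>\<^sub>M cw). (\<omega>, z) \<in> E}"
          using zs \<omega>s by (simp add: E_def space_pair_measure)
      qed
      show "{z \<in> space (ep \<Otimes>\<^sub>M cw). (\<omega>, z) \<in> E} \<in> sets (ep \<Otimes>\<^sub>M cw)"
      proof -
        have "Pair \<omega> -` E \<in> sets (ep \<Otimes>\<^sub>M cw)" by (rule sets_Pair1[OF Em])
        moreover have "Pair \<omega> -` E = {z \<in> space (ep \<Otimes>\<^sub>M cw). (\<omega>, z) \<in> E}"
          using sets.sets_into_space[OF Em] by (auto simp: space_pair_measure)
        ultimately show ?thesis by simp
      qed
    qed
    finally show ?thesis .
  qed
  have p1': "p \<le> 1"
  proof -
    obtain \<omega> where "\<omega> \<in> A" using Ane by blast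
    from ball[OF this] show ?thesis using \<nu>.prob_le_1 by (meson order_trans)
  qed
  \<comment> \<open>Here \<open>n \<ge> 3\<close> enters; it makes
    \<open>ln (real n) / p \<ge> 1\<close>, so that rounding up costs at most a factor 2.\<close>
  have lnn: "ln (real n) \<ge> 1"
  proof -
    have "exp 1 \<le> real n" using exp_le n by (simp add: order_trans[OF exp_le])
    then show ?thesis using n0 by (simp add: ln_ge_iff)
  qed
  \<comment> \<open>With this many codewords
    \<open>(1 - p) ^ Kn \<le> exp (- p * Kn) \<le> 1 / n\<close>.\<close>
  define Kn where "Kn = nat \<lceil>ln (real n) / p\<rceil>"
  have Kn1: "real Kn \<ge> ln (real n) / p" unfolding Kn_def by (rule real_nat_ceiling_ge)
  have lp: "1 \<le> ln (real n) / p" using lnn p0 p1' by (simp add: field_simps)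
  have Kn2: "real Kn \<le> 2 * ln (real n) / p"
  proof -
    have "real Kn \<le> ln (real n) / p + 1" unfolding Kn_def using lp by linarith
    then show ?thesis using lp by simp
  qed
  have Kn_pos: "Kn \<ge> 1" using Kn1 lp by linarith
  from greedy_covering[OF M \<nu>.prob_space_axioms Em Ameas ball p1', of Kn]
  obtain c' where "(\<forall>i. c' i \<in> space (ep \<Otimes>\<^sub>M cw)) \<and> prob {\<omega> \<in> A. \<forall>i<Kn. (\<omega>, c' i) \<notin> E} \<le> (1 - p) ^ Kn"
    by (rule exE)
  then have unc: "prob {\<omega> \<in> A. \<forall>i<Kn. (\<omega>, c' i) \<notin> E} \<le> (1 - p) ^ Kn" and c's: "\<And>i. c' i \<in> space (ep \<Otimes>\<^sub>M cw)"
    by simp_all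
  have "(1 - p) ^ Kn \<le> exp (- p) ^ Kn"
    using p1' exp_ge_add_one_self[of "- p"] by (intro power_mono) auto
  also have "\<dots> = exp (- (p * real Kn))" by (simp add: exp_of_nat_mult[symmetric] mult.commute)
  also have "\<dots> \<le> exp (- ln (real n))" using Kn1 p0 by (simp add: field_simps)
  also have "\<dots> = 1 / real n" using n0 by (simp add: exp_minus field_simps)
  finally have unc': "prob {\<omega> \<in> A. \<forall>i<Kn. (\<omega>, c' i) \<notin> E} \<le> 1 / real n" using unc by linarith
  have Rop: "Rop M U n d eps \<le> ln (real Kn) / real n"
  proof (rule Rop_le_of_codebook[OF M _ Kn_pos, where c="\<lambda>i. dec (c' i)"])
    show "prob {\<omega> \<in> space M. \<forall>i<Kn. d < distortion n (\<lambda>i. U i \<omega>) (dec (c' i))} \<le> eps"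
    proof -
      have Um': "{\<omega> \<in> A. \<forall>i<Kn. (\<omega>, c' i) \<notin> E} \<in> sets M"
      proof -
        have "{\<omega> \<in> space M. (\<omega>, c' i) \<in> E} \<in> sets M" for i
        proof -
          have "(\<lambda>\<omega>. (\<omega>, c' i)) -` E \<in> sets M" by (rule sets_Pair2[OF Em])
          moreover have "(\<lambda>\<omega>. (\<omega>, c' i)) -` E = {\<omega> \<in> space M. (\<omega>, c' i) \<in> E}"
            using sets.sets_into_space[OF Em] by (auto simp: space_pair_measure)
          ultimately show ?thesis by simp
        qed
        moreover have "{\<omega> \<in> A. \<forall>i<Kn. (\<omega>, c' i) \<notin> E} = A - (\<Union>i\<in>{..<Kn}. {\<omega> \<in> space M. (\<omega>, c' i) \<in> E})"
          using sets.sets_into_space[OF Ameas] by blast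
        ultimately show ?thesis using Ameas by simp
      qed
      \<comment> \<open>The code fails only for atypical sources or for typical ones that the greedy
        choice left uncovered.\<close>
      have "{\<omega> \<in> space M. \<forall>i<Kn. d < distortion n (\<lambda>i. U i \<omega>) (dec (c' i))} \<subseteq> Bad \<union> {\<omega> \<in> A. \<forall>i<Kn. (\<omega>, c' i) \<notin> E}"
      proof (rule subsetI)
        fix \<omega> assume w: "\<omega> \<in> {\<omega> \<in> space M. \<forall>i<Kn. d < distortion n (\<lambda>i. U i \<omega>) (dec (c' i))}"
        have "(\<omega>, c' i) \<notin> E" if "i < Kn" for i
        proof
          assume "(\<omega>, c' i) \<in> E"
          then have "distortion n (\<lambda>i. U i \<omega>) (dec (c' i)) \<le> d" by (simp add: E_def)
          moreover have "d < distortion n (\<lambda>i. U i \<omega>) (dec (c' i))" using w that by blast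
          ultimately show False by linarith
        qed
        then show "\<omega> \<in> Bad \<union> {\<omega> \<in> A. \<forall>i<Kn. (\<omega>, c' i) \<notin> E}" using w by (simp add: A_def)
      qed
      then have "prob {\<omega> \<in> space M. \<forall>i<Kn. d < distortion n (\<lambda>i. U i \<omega>) (dec (c' i))} \<le> prob (Bad \<union> {\<omega> \<in> A. \<forall>i<Kn. (\<omega>, c' i) \<notin> E})"
        by (rule finite_measure_mono[OF _ sets.Un[OF Badm Um']])
      also have "\<dots> \<le> prob Bad + prob {\<omega> \<in> A. \<forall>i<Kn. (\<omega>, c' i) \<notin> E}"
        by (rule measure_Un_le[OF Badm Um'])
      also have "\<dots> \<le> eps" using Bad1 unc' by linarith
      finally show ?thesis .
    qed
  qed (use n in auto)
  have "ln (real Kn) \<le> ln (2 * ln (real n) / p)" using Kn2 Kn_pos by simp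
  also have "\<dots> = ln (2 * ln (real n)) - ln p" using lnn p0 by (subst ln_div) auto
  also have "ln p = - ln (2 * (real n)\<^sup>2 * a ^ n) - X - ln (real n)"
  proof -
    define G where "G = 2 * (real n)\<^sup>2 * a ^ n"
    have G: "0 < G" using n a by (simp add: G_def)
    have "ln p = ln (1 / G) + (ln (exp (- X)) + ln (1 / real n))"
      unfolding p_def G_def[symmetric] using n0 G by (simp only: ln_mult_pos zero_less_divide_1_iff exp_gt_zero mult_pos_pos)
    then show ?thesis unfolding G_def[symmetric] using n0 G by (simp add: ln_div)
  qed
  finally have "ln (real Kn) \<le> ln (2 * (real n)\<^sup>2 * a ^ n) + L + t + (C + 3 * \<delta>) / (2 * th) + ln (real n) + ln (2 * ln (real n))"
    by (simp add: X_def)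
  then have "ln (real Kn) / real n \<le> (ln (2 * (real n)\<^sup>2 * a ^ n) + L + t + (C + 3 * \<delta>) / (2 * th) + ln (real n) + ln (2 * ln (real n))) / real n"
    by (rule divide_right_mono) simp
  then show ?thesis using Rop unfolding U_def by linarith
qed

section \<open>Choice of the parameters as functions of the blocklength\<close>

lemma sqrt_diff_le:
  assumes "0 \<le> x" "0 \<le> y"
  shows "\<bar>sqrt x - sqrt y\<bar> \<le> sqrt \<bar>x - y\<bar>"
proof -
  have "\<bar>sqrt x - sqrt y\<bar>\<^sup>2 \<le> \<bar>sqrt x - sqrt y\<bar> * (sqrt x + sqrt y)"
    unfolding power2_eq_square
  proof (rule mult_left_mono)
    show "\<bar>sqrt x - sqrt y\<bar> \<le> sqrt x + sqrt y"
      using real_sqrt_ge_zero[OF assms(1)] real_sqrt_ge_zero[OF assms(2)] by linarith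
  qed simp
  also have "\<dots> = \<bar>(sqrt x - sqrt y) * (sqrt x + sqrt y)\<bar>" using assms by (simp add: abs_mult)
  also have "(sqrt x - sqrt y) * (sqrt x + sqrt y) = x - y" using assms by (simp add: algebra_simps)
  finally show ?thesis by (rule real_le_rsqrt)
qed

lemma VU_nonneg:
  assumes "a > 1" "sig2 > 0" "water_level a sig2 d > 0"
  shows "0 \<le> VU a sig2 d"
proof -
  have "0 \<le> integral {0..pi} (\<lambda>w. 1/2 * (min 1 (svar a sig2 w / water_level a sig2 d))\<^sup>2)" (is "0 \<le> integral _ ?f")
  proof (cases "?f integrable_on {0..pi}")
    case True then show ?thesis by (rule Henstock_Kurzweil_Integration.integral_nonneg) simp
  qed (simp add: not_integrable_integral)
  then show ?thesis unfolding VU_eq[OF assms] by simp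
qed

text \<open>The number 8 is chosen so that, with \<open>R\<close> doubled to absorb the lower-order
  terms, the exponent is \<open>(th\<^sup>2 * \<kappa> / 2 * n * ln n) / (2 * th\<^sup>2 * \<kappa>
  * n) = ln n / 4\<close>. The main term is then of order \<open>n^(-1/4) * (ln n)^(-3/2)\<close>,
  which beats both \<open>1 / n\<close> and the Lindeberg error of order
  \<open>(ln n)^4 / sqrt n\<close>.\<close>

lemma window_asymptotics:
  assumes th: "th > 0" and \<kappa>: "\<kappa> > 0" and C: "C \<ge> 0"
  shows "\<forall>\<^sub>F n in sequentially. 1 / real n \<le> (sqrt (real n) / ln (real n)) / (sqrt (6 * th\<^sup>2 * (real n * ln (real n))) * sqrt (2 * pi))
     * exp (- (sqrt (th\<^sup>2 * \<kappa> / 8 * (real n * ln (real n))) + C + 6 * (sqrt (real n) / ln (real n)))\<^sup>2 / (2 * (th\<^sup>2 * \<kappa> * real n)))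
     - 36288 * (1 + th ^ 4) * (real n * ln (real n)) / (sqrt (real n) / ln (real n)) ^ 3"
proof -
  define e where "e = sqrt (th\<^sup>2 * \<kappa> / 8)"
  have e: "e > 0" using th \<kappa> by (simp add: e_def)
  define c1 where "c1 = 1 / (sqrt (6 * th\<^sup>2) * sqrt (2 * pi))"
  have c1: "c1 > 0" using th by (simp add: c1_def)
  define c2 where "c2 = 36288 * (1 + th ^ 4)"
  have c2: "c2 > 0" using th by (simp add: c2_def add_pos_pos)
  have 1: "\<forall>\<^sub>F n in sequentially. C + 6 * (sqrt (real n) / ln (real n)) \<le> e * (sqrt (real n) * sqrt (ln (real n)))"
    using e by real_asymp
  have 2: "\<forall>\<^sub>F n in sequentially. 1 / real n \<le> (1 / ln (real n) / sqrt (ln (real n))) * c1 * (real n) powr (-1/4)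
       - c2 * (ln (real n)) ^ 4 / sqrt (real n)"
    using c1 c2 by real_asymp
  show ?thesis
    using 1 2 eventually_ge_at_top[of 3]
  proof eventually_elim
    case (elim n)
    have n0: "real n > 0" and n1: "real n > 1" using elim(3) by auto
    have l0: "ln (real n) > 0" using n1 by simp
    define r where "r = sqrt (th\<^sup>2 * \<kappa> / 8 * (real n * ln (real n))) + C + 6 * (sqrt (real n) / ln (real n))"
    have req: "sqrt (th\<^sup>2 * \<kappa> / 8 * (real n * ln (real n))) = e * (sqrt (real n) * sqrt (ln (real n)))"
      unfolding e_def by (simp only: real_sqrt_mult)
    have r0: "0 \<le> r" unfolding r_def req using e C l0 by simp
    have r2: "r \<le> 2 * (e * (sqrt (real n) * sqrt (ln (real n))))" unfolding r_def req using elim(1) by linarith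
    have "r\<^sup>2 \<le> (2 * (e * (sqrt (real n) * sqrt (ln (real n)))))\<^sup>2" by (rule power_mono[OF r2 r0])
    also have "\<dots> = th\<^sup>2 * \<kappa> / 2 * (real n * ln (real n))"
      using l0 \<kappa> by (simp add: power_mult_distrib e_def)
    finally have "r\<^sup>2 / (2 * (th\<^sup>2 * \<kappa> * real n)) \<le> th\<^sup>2 * \<kappa> / 2 * (real n * ln (real n)) / (2 * (th\<^sup>2 * \<kappa> * real n))"
      using th \<kappa> by (intro divide_right_mono) auto
    also have "\<dots> = ln (real n) / 4" using th \<kappa> n0 by (simp add: field_simps)
    finally have "exp (- (1/4) * ln (real n)) \<le> exp (- r\<^sup>2 / (2 * (th\<^sup>2 * \<kappa> * real n)))" by simp
    then have ex: "(real n) powr (-1/4) \<le> exp (- r\<^sup>2 / (2 * (th\<^sup>2 * \<kappa> * real n)))"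
      using n0 by (simp add: powr_def)
    have pre: "(sqrt (real n) / ln (real n)) / (sqrt (6 * th\<^sup>2 * (real n * ln (real n))) * sqrt (2 * pi)) = (1 / ln (real n) / sqrt (ln (real n))) * c1"
    proof -
      have "sqrt (6 * th\<^sup>2 * (real n * ln (real n))) = sqrt (6 * th\<^sup>2) * (sqrt (real n) * sqrt (ln (real n)))"
        by (simp only: real_sqrt_mult)
      then show ?thesis using n0 by (simp add: c1_def)
    qed
    have last: "36288 * (1 + th ^ 4) * (real n * ln (real n)) / (sqrt (real n) / ln (real n)) ^ 3 = c2 * (ln (real n)) ^ 4 / sqrt (real n)"
    proof -
      have s3: "sqrt (real n) ^ 3 = real n * sqrt (real n)" using n0 by (simp add: power3_eq_cube)
      show ?thesis unfolding c2_def[symmetric] power_divide s3 using n0 l0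
        by (simp add: power3_eq_cube power4_eq_xxxx)
    qed
    have "(1 / ln (real n) / sqrt (ln (real n))) * c1 * (real n) powr (-1/4)
      \<le> (1 / ln (real n) / sqrt (ln (real n))) * c1 * exp (- r\<^sup>2 / (2 * (th\<^sup>2 * \<kappa> * real n)))"
      using ex c1 l0 by (intro mult_left_mono) auto
    then show ?case unfolding pre last r_def[symmetric] using elim(2) by linarith
  qed
qed

theorem theorem7:
  fixes M :: "'w measure" and Z :: "nat \<Rightarrow> 'w \<Rightarrow> real"
    and a sigma eps d :: real
  assumes "prob_space M"
    and "a > 1" and "sigma > 0"
    and "prob_space.indep_vars M (\<lambda>_. borel) Z {1..}"
    and "\<And>i. i \<ge> 1 \<Longrightarrow> distributed M lborel (Z i) (normal_density 0 sigma)"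
    and "0 < eps" and "eps < 1"
    and "0 < d" and "d < sigma\<^sup>2 / (a\<^sup>2 - 1)"
  shows "\<exists>C. \<forall>\<^sub>F n in sequentially.
     Rop M (GM a Z) n d eps \<le> RU a (sigma\<^sup>2) d
        + sqrt (VU a (sigma\<^sup>2) d / real n) * Qinv eps
        + C / (sqrt (real n) * ln (real n))"
proof -
  note a = assms(2) and \<sigma> = assms(3) and d = assms(8,9)
  interpret N: real_distribution stdN by (rule real_dist_normal_dist)
  have s2: "sigma\<^sup>2 > 0" using \<sigma> by simp
  define th where "th = water_level a (sigma\<^sup>2) d"
  define V where "V = VU a (sigma\<^sup>2) d"
  define RR where "RR = RU a (sigma\<^sup>2) d"
  have th: "th > 0" unfolding th_def by (rule water_level_props(1)[OF a s2 d])
  have V: "0 \<le> V" unfolding V_def by (rule VU_nonneg[OF a s2]) (use th th_def in simp)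
  define s where "s n k = svar a (sigma\<^sup>2) (freq n k)" for n k
  have "\<exists>Cs \<kappa>. \<kappa> > 0 \<and> Cs > 0
    \<and> (\<forall>n>0. \<bar>(\<Sum>k\<in>{1..<n}. min th (s n k)) - real n * d\<bar> \<le> Cs)
    \<and> (\<forall>n>0. \<bar>(\<Sum>k\<in>{1..<n}. 1/2 * ln (max 1 (s n k / th))) - real n * (RR - ln a)\<bar> \<le> Cs)
    \<and> (\<forall>n>0. \<bar>(\<Sum>k\<in>{1..<n}. 1/2 * (min 1 (s n k / th))\<^sup>2) - real n * V\<bar> \<le> Cs)
    \<and> (\<forall>n>0. \<bar>(\<Sum>k\<in>{1..<n}. (max 0 (1 - th / s n k))\<^sup>2) - real n * \<kappa>\<bar> \<le> Cs)"
    unfolding s_def th_def V_def RR_def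
  proof (rule spectral_sums[OF a s2 d], goal_cases)
    case (1 C \<kappa>)
    show ?case
      by (intro exI[of _ C] exI[of _ \<kappa>] conjI allI impI) (rule 1, assumption?)+
  qed
  then obtain Cs \<kappa> where \<kappa>: "\<kappa> > 0" and Cs: "Cs > 0"
    and S1: "\<forall>n>0. \<bar>(\<Sum>k\<in>{1..<n}. min th (s n k)) - real n * d\<bar> \<le> Cs"
    and S2: "\<forall>n>0. \<bar>(\<Sum>k\<in>{1..<n}. 1/2 * ln (max 1 (s n k / th))) - real n * (RR - ln a)\<bar> \<le> Cs"
    and S3: "\<forall>n>0. \<bar>(\<Sum>k\<in>{1..<n}. 1/2 * (min 1 (s n k / th))\<^sup>2) - real n * V\<bar> \<le> Cs"
    and S4: "\<forall>n>0. \<bar>(\<Sum>k\<in>{1..<n}. (max 0 (1 - th / s n k))\<^sup>2) - real n * \<kappa>\<bar> \<le> Cs"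
    by (elim exE conjE)
  note S1 = S1[rule_format] and S2 = S2[rule_format] and S3 = S3[rule_format] and S4 = S4[rule_format]
  define c0 where "c0 = d + 2 * (a\<^sup>2 / (a - 1) ^ 4) + 1"
  have c0: "c0 \<ge> 0" unfolding c0_def using d by (intro add_nonneg_nonneg) auto
  \<comment> \<open>The Riemann sum error plus the distortion slack demanded by
    \<open>decode_distortion\<close>.\<close>
  define C where "C = Cs + c0"
  have C: "C \<ge> 0" using Cs c0 by (simp add: C_def)
  define \<delta> where "\<delta> n = sqrt (real n) / ln (real n)" for n
  define R where "R n = sqrt (th\<^sup>2 * \<kappa> / 8 * (real n * ln (real n)))" for n
  define T where "T n = real n * ln (real n)" for n
  define q where "q = Qinv eps"
  \<comment> \<open>The rate at which \<open>Qfun\<close> decreases to the right of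
    \<open>q\<close>, from \<open>Qfun_decrease\<close>.\<close>
  define kq where "kq = 1 / (2 * sqrt (2 * pi)) * exp (- (\<bar>q\<bar> + 1)\<^sup>2 / 2)"
  have kq: "kq > 0" by (simp add: kq_def)
  \<comment> \<open>The quantile is moved by \<open>B1 / ln n\<close> to gain
    \<open>(16 / \<kappa> + 5) / ln n\<close> of error probability: \<open>16 / \<kappa>\<close> for
    Chebyshev, 4 for Markov and 1 for all smaller terms.\<close>
  define B1 where "B1 = (16 / \<kappa> + 5) / kq"
  have B1: "B1 > 0" using kq \<kappa> by (simp add: B1_def add_pos_pos)
  define v where "v n = (\<Sum>k\<in>{1..<n}. 1/2 * (min 1 (s n k / th))\<^sup>2)" for n
  \<comment> \<open>One \<open>\<delta> n\<close> compensates the smoothing in the tail bound, the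
    other \<open>B1\<close> of them move the quantile.\<close>
  define t where "t n = sqrt (v n) * q + (B1 + 1) * \<delta> n" for n
  \<comment> \<open>The coefficients of \<open>\<delta> n\<close>: \<open>B1 + 1\<close> from
    \<open>t n\<close>, \<open>3 / (2 * th)\<close> from the width of the window, and 1 for all
    logarithms and constants.\<close>
  define Cf where "Cf = B1 + 2 + 3 / (2 * th)"
  define c3 where "c3 = Cs + \<bar>q\<bar> * sqrt Cs + C / (2 * th)"
  define c4 where "c4 = sigma / (a - 1)"
  have E1: "\<forall>\<^sub>F n in sequentially. Cs \<le> real n * (\<kappa> / 2)" using \<kappa> by real_asymp
  have E2: "\<forall>\<^sub>F n in sequentially. 252 * (ln (real n)) ^ 3 / sqrt (real n) + c4 / real n + 1 / real n \<le> 1 / ln (real n)"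
    by real_asymp
  have E3: "\<forall>\<^sub>F n in sequentially. B1 / ln (real n) \<le> 1" by real_asymp
  have E4: "\<forall>\<^sub>F n in sequentially. ln 2 + 2 * ln (real n) + c3 + ln (real n) + ln (2 * ln (real n)) \<le> sqrt (real n) / ln (real n)"
    by real_asymp
  have "\<forall>\<^sub>F n in sequentially. Rop M (GM a Z) n d eps \<le> RR + sqrt (V / real n) * q + Cf / (sqrt (real n) * ln (real n))"
    using E1 E2 E3 E4 window_asymptotics[OF th \<kappa> C] eventually_ge_at_top[of 3]
  proof eventually_elim
    case (elim n)
    note n = elim(6)
    have n0: "real n > 0" "n > 0" and n1: "real n > 1" using n by auto
    have l0: "ln (real n) > 0" using n1 by simp
    have \<delta>: "\<delta> n > 0" using n0 l0 by (simp add: \<delta>_def)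
    have vn0: "0 \<le> v n" unfolding v_def by (rule sum_nonneg) simp
    have vn: "v n \<le> real n"
    proof -
      have "v n \<le> (\<Sum>k\<in>{1..<n}. 1)"
        unfolding v_def
      proof (rule sum_mono)
        fix k
        have "0 < s n k" unfolding s_def by (rule svar_bounds(3)[OF a s2])
        then have "(min 1 (s n k / th))\<^sup>2 \<le> 1" using th by (intro power_le_one) auto
        then show "1/2 * (min 1 (s n k / th))\<^sup>2 \<le> 1" by simp
      qed
      then show ?thesis by simp
    qed
    have tail: "measure stdN {g. sqrt (v n) * g > t n - \<delta> n} \<le> eps - kq * (B1 / ln (real n))"
    proof -
      have h: "0 \<le> B1 / ln (real n)" using B1 l0 by simp
      have "{g. sqrt (v n) * g > t n - \<delta> n} \<subseteq> {q + B1 / ln (real n)<..}"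
      proof
        fix g assume "g \<in> {g. sqrt (v n) * g > t n - \<delta> n}"
        then have g: "B1 * \<delta> n < sqrt (v n) * (g - q)" by (simp add: t_def algebra_simps)
        have "0 < B1 * \<delta> n" using B1 \<delta> by simp
        then have "0 < sqrt (v n) * (g - q)" using g by linarith
        then have gq: "g - q > 0" using vn0 by (simp add: zero_less_mult_iff)
        \<comment> \<open>The variance is used only through \<open>v n \<le> n\<close>: a deviation
          \<open>B1 * \<delta> n\<close> is \<open>sqrt n * B1 / ln n\<close>, so \<open>g\<close>
          must exceed \<open>q\<close> by more than \<open>B1 / ln n\<close>.\<close>
        have "sqrt (v n) * (g - q) \<le> sqrt (real n) * (g - q)" using vn gq by (intro mult_right_mono) auto
        then have "sqrt (real n) * (B1 / ln (real n)) < sqrt (real n) * (g - q)" using g by (simp add: \<delta>_def mult.commute)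
        then have "B1 / ln (real n) < g - q" using n0 by (simp only: mult_less_cancel_left_pos real_sqrt_gt_zero)
        then show "g \<in> {q + B1 / ln (real n)<..}" by simp
      qed
      then have "measure stdN {g. sqrt (v n) * g > t n - \<delta> n} \<le> measure stdN {q + B1 / ln (real n)<..}"
        by (rule N.finite_measure_mono) simp
      also have "\<dots> = Qfun (q + B1 / ln (real n))" by (rule Qfun_eq[symmetric])
      also have "\<dots> \<le> Qfun q - (B1 / ln (real n)) / (2 * sqrt (2 * pi)) * exp (- (\<bar>q\<bar> + 1)\<^sup>2 / 2)"
        by (rule Qfun_decrease[OF h elim(3)])
      also have "\<dots> = eps - kq * (B1 / ln (real n))"
        using Qfun_Qinv[OF assms(6,7)] by (simp add: q_def kq_def mult_ac)
      finally show ?thesis .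
    qed
    have s3: "sqrt (real n) ^ 3 = real n * sqrt (real n)" using n0 by (simp add: power3_eq_cube)
    have err1: "252 * real n / \<delta> n ^ 3 = 252 * (ln (real n)) ^ 3 / sqrt (real n)"
      unfolding \<delta>_def power_divide s3 using n0 by simp
    have err2: "2 * th\<^sup>2 * real n / (R n)\<^sup>2 = 16 / \<kappa> / ln (real n)"
    proof -
      have R2: "(R n)\<^sup>2 = th\<^sup>2 * \<kappa> / 8 * (real n * ln (real n))"
        unfolding R_def using \<kappa> n0 l0 by simp
      show ?thesis unfolding R2 using th \<kappa> n0 l0 by (simp add: field_simps)
    qed
    have err3: "4 * real n / T n = 4 / ln (real n)" unfolding T_def using n0 by simp
    have kB: "kq * (B1 / ln (real n)) = 16 / \<kappa> / ln (real n) + 4 / ln (real n) + 1 / ln (real n)"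
    proof -
      have "kq * B1 = 16 / \<kappa> + 5" using kq by (simp add: B1_def)
      then have "kq * (B1 / ln (real n)) = (16 / \<kappa> + 5) / ln (real n)" by simp
      then show ?thesis by (simp add: add_divide_distrib)
    qed
    have bound: "Rop M (GM a Z) n d eps \<le> (ln (2 * (real n)\<^sup>2 * a ^ n) + (\<Sum>k\<in>{1..<n}. 1/2 * ln (max 1 (s n k / th))) + t n
        + (C + 3 * \<delta> n) / (2 * th) + ln (real n) + ln (2 * ln (real n))) / real n"
      unfolding s_def
    proof (rule finite_blocklength_bound[OF assms(1) a \<sigma> assms(4,5) assms(7) d(1) th n, where C=C and Vmin="th\<^sup>2 * \<kappa> * real n" and \<delta>="\<delta> n" and R="R n" and T="T n" and t="t n"])
      show "\<bar>real n * d - (d + 2 * (a\<^sup>2 / (a - 1) ^ 4) + 1) - (\<Sum>k\<in>{1..<n}. min th (svar a (sigma\<^sup>2) (freq n k)))\<bar> \<le> C"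
        using S1[OF n0(2)] c0 unfolding s_def C_def c0_def[symmetric] by linarith
      show "0 < th\<^sup>2 * \<kappa> * real n" using th \<kappa> n0 by simp
      show "th\<^sup>2 * \<kappa> * real n \<le> 2 * th\<^sup>2 * (\<Sum>k\<in>{1..<n}. (max 0 (1 - th / svar a (sigma\<^sup>2) (freq n k)))\<^sup>2)"
      proof -
        \<comment> \<open>Half of the linear growth absorbs the constant error \<open>Cs\<close>,
          which explains \<open>Vmin = th\<^sup>2 * \<kappa> * n\<close>.\<close>
        have "real n * (\<kappa> / 2) \<le> (\<Sum>k\<in>{1..<n}. (max 0 (1 - th / s n k))\<^sup>2)"
          using S4[OF n0(2)] elim(1) by (simp add: abs_le_iff)
        then have "2 * th\<^sup>2 * (real n * (\<kappa> / 2)) \<le> 2 * th\<^sup>2 * (\<Sum>k\<in>{1..<n}. (max 0 (1 - th / s n k))\<^sup>2)"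
          by (intro mult_left_mono) auto
        moreover have "2 * th\<^sup>2 * (real n * (\<kappa> / 2)) = th\<^sup>2 * \<kappa> * real n" by simp
        ultimately show ?thesis unfolding s_def by linarith
      qed
      show "\<delta> n > 0" by (rule \<delta>)
      show "R n > 0" unfolding R_def using th \<kappa> n0 l0 by simp
      show "T n > 0" unfolding T_def using n0 l0 by simp
      show "1 / real n \<le> \<delta> n / (sqrt (6 * th\<^sup>2 * T n) * sqrt (2 * pi)) * exp (- (R n + C + 6 * \<delta> n)\<^sup>2 / (2 * (th\<^sup>2 * \<kappa> * real n))) - 36288 * (1 + th ^ 4) * T n / \<delta> n ^ 3"
        using elim(5) unfolding \<delta>_def R_def T_def .
      show "measure stdN {g. sqrt (\<Sum>k\<in>{1..<n}. 1/2 * (min 1 (svar a (sigma\<^sup>2) (freq n k) / th))\<^sup>2) * g > t n - \<delta> n} + 252 * real n / \<delta> n ^ 3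
       + 2 * th\<^sup>2 * real n / (R n)\<^sup>2 + 4 * real n / T n + sigma / (a - 1) / real n + 1 / real n \<le> eps"
        unfolding s_def[symmetric] v_def[symmetric] err1 err2 err3 c4_def[symmetric]
        using tail elim(2) unfolding kB by linarith
    qed
    have lnG: "ln (2 * (real n)\<^sup>2 * a ^ n) = ln 2 + 2 * ln (real n) + real n * ln a"
      using n0 a by (simp add: ln_mult_pos ln_realpow)
    \<comment> \<open>The variances differ by at most \<open>Cs\<close>, hence the standard
      deviations by at most \<open>sqrt Cs\<close>, even if the variances are small.\<close>
    have tb: "t n \<le> sqrt (real n * V) * q + \<bar>q\<bar> * sqrt Cs + (B1 + 1) * \<delta> n"
    proof -
      have "\<bar>sqrt (v n) - sqrt (real n * V)\<bar> \<le> sqrt \<bar>v n - real n * V\<bar>"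
        by (rule sqrt_diff_le[OF vn0]) (use V in simp)
      also have "\<dots> \<le> sqrt Cs" using S3[OF n0(2)] unfolding v_def by simp
      finally have "\<bar>q\<bar> * \<bar>sqrt (v n) - sqrt (real n * V)\<bar> \<le> \<bar>q\<bar> * sqrt Cs" by (rule mult_left_mono) simp
      moreover have "(sqrt (v n) - sqrt (real n * V)) * q \<le> \<bar>q\<bar> * \<bar>sqrt (v n) - sqrt (real n * V)\<bar>"
        using abs_ge_self[of "(sqrt (v n) - sqrt (real n * V)) * q"] by (simp add: abs_mult mult.commute)
      ultimately have "(sqrt (v n) - sqrt (real n * V)) * q \<le> \<bar>q\<bar> * sqrt Cs" by linarith
      then show ?thesis unfolding t_def by (simp add: left_diff_distrib)
    qed
    have Cd: "(C + 3 * \<delta> n) / (2 * th) = C / (2 * th) + 3 / (2 * th) * \<delta> n" by (simp add: add_divide_distrib)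
    have L: "(\<Sum>k\<in>{1..<n}. 1/2 * ln (max 1 (s n k / th))) \<le> real n * RR - real n * ln a + Cs"
      using S2[OF n0(2)] by (simp add: right_diff_distrib abs_le_iff)
    have num: "ln (2 * (real n)\<^sup>2 * a ^ n) + (\<Sum>k\<in>{1..<n}. 1/2 * ln (max 1 (s n k / th))) + t n
        + (C + 3 * \<delta> n) / (2 * th) + ln (real n) + ln (2 * ln (real n)) \<le> real n * RR + sqrt (real n * V) * q + Cf * \<delta> n"
    proof -
      have "Cf * \<delta> n = (B1 + 1) * \<delta> n + 3 / (2 * th) * \<delta> n + \<delta> n" by (simp add: Cf_def distrib_right)
      then show ?thesis using L tb elim(4) unfolding lnG Cd c3_def \<delta>_def[symmetric] by linarith
    qed
    have "Rop M (GM a Z) n d eps \<le> (real n * RR + sqrt (real n * V) * q + Cf * \<delta> n) / real n"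
      using bound divide_right_mono[OF num, of "real n"] by simp
    also have "\<dots> = RR + sqrt (V / real n) * q + Cf / (sqrt (real n) * ln (real n))"
    proof -
      have sn: "sqrt (real n) / real n = 1 / sqrt (real n)" using n0 by (simp add: field_simps)
      have "sqrt (real n * V) * q / real n = (sqrt (real n) / real n) * sqrt V * q" by (simp add: real_sqrt_mult)
      also have "\<dots> = sqrt (V / real n) * q" unfolding sn by (simp add: real_sqrt_divide)
      finally have e1: "sqrt (real n * V) * q / real n = sqrt (V / real n) * q" .
      have "Cf * \<delta> n / real n = Cf * (sqrt (real n) / real n) / ln (real n)" by (simp add: \<delta>_def)
      also have "\<dots> = Cf / (sqrt (real n) * ln (real n))" unfolding sn by simp
      finally have e2: "Cf * \<delta> n / real n = Cf / (sqrt (real n) * ln (real n))" .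
      have e0: "real n * RR / real n = RR" using n0 by simp
      show ?thesis unfolding add_divide_distrib e0 e1 e2 ..
    qed
    finally show ?case .
  qed
  then show ?thesis unfolding RR_def V_def q_def by (rule exI[of _ Cf])
qed

end
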